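(* Assume that the system $g(p,x)\in C$ enjoys Robinson stability at $(\bar p,\bar x)$ and that $S$ is isolatedly calm at $(\bar p,\bar x)$. Suppose moreover that $P=P_1\times P_2$, that $g((p_1,p_2),x)=g((p_1,\bar p_2),x)$ for all $((p_1,p_2),x)\in P\times X$, and that $\nabla_{p_2}f(\bar p,\bar x)$ is surjective. Then condition (C1) holds. If in addition, for all $u\in{\cal K}_{\Gamma(\bar p)}(\bar x,-f(\bar z))$, $$\nabla h(g(\bar z))\nabla^2_xg(\bar z)(u,u)+\nabla^2h(g(\bar z))\big(\nabla_xg(\bar z)u,\nabla_xg(\bar z)u\big)\in\operatorname{rge}\big(\nabla h(g(\bar z))\circ\nabla g(\bar z)\big)+\operatorname{lin}T_C(g(\bar z)),$$ then condition (C2) also holds.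
   Context: Notation: $X=\mathbb R^n$, $P=\mathbb R^m$, $Y=\mathbb R^l$, $Z:=P\times X$, and $E$ is finite-dimensional. Dual spaces are distinguished from primal ones, and $A^*$ is the adjoint of a linear map $A$, and $\operatorname{rge}A$ its range. For a closed convex cone $A$, $\operatorname{lin}A:=A\cap(-A)$. For a closed set $\Omega$ and $\bar z\in\Omega$: the tangent cone is $T_\Omega(\bar z):=\{w:\exists\, t_k\downarrow0,\ w_k\to w \text{ with } \bar z+t_kw_k\in\Omega\}$; the regular normal cone is $N_\Omega(\bar z):=\{z^*:\limsup_{z\to\bar z,\,z\in\Omega}\langle z^*,z-\bar z\rangle/\|z-\bar z\|\le0\}$; and the critical cone is ${\cal K}_\Omega(\bar z,z^* ):=T_\Omega(\bar z)\cap\{z^*\}^\perp$. ${\cal B}_X$ is the closed unit ball. Setting: $g\colon P\times X\to Y$ is $C^2$ around $\bar z=(\bar p,\bar x)$. The set $C\subset Y$ is closed and $C^2$-cone reducible at $g(\bar z)$ to a closed convex cone $K\subset E$: there exist a neighborhood $V$ of $g(\bar z)$ and a $C^2$ map $h\colon V\to E$ with $h(g(\bar z))=0$, $\nabla h(g(\bar z))$ surjective, and $C\cap V=\{y\in V:h(y)\in K\}$. Set $\Gamma(p):=\{x:g(p,x)\in C\}$. The map $f\colon P\times X\to X^*$ is $C^1$ around $\bar z$, and $S(p):=\{x:0\in f(p,x)+N_{\Gamma(p)}(x)\}$ with $\bar x\in S(\bar p)$. Robinson stability of $g(p,x)\in C$ at $(\bar p,\bar x)$: there are $\kappa\ge0$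 and neighborhoods $W$ of $\bar p$ and $U$ of $\bar x$ with ${\rm dist}(x;\Gamma(p))\le\kappa\,{\rm dist}(g(p,x);C)$ on $W\times U$. $S$ is isolatedly calm at $(\bar p,\bar x)$ if there exist $\ell>0$ and neighborhoods $Q$ of $\bar p$ and $U$ of $\bar x$ such that $S(p)\cap U\subset\{\bar x\}+\ell\|p-\bar p\|{\cal B}_X$ for all $p\in Q$. Multipliers: for $\lambda\in N_C(g(\bar z))$, $(\nabla h(g(\bar z))^* )^{-1}\lambda$ denotes the unique $\mu\in E^*$ with $\nabla h(g(\bar z))^*\mu=\lambda$. For $z^*\in Z^*$, set $\Lambda(\bar z,z^* ):=\{\lambda\in N_C(g(\bar z)):\nabla g(\bar z)^*\lambda=z^*\}$, and for $v\in Z$, $$\Lambda(\bar z,z^*;v):=\arg\max_{\lambda\in\Lambda(\bar z,z^* )}\Big(\langle\lambda,\nabla^2g(\bar z)(v,v)\rangle+\nabla^2\langle(\nabla h(g(\bar z))^* )^{-1}\lambda,h(\cdot)\rangle(g(\bar z))\big(\nabla g(\bar z)v,\nabla g(\bar z)v\big)\Big).$$ Further, $\bar\Lambda:=\{\lambda\in N_C(g(\bar z)):f(\bar z)+\nabla_xg(\bar z)^*\lambda=0\}$. For $\lambda\in N_C(g(\bar z))$, define ${\cal H}^x_\lambda u:=\nabla_xg(\bar z)^*\nabla^2\langle(\nabla h(g(\bar z))^* )^{-1}\lambda,h(\cdot)\rangle(g(\bar z))\nabla_xg(\bar z)u$ and ${\cal F}_\lambda u:=\nabla_xf(\bar z)u+\nabla^2_x\langle\lambda,g(\cdot)\rangle(\bar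 z)u+{\cal H}^x_\lambda u$ for $u\in X$. Condition (C1): for every $0\ne u\in{\cal K}_{\Gamma(\bar p)}(\bar x,-f(\bar z))$, every $\lambda\in\bar\Lambda$, and every $\hat\lambda\in\Lambda(\bar z,\nabla g(\bar z)^*\lambda;(0,u))$, either $\langle{\cal F}_{\hat\lambda}u,u\rangle>0$ or $\langle{\cal F}_{\hat\lambda}u,\widetilde u\rangle<0$ for some $\widetilde u\in{\cal K}_{\Gamma(\bar p)}(\bar x,-f(\bar z))$. Condition (C2): for all $0\ne u\in{\cal K}_{\Gamma(\bar p)}(\bar x,-f(\bar z))$ and all $\lambda\in\bar\Lambda$, either $\langle{\cal F}_\lambda u,u\rangle>0$ or $\langle{\cal F}_\lambda u,\widetilde u\rangle<0$ for some $\widetilde u\in{\cal K}_{\Gamma(\bar p)}(\bar x,-f(\bar z))$.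
   Formalization: In the extra condition for (C2), lin T_C(g(z̄)) lies in Y while the rest lies in E, so the sum is ill-typed; it is replaced by its image ∇h(g(z̄)) lin T_C(g(z̄)), which equals lin K. *)

theory Defs
  imports "HOL-Analysis.Analysis"
begin

definition D1 :: "('a::real_normed_vector \<Rightarrow> 'b::real_normed_vector) \<Rightarrow> 'a \<Rightarrow> 'a \<Rightarrow> 'b" where
  "D1 \<phi> z = frechet_derivative \<phi> (at z)"

definition D2 :: "('a::real_normed_vector \<Rightarrow> 'b::real_normed_vector) \<Rightarrow> 'a \<Rightarrow> 'a \<Rightarrow> 'a \<Rightarrow> 'b" where
  "D2 \<phi> z a b = frechet_derivative (\<lambda>y. frechet_derivative \<phi> (at y) b) (at z) a"

definition C1_on :: "'a::euclidean_space set \<Rightarrow> ('a \<Rightarrow> 'b::euclidean_space) \<Rightarrow> bool" where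
  "C1_on U \<phi> \<longleftrightarrow> open U \<and> (\<forall>y\<in>U. \<phi> differentiable (at y))
     \<and> (\<forall>b. continuous_on U (\<lambda>y. frechet_derivative \<phi> (at y) b))"

definition C2_on :: "'a::euclidean_space set \<Rightarrow> ('a \<Rightarrow> 'b::euclidean_space) \<Rightarrow> bool" where
  "C2_on U \<phi> \<longleftrightarrow> open U \<and> (\<forall>y\<in>U. \<phi> differentiable (at y))
     \<and> (\<forall>b. \<forall>y\<in>U. (\<lambda>w. frechet_derivative \<phi> (at w) b) differentiable (at y))
     \<and> (\<forall>a b. continuous_on U (\<lambda>y. D2 \<phi> y a b))"

definition C1_around :: "('a::euclidean_space \<Rightarrow> 'b::euclidean_space) \<Rightarrow> 'a \<Rightarrow> bool" where
  "C1_around \<phi> z \<longleftrightarrow> (\<exists>U. z \<in> U \<and> C1_on U \<phi>)"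

definition C2_around :: "('a::euclidean_space \<Rightarrow> 'b::euclidean_space) \<Rightarrow> 'a \<Rightarrow> bool" where
  "C2_around \<phi> z \<longleftrightarrow> (\<exists>U. z \<in> U \<and> C2_on U \<phi>)"

(* Dual spaces are identified with the primal (Euclidean) spaces via the inner product.
  The vector representing a linear functional: *)

definition dual_vec :: "('a::euclidean_space \<Rightarrow> real) \<Rightarrow> 'a" where
  "dual_vec l = (\<Sum>b\<in>Basis. l b *\<^sub>R b)"

definition hess_op :: "('a::euclidean_space \<Rightarrow> real) \<Rightarrow> 'a \<Rightarrow> 'a \<Rightarrow> 'a" where
  "hess_op \<phi> z a = dual_vec (\<lambda>b. D2 \<phi> z a b)"

definition tangent_cone :: "'a::real_normed_vector set \<Rightarrow> 'a \<Rightarrow> 'a set" where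
  "tangent_cone \<Omega> z = {w. \<exists>t wk. (\<forall>k. t k > 0) \<and> t \<longlonglongrightarrow> 0 \<and> wk \<longlonglongrightarrow> w
                              \<and> (\<forall>k. z + t k *\<^sub>R wk k \<in> \<Omega>)}"

(* Regular normal cone; limsup condition written out; empty outside \<Omega>. *)

definition regular_normal_cone :: "'a::real_inner set \<Rightarrow> 'a \<Rightarrow> 'a set" where
  "regular_normal_cone \<Omega> z = {v. z \<in> \<Omega> \<and>
     (\<forall>\<epsilon>>0. \<exists>\<delta>>0. \<forall>y\<in>\<Omega>. norm (y - z) < \<delta> \<longrightarrow> v \<bullet> (y - z) \<le> \<epsilon> * norm (y - z))}"

definition critical_cone :: "'a::real_inner set \<Rightarrow> 'a \<Rightarrow> 'a \<Rightarrow> 'a set" where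
  "critical_cone \<Omega> z zs = tangent_cone \<Omega> z \<inter> {w. zs \<bullet> w = 0}"

definition lin_cone :: "'a::real_vector set \<Rightarrow> 'a set" where
  "lin_cone A = A \<inter> uminus ` A"

definition Gamma :: "('p \<times> 'x \<Rightarrow> 'y) \<Rightarrow> 'y set \<Rightarrow> 'p \<Rightarrow> 'x set" where
  "Gamma g C p = {x. g (p, x) \<in> C}"

definition Ssol :: "('p \<times> 'x \<Rightarrow> 'x::real_inner) \<Rightarrow> ('p \<times> 'x \<Rightarrow> 'y) \<Rightarrow> 'y set \<Rightarrow> 'p \<Rightarrow> 'x set" where
  "Ssol f g C p = {x. - f (p, x) \<in> regular_normal_cone (Gamma g C p) x}"

(* Robinson stability. Since dist(x; \<emptyset>) = +\<infinity> in the paper but infdist x {} = 0 in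
  Isabelle, nonemptiness of \<Gamma>(p) (implied by the paper's inequality) is made explicit. *)

definition robinson_stable ::
  "('p::real_normed_vector \<times> 'x::real_normed_vector \<Rightarrow> 'y::real_normed_vector) \<Rightarrow> 'y set \<Rightarrow> 'p \<Rightarrow> 'x \<Rightarrow> bool" where
  "robinson_stable g C pb xb \<longleftrightarrow> (\<exists>\<kappa>\<ge>0. \<exists>W U. open W \<and> pb \<in> W \<and> open U \<and> xb \<in> U \<and>
     (\<forall>p\<in>W. \<forall>x\<in>U. Gamma g C p \<noteq> {} \<and> infdist x (Gamma g C p) \<le> \<kappa> * infdist (g (p, x)) C))"

definition isolatedly_calm :: "('p::real_normed_vector \<Rightarrow> 'x::real_normed_vector set) \<Rightarrow> 'p \<Rightarrow> 'x \<Rightarrow> bool" where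
  "isolatedly_calm S pb xb \<longleftrightarrow> (\<exists>l>0. \<exists>Q U. open Q \<and> pb \<in> Q \<and> open U \<and> xb \<in> U \<and>
     (\<forall>p\<in>Q. S p \<inter> U \<subseteq> cball xb (l * norm (p - pb))))"

definition mu_of :: "('y::euclidean_space \<Rightarrow> 'e::euclidean_space) \<Rightarrow> 'y \<Rightarrow> 'y \<Rightarrow> 'e" where
  "mu_of h y lam = (THE mu. adjoint (D1 h y) mu = lam)"

definition Lambda ::
  "('z::euclidean_space \<Rightarrow> 'y::euclidean_space) \<Rightarrow> 'y set \<Rightarrow> 'z \<Rightarrow> 'z \<Rightarrow> 'y set" where
  "Lambda g C zb zs = {lam \<in> regular_normal_cone C (g zb). adjoint (D1 g zb) lam = zs}"

definition Lambda_dir ::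
  "('z::euclidean_space \<Rightarrow> 'y::euclidean_space) \<Rightarrow> 'y set \<Rightarrow> ('y \<Rightarrow> 'e::euclidean_space)
     \<Rightarrow> 'z \<Rightarrow> 'z \<Rightarrow> 'z \<Rightarrow> 'y set" where
  "Lambda_dir g C h zb zs v =
     (let val = (\<lambda>lam. lam \<bullet> D2 g zb v v
                   + D2 (\<lambda>y. mu_of h (g zb) lam \<bullet> h y) (g zb) (D1 g zb v) (D1 g zb v))
      in {lam \<in> Lambda g C zb zs. \<forall>lam' \<in> Lambda g C zb zs. val lam' \<le> val lam})"

definition Lambda_bar ::
  "('p::euclidean_space \<times> 'x::euclidean_space \<Rightarrow> 'x) \<Rightarrow> ('p \<times> 'x \<Rightarrow> 'y::euclidean_space)
     \<Rightarrow> 'y set \<Rightarrow> 'p \<Rightarrow> 'x \<Rightarrow> 'y set" where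
  "Lambda_bar f g C pb xb = {lam \<in> regular_normal_cone C (g (pb, xb)).
      f (pb, xb) + adjoint (D1 (\<lambda>x. g (pb, x)) xb) lam = 0}"

definition Hx ::
  "('p::euclidean_space \<times> 'x::euclidean_space \<Rightarrow> 'y::euclidean_space) \<Rightarrow> ('y \<Rightarrow> 'e::euclidean_space)
     \<Rightarrow> 'p \<Rightarrow> 'x \<Rightarrow> 'y \<Rightarrow> 'x \<Rightarrow> 'x" where
  "Hx g h pb xb lam u =
     adjoint (D1 (\<lambda>x. g (pb, x)) xb)
       (hess_op (\<lambda>y. mu_of h (g (pb, xb)) lam \<bullet> h y) (g (pb, xb)) (D1 (\<lambda>x. g (pb, x)) xb u))"

definition Fop ::
  "('p::euclidean_space \<times> 'x::euclidean_space \<Rightarrow> 'x) \<Rightarrow> ('p \<times> 'x \<Rightarrow> 'y::euclidean_space)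
     \<Rightarrow> ('y \<Rightarrow> 'e::euclidean_space) \<Rightarrow> 'p \<Rightarrow> 'x \<Rightarrow> 'y \<Rightarrow> 'x \<Rightarrow> 'x" where
  "Fop f g h pb xb lam u =
     D1 (\<lambda>x. f (pb, x)) xb u + hess_op (\<lambda>x. lam \<bullet> g (pb, x)) xb u + Hx g h pb xb lam u"

definition cond_C1 ::
  "('p::euclidean_space \<times> 'x::euclidean_space \<Rightarrow> 'x) \<Rightarrow> ('p \<times> 'x \<Rightarrow> 'y::euclidean_space)
     \<Rightarrow> 'y set \<Rightarrow> ('y \<Rightarrow> 'e::euclidean_space) \<Rightarrow> 'p \<Rightarrow> 'x \<Rightarrow> bool" where
  "cond_C1 f g C h pb xb \<longleftrightarrow>
    (\<forall>u \<in> critical_cone (Gamma g C pb) xb (- f (pb, xb)). u \<noteq> 0 \<longrightarrow>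
      (\<forall>lam \<in> Lambda_bar f g C pb xb.
        \<forall>lamh \<in> Lambda_dir g C h (pb, xb) (adjoint (D1 g (pb, xb)) lam) (0, u).
          Fop f g h pb xb lamh u \<bullet> u > 0 \<or>
          (\<exists>ut \<in> critical_cone (Gamma g C pb) xb (- f (pb, xb)). Fop f g h pb xb lamh u \<bullet> ut < 0)))"

definition cond_C2 ::
  "('p::euclidean_space \<times> 'x::euclidean_space \<Rightarrow> 'x) \<Rightarrow> ('p \<times> 'x \<Rightarrow> 'y::euclidean_space)
     \<Rightarrow> 'y set \<Rightarrow> ('y \<Rightarrow> 'e::euclidean_space) \<Rightarrow> 'p \<Rightarrow> 'x \<Rightarrow> bool" where
  "cond_C2 f g C h pb xb \<longleftrightarrow>
    (\<forall>u \<in> critical_cone (Gamma g C pb) xb (- f (pb, xb)). u \<noteq> 0 \<longrightarrow>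
      (\<forall>lam \<in> Lambda_bar f g C pb xb.
          Fop f g h pb xb lam u \<bullet> u > 0 \<or>
          (\<exists>ut \<in> critical_cone (Gamma g C pb) xb (- f (pb, xb)). Fop f g h pb xb lam u \<bullet> ut < 0)))"

(* The additional hypothesis for (C2); lin T_C(g(zb)) is transported to E by \<nabla>h(g(zb)). *)

definition extra_cond ::
  "('p::euclidean_space \<times> 'x::euclidean_space \<Rightarrow> 'x) \<Rightarrow> ('p \<times> 'x \<Rightarrow> 'y::euclidean_space)
     \<Rightarrow> 'y set \<Rightarrow> ('y \<Rightarrow> 'e::euclidean_space) \<Rightarrow> 'p \<Rightarrow> 'x \<Rightarrow> bool" where
  "extra_cond f g C h pb xb \<longleftrightarrow>
    (\<forall>u \<in> critical_cone (Gamma g C pb) xb (- f (pb, xb)).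
       D1 h (g (pb, xb)) (D2 (\<lambda>x. g (pb, x)) xb u u)
         + D2 h (g (pb, xb)) (D1 (\<lambda>x. g (pb, x)) xb u) (D1 (\<lambda>x. g (pb, x)) xb u)
       \<in> {a + b | a b. a \<in> range (D1 h (g (pb, xb)) \<circ> D1 g (pb, xb))
                    \<and> b \<in> D1 h (g (pb, xb)) ` lin_cone (tangent_cone C (g (pb, xb)))})"

end

theory Submission
  imports Defs
begin

text \<open>Put \<open>G = h \<circ> g\<close>, so that locally \<open>\<Gamma>(p) = {x. G (p, x) \<in> K}\<close>. If (C1) fails at \<open>u\<close> with multiplier
  \<open>\<mu>\<close>, then \<open>\<xi> = - F u\<close> lies in the polar of the critical cone and is orthogonal to \<open>u\<close>. Maximality of
  \<open>\<mu>\<close> is dualised to a second-order correction \<open>v\<close>; by Robinson stability it yields points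
  \<open>p = pb + O(t\<^sup>2)\<close> and \<open>x \<in> \<Gamma>(p)\<close>, \<open>x = xb + t u + o(t)\<close>, with \<open>\<mu> \<bullet> G (p, x) \<ge> - o(t\<^sup>2)\<close>. Such \<open>x\<close> are almost
  optimal for a proximal minimisation problem over \<open>\<Gamma>(p)\<close>, and the exact minimisers, at distance
  \<open>o(t)\<close>, carry normals equal to \<open>- f - t f\<^sub>x u\<close> up to \<open>o(t)\<close>. The residual \<open>o(t)\<close> is absorbed by
  moving \<open>p\<^sub>2\<close>, which does not change \<open>\<Gamma>(p)\<close>. So there are solutions at distance about \<open>t |u|\<close> from \<open>xb\<close>
  for parameters at distance \<open>o(t)\<close> from \<open>pb\<close>, against isolated calmness. Under the extra condition the
  objective defining the directional multipliers is constant, so that (C1) becomes (C2).\<close>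

section \<open>Second-order calculus\<close>

text \<open>The multipliers compared in (C1) share the whole vector
  \<open>adjoint (D1 g (pb, xb)) lam\<close>, its parameter part included. The primal variable dual
  to this constraint is therefore a vector of the full product space, which is why the correction of
  the arc moves the parameter as well as x. It does so at order t^2, negligible against the order t
  of x - xb. The obstacle is that neither the dual solution nor the normals along the arc are
  available exactly. So there is no extremal curve, only, for each \<epsilon>, one point at which
  all errors are multiples of \<epsilon>; \<epsilon> is chosen last, against |u| and the calmness
  modulus. A feasible arc alone does not produce normals near the required vector. The proximal term
  does, provided that its weight exceeds the curvature of \<mu> . G in x, a function that need not
  be convex. The deviation d of the minimiser from the arc, divided by t, then clusters only at 0:
  for a cluster point w the direction u + w is again critical, and the violated condition gives
  \<xi> . w \<le> 0.\<close>

definition twice_diff_at :: "('a::euclidean_space \<Rightarrow> 'b::euclidean_space) \<Rightarrow> 'a \<Rightarrow> bool" where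
  "twice_diff_at \<phi> z \<longleftrightarrow> (\<forall>\<^sub>F y in nhds z. \<phi> differentiable (at y))
     \<and> (\<forall>b. (\<lambda>y. D1 \<phi> y b) differentiable (at z))"

lemma D1_has_derivative: "\<phi> differentiable (at z) \<Longrightarrow> (\<phi> has_derivative D1 \<phi> z) (at z)"
  unfolding D1_def by (simp add: frechet_derivative_works)

lemma D1_eqI: "(\<phi> has_derivative D) (at z) \<Longrightarrow> D1 \<phi> z = D"
  unfolding D1_def using frechet_derivative_at by metis

lemma linear_D1: "\<phi> differentiable (at z) \<Longrightarrow> linear (D1 \<phi> z)"
  using D1_has_derivative has_derivative_linear by blast

lemma D2_eq_D1: "D2 \<phi> z a b = D1 (\<lambda>y. D1 \<phi> y b) z a"
  by (simp add: D2_def D1_def)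

lemma D2_has_derivative:
  "twice_diff_at \<phi> z \<Longrightarrow> ((\<lambda>y. D1 \<phi> y b) has_derivative (\<lambda>a. D2 \<phi> z a b)) (at z)"
  unfolding D2_eq_D1 twice_diff_at_def by (metis D1_has_derivative)

lemma has_derivative_transform_nhds:
  assumes "(\<psi> has_derivative D) (at z)" "\<forall>\<^sub>F y in nhds z. \<phi> y = \<psi> y"
  shows "(\<phi> has_derivative D) (at z)"
proof -
  obtain S where S: "open S" "z \<in> S" "\<And>y. y \<in> S \<Longrightarrow> \<phi> y = \<psi> y"
    using assms(2) unfolding eventually_nhds by blast
  show ?thesis
    by (rule has_derivative_transform_within_open[OF assms(1) S(1,2)]) (use S(3) in auto)
qed

lemma D2_eqI:
  assumes "\<forall>\<^sub>F y in nhds z. D1 \<phi> y b = \<psi> y" "(\<psi> has_derivative D) (at z)"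
  shows "D2 \<phi> z a b = D a"
  unfolding D2_eq_D1
  using D1_eqI[OF has_derivative_transform_nhds[OF assms(2,1)]] by simp

lemma twice_diff_atI:
  assumes "\<forall>\<^sub>F y in nhds z. (\<phi> has_derivative M y) (at y)"
    and "\<And>b. ((\<lambda>y. M y b) has_derivative N b) (at z)"
  shows "twice_diff_at \<phi> z" "D2 \<phi> z a b = N b a"
proof -
  have ev: "\<forall>\<^sub>F y in nhds z. D1 \<phi> y b = M y b" for b
    using assms(1) by eventually_elim (simp add: D1_eqI)
  have "((\<lambda>y. D1 \<phi> y b) has_derivative N b) (at z)" for b
    by (rule has_derivative_transform_nhds[OF assms(2) ev])
  moreover have "\<forall>\<^sub>F y in nhds z. \<phi> differentiable (at y)"
    using assms(1) by eventually_elim (auto simp: differentiable_def)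
  ultimately show "twice_diff_at \<phi> z"
    unfolding twice_diff_at_def differentiable_def by blast
  show "D2 \<phi> z a b = N b a"
    by (rule D2_eqI[OF ev assms(2)])
qed

lemma C2_on_imp_twice_diff_at: "C2_on U \<phi> \<Longrightarrow> z \<in> U \<Longrightarrow> twice_diff_at \<phi> z"
  unfolding C2_on_def twice_diff_at_def D1_def eventually_nhds by blast

lemma C2_on_imp_C1_on: "C2_on U \<phi> \<Longrightarrow> C1_on U \<phi>"
  unfolding C2_on_def C1_on_def
  by (meson continuous_at_imp_continuous_on differentiable_imp_continuous_within)

lemma twice_diff_at_imp_differentiable: "twice_diff_at \<phi> z \<Longrightarrow> \<phi> differentiable (at z)"
  unfolding twice_diff_at_def using eventually_nhds_x_imp_x by blast

lemma linear_D2_left: "twice_diff_at \<phi> z \<Longrightarrow> linear (\<lambda>a. D2 \<phi> z a b)"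
  using D2_has_derivative has_derivative_linear by blast

text \<open>The second slot is the argument of the first derivative. Linearity in it holds at every
  point y near z, and differentiating these identities in y transfers it to
  \<open>D2\<close>.\<close>

lemma linear_D2_right:
  assumes "twice_diff_at \<phi> z" shows "linear (D2 \<phi> z a)"
proof -
  have ev: "\<forall>\<^sub>F y in nhds z. linear (D1 \<phi> y)"
    using assms unfolding twice_diff_at_def by (auto elim!: eventually_mono intro: linear_D1)
  show ?thesis
  proof (rule linearI)
    fix b c
    have "\<forall>\<^sub>F y in nhds z. D1 \<phi> y (b + c) = D1 \<phi> y b + D1 \<phi> y c"
      using ev by eventually_elim (simp add: linear_add)
    from D2_eqI[OF this has_derivative_add[OF D2_has_derivative D2_has_derivative], OF assms assms]
    show "D2 \<phi> z a (b + c) = D2 \<phi> z a b + D2 \<phi> z a c" .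
  next
    fix r b
    have "\<forall>\<^sub>F y in nhds z. D1 \<phi> y (r *\<^sub>R b) = r *\<^sub>R D1 \<phi> y b"
      using ev by eventually_elim (simp add: linear_cmul)
    from D2_eqI[OF this has_derivative_scaleR_right[OF D2_has_derivative], OF assms]
    show "D2 \<phi> z a (r *\<^sub>R b) = r *\<^sub>R D2 \<phi> z a b" .
  qed
qed

lemma linear_eq_sum_Basis:
  fixes L :: "'a::euclidean_space \<Rightarrow> 'b::real_vector"
  assumes "linear L"
  shows "L v = (\<Sum>i\<in>Basis. (v \<bullet> i) *\<^sub>R L i)"
proof -
  have "L v = L (\<Sum>i\<in>Basis. (v \<bullet> i) *\<^sub>R i)" by (simp add: euclidean_representation)
  also have "\<dots> = (\<Sum>i\<in>Basis. (v \<bullet> i) *\<^sub>R L i)"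
    using assms by (simp add: linear_sum linear_cmul)
  finally show ?thesis .
qed

lemma linear_norm_le_Basis:
  fixes L :: "'a::euclidean_space \<Rightarrow> 'b::real_normed_vector" and c :: real
  assumes "linear L" "\<And>i. i \<in> Basis \<Longrightarrow> norm (L i) \<le> c"
  shows "norm (L b) \<le> DIM('a) * c * norm b"
proof -
  have "norm (L b) = norm (\<Sum>i\<in>Basis. (b \<bullet> i) *\<^sub>R L i)"
    by (rule arg_cong[OF linear_eq_sum_Basis[OF assms(1)]])
  also have "\<dots> \<le> (\<Sum>i\<in>(Basis::'a set). norm b * c)"
  proof (rule sum_norm_le)
    fix i :: 'a assume i: "i \<in> Basis"
    show "norm ((b \<bullet> i) *\<^sub>R L i) \<le> norm b * c"
      unfolding norm_scaleR by (rule mult_mono[OF Basis_le_norm[OF i] assms(2)[OF i]]) auto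
  qed
  finally show ?thesis by (simp add: mult_ac)
qed

text \<open>Differentiability of the first derivative is known for one direction b at a time. The
  finitely many basis directions share a neighborhood, and linearity in b then makes the estimate
  uniform; this costs a factor DIM('a), which \<open>c\<close> divides out in advance.\<close>

lemma D1_expansion:
  fixes \<phi> :: "'a::euclidean_space \<Rightarrow> 'b::euclidean_space"
  assumes "twice_diff_at \<phi> z" "\<eta> > 0"
  obtains \<delta> where "\<delta> > 0" "\<And>y. norm (y - z) < \<delta> \<Longrightarrow> \<phi> differentiable (at y)"
    "\<And>y b. norm (y - z) < \<delta> \<Longrightarrow>
      norm (D1 \<phi> y b - D1 \<phi> z b - D2 \<phi> z (y - z) b) \<le> \<eta> * norm (y - z) * norm b"
proof -
  define c where "c = \<eta> / DIM('a)"
  have c: "c > 0" using assms(2) by (simp add: c_def)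
  have "\<forall>\<^sub>F y in nhds z. norm (D1 \<phi> y b - D1 \<phi> z b - D2 \<phi> z (y - z) b) \<le> c * norm (y - z)" for b
    using D2_has_derivative[OF assms(1), of b] c
    unfolding has_derivative_at_alt eventually_nhds_metric dist_norm by blast
  then have "\<forall>\<^sub>F y in nhds z. \<forall>b\<in>Basis.
      norm (D1 \<phi> y b - D1 \<phi> z b - D2 \<phi> z (y - z) b) \<le> c * norm (y - z)"
    by (simp add: eventually_ball_finite_distrib)
  moreover have "\<forall>\<^sub>F y in nhds z. \<phi> differentiable (at y)"
    using assms(1) unfolding twice_diff_at_def by blast
  ultimately have "\<forall>\<^sub>F y in nhds z. \<phi> differentiable (at y) \<and> (\<forall>b\<in>Basis.
      norm (D1 \<phi> y b - D1 \<phi> z b - D2 \<phi> z (y - z) b) \<le> c * norm (y - z))"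
    by eventually_elim blast
  then obtain \<delta> where \<delta>: "\<delta> > 0" "\<And>y. norm (y - z) < \<delta> \<Longrightarrow> \<phi> differentiable (at y)"
    "\<And>y b. norm (y - z) < \<delta> \<Longrightarrow> b \<in> Basis \<Longrightarrow>
      norm (D1 \<phi> y b - D1 \<phi> z b - D2 \<phi> z (y - z) b) \<le> c * norm (y - z)"
    unfolding eventually_nhds_metric dist_norm by blast
  show ?thesis
  proof (rule that[OF \<delta>(1,2)])
    fix y b assume y: "norm (y - z) < \<delta>"
    have "linear (\<lambda>b. D1 \<phi> y b - D1 \<phi> z b - D2 \<phi> z (y - z) b)"
      using \<delta>(1,2) y assms(1)
      by (intro linear_compose_sub linear_D1 linear_D2_right) auto
    from linear_norm_le_Basis[OF this \<delta>(3)[OF y]]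
    show "norm (D1 \<phi> y b - D1 \<phi> z b - D2 \<phi> z (y - z) b) \<le> \<eta> * norm (y - z) * norm b"
      by (simp add: c_def)
  qed
qed

lemma Taylor_Young:
  fixes \<phi> :: "'a::euclidean_space \<Rightarrow> 'b::euclidean_space"
  assumes "twice_diff_at \<phi> z" "\<eta> > 0"
  obtains \<delta> where "\<delta> > 0" "\<And>w. norm w < \<delta> \<Longrightarrow>
      norm (\<phi> (z + w) - \<phi> z - D1 \<phi> z w - (1/2) *\<^sub>R D2 \<phi> z w w) \<le> \<eta> * (norm w)\<^sup>2"
proof -
  obtain \<delta> where \<delta>: "\<delta> > 0" "\<And>y. norm (y - z) < \<delta> \<Longrightarrow> \<phi> differentiable (at y)"
    "\<And>y b. norm (y - z) < \<delta> \<Longrightarrow>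
      norm (D1 \<phi> y b - D1 \<phi> z b - D2 \<phi> z (y - z) b) \<le> \<eta> * norm (y - z) * norm b"
    using D1_expansion[OF assms] by blast
  show ?thesis
  proof (rule that[OF \<delta>(1)])
    fix w :: 'a assume w: "norm w < \<delta>"
    \<comment> \<open>With the second-order polynomial subtracted along the segment, the derivative
      at s is the remainder of \<open>D1_expansion\<close> at z + s w in direction w, hence at most
      \<eta> |w|^2, and the mean value inequality on [0, 1] applies.\<close>
    define \<psi> where "\<psi> s = \<phi> (z + s *\<^sub>R w) - s *\<^sub>R D1 \<phi> z w - (s\<^sup>2/2) *\<^sub>R D2 \<phi> z w w" for s
    have near: "norm (z + s *\<^sub>R w - z) < \<delta>" if "0 \<le> s" "s \<le> 1" for s
    proof -
      have "\<bar>s\<bar> * norm w \<le> norm w" using that by (simp add: mult_left_le_one_le)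
      then show ?thesis using w by simp
    qed
    have der: "(\<psi> has_vector_derivative
        (D1 \<phi> (z + s *\<^sub>R w) w - D1 \<phi> z w - s *\<^sub>R D2 \<phi> z w w)) (at s)" if "0 \<le> s" "s \<le> 1" for s
    proof -
      have d: "(\<phi> has_derivative D1 \<phi> (z + s *\<^sub>R w)) (at (z + s *\<^sub>R w))"
        using D1_has_derivative \<delta>(2) near[OF that] by blast
      have "((\<lambda>s. z + s *\<^sub>R w) has_derivative (\<lambda>h. h *\<^sub>R w)) (at s)"
        by (auto intro!: derivative_eq_intros)
      from diff_chain_at[OF this d]
      have "((\<lambda>s. \<phi> (z + s *\<^sub>R w)) has_vector_derivative D1 \<phi> (z + s *\<^sub>R w) w) (at s)"
        unfolding has_vector_derivative_def o_def
        using has_derivative_linear[OF d] by (simp add: linear_cmul)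
      moreover have "((\<lambda>s. s *\<^sub>R D1 \<phi> z w) has_vector_derivative D1 \<phi> z w) (at s)"
        unfolding has_vector_derivative_def by (auto intro!: derivative_eq_intros)
      moreover have "((\<lambda>s. (s\<^sup>2/2) *\<^sub>R D2 \<phi> z w w) has_vector_derivative s *\<^sub>R D2 \<phi> z w w) (at s)"
        unfolding has_vector_derivative_def by (auto intro!: derivative_eq_intros simp: mult_ac)
      ultimately show ?thesis
        unfolding \<psi>_def by (intro has_vector_derivative_diff)
    qed
    have "norm (\<psi> 1 - \<psi> 0) \<le> \<eta> * (norm w)\<^sup>2 * 1 - \<eta> * (norm w)\<^sup>2 * 0"
    proof (rule differentiable_bound_general[OF zero_less_one])
      show "continuous_on {0..1} \<psi>"
        using der by (intro continuous_at_imp_continuous_on ballI)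
          (auto dest: has_vector_derivative_continuous)
      show "continuous_on {0..1} (\<lambda>s. \<eta> * (norm w)\<^sup>2 * s)" by (intro continuous_intros)
    next
      fix s :: real assume s: "0 < s" "s < 1"
      show "(\<psi> has_vector_derivative (D1 \<phi> (z + s *\<^sub>R w) w - D1 \<phi> z w - s *\<^sub>R D2 \<phi> z w w)) (at s)"
        using der s by simp
      show "((\<lambda>s. \<eta> * (norm w)\<^sup>2 * s) has_vector_derivative \<eta> * (norm w)\<^sup>2) (at s)"
        unfolding has_vector_derivative_def by (auto intro!: derivative_eq_intros)
      have "norm (D1 \<phi> (z + s *\<^sub>R w) w - D1 \<phi> z w - s *\<^sub>R D2 \<phi> z w w) \<le> \<eta> * norm (s *\<^sub>R w) * norm w"
        using \<delta>(3)[OF near, of s w] s linear_cmul[OF linear_D2_left[OF assms(1), of w], of s w] by simp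
      also have "\<dots> = s * (\<eta> * (norm w)\<^sup>2)" using s by (simp add: power2_eq_square)
      also have "\<dots> \<le> \<eta> * (norm w)\<^sup>2"
        using s assms(2) by (intro mult_left_le_one_le) auto
      finally show "norm (D1 \<phi> (z + s *\<^sub>R w) w - D1 \<phi> z w - s *\<^sub>R D2 \<phi> z w w) \<le> \<eta> * (norm w)\<^sup>2" .
    qed
    then show "norm (\<phi> (z + w) - \<phi> z - D1 \<phi> z w - (1/2) *\<^sub>R D2 \<phi> z w w) \<le> \<eta> * (norm w)\<^sup>2"
      by (simp add: \<psi>_def algebra_simps)
  qed
qed

lemma twice_diff_at_compose:
  fixes g :: "'a::euclidean_space \<Rightarrow> 'b::euclidean_space" and h :: "'b \<Rightarrow> 'c::euclidean_space"
  assumes g: "twice_diff_at g z" and h: "twice_diff_at h (g z)"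
  shows "twice_diff_at (h \<circ> g) z" "D1 (h \<circ> g) z a = D1 h (g z) (D1 g z a)"
    "D2 (h \<circ> g) z a b = D2 h (g z) (D1 g z a) (D1 g z b) + D1 h (g z) (D2 g z a b)"
proof -
  have gd: "(g has_derivative D1 g z) (at z)"
    using g D1_has_derivative twice_diff_at_imp_differentiable by blast
  then have "g \<midarrow>z\<rightarrow> g z" using has_derivative_continuous isCont_def by blast
  then have "filterlim g (nhds (g z)) (nhds z)" by (simp add: tendsto_nhds_iff)
  then have ev: "\<forall>\<^sub>F y in nhds z. h differentiable (at (g y))"
    using h filterlim_iff unfolding twice_diff_at_def by blast
  have evg: "\<forall>\<^sub>F y in nhds z. g differentiable (at y)" using g unfolding twice_diff_at_def by blast
  \<comment> \<open>The composite derivative is expanded over \<open>Basis\<close>, so that the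
    operator at the moving point g y acts on fixed vectors only and each summand is a product to
    which the Leibniz rule applies.\<close>
  let ?M = "\<lambda>y b. \<Sum>i\<in>Basis. (D1 g y b \<bullet> i) *\<^sub>R D1 h (g y) i"
  let ?N = "\<lambda>b a. \<Sum>i\<in>Basis. (D1 g z b \<bullet> i) *\<^sub>R D2 h (g z) (D1 g z a) i
     + (D2 g z a b \<bullet> i) *\<^sub>R D1 h (g z) i"
  have rep: "L v = (\<Sum>i\<in>Basis. (v \<bullet> i) *\<^sub>R L i)" if "linear L" for L :: "'b \<Rightarrow> 'c" and v
    using that by (rule linear_eq_sum_Basis)
  have M: "\<forall>\<^sub>F y in nhds z. ((h \<circ> g) has_derivative ?M y) (at y)"
    using ev evg
  proof eventually_elim
    case (elim y)
    have "?M y = D1 h (g y) \<circ> D1 g y"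
      unfolding o_def by (intro ext rep[OF linear_D1[OF elim(1)], symmetric])
    then show ?case
      using diff_chain_at[OF D1_has_derivative[OF elim(2)] D1_has_derivative[OF elim(1)]] by simp
  qed
  have N: "((\<lambda>y. ?M y b) has_derivative ?N b) (at z)" for b
  proof (intro has_derivative_sum)
    fix i :: 'b assume "i \<in> Basis"
    have "((\<lambda>y. D1 h (g y) i) has_derivative (\<lambda>a. D2 h (g z) (D1 g z a) i)) (at z)"
      using diff_chain_at[OF gd D2_has_derivative[OF h, of i]] by (simp add: o_def)
    moreover have "((\<lambda>y. D1 g y b \<bullet> i) has_derivative (\<lambda>a. D2 g z a b \<bullet> i)) (at z)"
      using D2_has_derivative[OF g] by (intro has_derivative_inner_left)
    ultimately show "((\<lambda>y. (D1 g y b \<bullet> i) *\<^sub>R D1 h (g y) i) has_derivative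
        (\<lambda>a. (D1 g z b \<bullet> i) *\<^sub>R D2 h (g z) (D1 g z a) i + (D2 g z a b \<bullet> i) *\<^sub>R D1 h (g z) i)) (at z)"
      by (rule has_derivative_scaleR[rotated])
  qed
  show "twice_diff_at (h \<circ> g) z" by (rule twice_diff_atI[OF M N])
  have "D1 (h \<circ> g) z = D1 h (g z) \<circ> D1 g z"
    by (rule D1_eqI) (intro diff_chain_at gd D1_has_derivative twice_diff_at_imp_differentiable h)
  then show "D1 (h \<circ> g) z a = D1 h (g z) (D1 g z a)" by simp
  have "D2 (h \<circ> g) z a b = ?N b a" by (rule twice_diff_atI[OF M N])
  also have "\<dots> = D2 h (g z) (D1 g z a) (D1 g z b) + D1 h (g z) (D2 g z a b)"
    unfolding sum.distrib
      rep[OF linear_D2_right[OF h, of "D1 g z a"], of "D1 g z b"]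
      rep[OF linear_D1[OF twice_diff_at_imp_differentiable[OF h]], of "D2 g z a b"] ..
  finally show "D2 (h \<circ> g) z a b = D2 h (g z) (D1 g z a) (D1 g z b) + D1 h (g z) (D2 g z a b)" .
qed

lemma twice_diff_at_affine:
  assumes "linear L"
  shows "twice_diff_at (\<lambda>x. c + L x) z" "D1 (\<lambda>x. c + L x) z = L" "D2 (\<lambda>x. c + L x) z a b = 0"
proof -
  have d: "((\<lambda>x. c + L x) has_derivative L) (at y)" for y
    using linear_imp_has_derivative[OF assms, of "at y"] by (auto intro!: derivative_eq_intros)
  have ev: "\<forall>\<^sub>F y in nhds z. ((\<lambda>x. c + L x) has_derivative L) (at y)" using d by simp
  have "((\<lambda>y. L b) has_derivative (\<lambda>_. 0)) (at z)" for b by simp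
  note this' = twice_diff_atI[OF ev this]
  show "twice_diff_at (\<lambda>x. c + L x) z" "D2 (\<lambda>x. c + L x) z a b = 0" by (rule this')+
  show "D1 (\<lambda>x. c + L x) z = L" by (rule D1_eqI[OF d])
qed

text \<open>A slice of \<phi> is \<phi> composed with an affine insertion, whose second derivative
  vanishes, so the chain rule leaves only the derivatives of \<phi> in directions (0, a).\<close>

lemma D_partial:
  fixes \<phi> :: "'p::euclidean_space \<times> 'x::euclidean_space \<Rightarrow> 'y::euclidean_space"
  assumes "twice_diff_at \<phi> (p, x)"
  shows "twice_diff_at (\<lambda>x. \<phi> (p, x)) x" "D1 (\<lambda>x. \<phi> (p, x)) x a = D1 \<phi> (p, x) (0, a)"
    "D2 (\<lambda>x. \<phi> (p, x)) x a b = D2 \<phi> (p, x) (0, a) (0, b)"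
proof -
  have lin: "linear (\<lambda>x::'x. (0::'p, x))" by (intro linearI) auto
  have eq: "(\<lambda>x. \<phi> (p, x)) = \<phi> \<circ> (\<lambda>x. (p, 0) + (0, x))" by (auto simp: o_def)
  note aff = twice_diff_at_affine[OF lin, of "(p, 0)"]
  have \<phi>: "twice_diff_at \<phi> ((p, 0) + (0, x))" using assms by simp
  have z: "D1 \<phi> (p, x) 0 = 0"
    using linear_0[OF linear_D1[OF twice_diff_at_imp_differentiable[OF assms]]] .
  show "twice_diff_at (\<lambda>x. \<phi> (p, x)) x" unfolding eq by (rule twice_diff_at_compose[OF aff(1) \<phi>])
  show "D1 (\<lambda>x. \<phi> (p, x)) x a = D1 \<phi> (p, x) (0, a)"
    unfolding eq twice_diff_at_compose(2)[OF aff(1) \<phi>] aff by simp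
  show "D2 (\<lambda>x. \<phi> (p, x)) x a b = D2 \<phi> (p, x) (0, a) (0, b)"
    unfolding eq twice_diff_at_compose(3)[OF aff(1) \<phi>] aff by (simp add: z)
qed

lemma D_inner:
  fixes \<phi> :: "'a::euclidean_space \<Rightarrow> 'b::euclidean_space"
  assumes "twice_diff_at \<phi> z"
  shows "D2 (\<lambda>y. m \<bullet> \<phi> y) z a b = m \<bullet> D2 \<phi> z a b"
proof -
  have lin: "linear (\<lambda>x. m \<bullet> x)" by (simp add: bounded_linear.linear bounded_linear_inner_right)
  have eq: "(\<lambda>x. m \<bullet> \<phi> x) = (\<lambda>x. 0 + m \<bullet> x) \<circ> \<phi>" by (auto simp: o_def)
  show ?thesis
    unfolding eq twice_diff_at_compose(3)[OF assms twice_diff_at_affine(1)[OF lin]]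
      twice_diff_at_affine[OF lin] by simp
qed

text \<open>Strict differentiability compares two arbitrary points near z, as the fixed point
  argument for solvability requires. It is the mean value inequality for \<phi> minus its
  linearisation, on a ball where continuity in each basis direction keeps the derivative close to
  \<open>D1 \<phi> z\<close>.\<close>

lemma C1_on_strict:
  fixes \<phi> :: "'a::euclidean_space \<Rightarrow> 'b::euclidean_space"
  assumes "C1_on U \<phi>" "z \<in> U" "\<eta> > 0"
  obtains \<delta> where "\<delta> > 0" "ball z \<delta> \<subseteq> U"
    "\<And>y y'. y \<in> ball z \<delta> \<Longrightarrow> y' \<in> ball z \<delta> \<Longrightarrow>
      norm (\<phi> y' - \<phi> y - D1 \<phi> z (y' - y)) \<le> \<eta> * norm (y' - y)"
proof -
  define c where "c = \<eta> / DIM('a)"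
  have c: "c > 0" using assms(3) by (simp add: c_def)
  have U: "open U" using assms(1) unfolding C1_on_def by blast
  have diff: "\<phi> differentiable (at y)" if "y \<in> U" for y
    using assms(1) that unfolding C1_on_def by blast
  have "\<forall>\<^sub>F y in nhds z. norm (D1 \<phi> y b - D1 \<phi> z b) < c" for b
  proof -
    have "isCont (\<lambda>y. D1 \<phi> y b) z"
      using assms(1,2) U unfolding C1_on_def D1_def
      by (simp add: continuous_on_eq_continuous_at)
    then have "((\<lambda>y. D1 \<phi> y b) \<longlongrightarrow> D1 \<phi> z b) (nhds z)"
      by (simp add: tendsto_nhds_iff isCont_def)
    from tendstoD[OF this c] show ?thesis by (simp add: dist_norm)
  qed
  then have "\<forall>\<^sub>F y in nhds z. \<forall>b\<in>Basis. norm (D1 \<phi> y b - D1 \<phi> z b) < c"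
    by (simp add: eventually_ball_finite_distrib)
  moreover have "\<forall>\<^sub>F y in nhds z. y \<in> U"
    using U assms(2) by (simp add: eventually_nhds_in_open)
  ultimately have "\<forall>\<^sub>F y in nhds z. y \<in> U \<and> (\<forall>b\<in>Basis. norm (D1 \<phi> y b - D1 \<phi> z b) < c)"
    by eventually_elim blast
  then obtain \<delta> where \<delta>: "\<delta> > 0" "\<And>y. dist y z < \<delta> \<Longrightarrow> y \<in> U"
    "\<And>y b. dist y z < \<delta> \<Longrightarrow> b \<in> Basis \<Longrightarrow> norm (D1 \<phi> y b - D1 \<phi> z b) < c"
    unfolding eventually_nhds_metric by blast
  have sub: "ball z \<delta> \<subseteq> U" using \<delta>(2) by (auto simp: dist_commute)
  show ?thesis
  proof (rule that[OF \<delta>(1) sub])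
    fix y y' assume y: "y \<in> ball z \<delta>" "y' \<in> ball z \<delta>"
    let ?\<psi> = "\<lambda>x. \<phi> x - D1 \<phi> z x"
    have lz: "linear (D1 \<phi> z)" using diff assms(2) linear_D1 by blast
    have "norm (?\<psi> y' - ?\<psi> y) \<le> \<eta> * norm (y' - y)"
    proof (rule differentiable_bound[OF convex_ball])
      fix x assume x: "x \<in> ball z \<delta>"
      have lx: "linear (D1 \<phi> x)" using diff sub x linear_D1 by blast
      show "(?\<psi> has_derivative (\<lambda>b. D1 \<phi> x b - D1 \<phi> z b)) (at x within ball z \<delta>)"
        by (rule has_derivative_at_withinI,
            intro has_derivative_diff D1_has_derivative linear_imp_has_derivative lz diff subsetD[OF sub x])
      show "onorm (\<lambda>b. D1 \<phi> x b - D1 \<phi> z b) \<le> \<eta>"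
      proof (rule onorm_le)
        fix b
        have "norm (D1 \<phi> x b - D1 \<phi> z b) \<le> DIM('a) * c * norm b"
          using \<delta>(3)[of x] x
          by (intro linear_norm_le_Basis linear_compose_sub lx lz less_imp_le) (simp_all add: dist_commute)
        then show "norm (D1 \<phi> x b - D1 \<phi> z b) \<le> \<eta> * norm b" by (simp add: c_def)
      qed
    qed (use y in auto)
    then show "norm (\<phi> y' - \<phi> y - D1 \<phi> z (y' - y)) \<le> \<eta> * norm (y' - y)"
      by (simp add: linear_diff[OF lz] algebra_simps)
  qed
qed

section \<open>Local solvability and conic duality\<close>

lemma surj_linear_right_inverse:
  fixes T :: "'a::euclidean_space \<Rightarrow> 'b::euclidean_space"
  assumes "linear T" "surj T"
  obtains B b where "linear B" "\<And>y. T (B y) = y" "b > 0" "\<And>y. norm (B y) \<le> b * norm y"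
proof -
  obtain B where B: "linear B" "T \<circ> B = id"
    using linear_surjective_right_inverse[OF assms] by blast
  moreover obtain b where "b > 0" "\<And>y. norm (B y) \<le> b * norm y"
    using linear_bounded_pos[OF B(1)] by blast
  ultimately show ?thesis using that by (metis comp_apply id_apply)
qed

text \<open>Brouwer's theorem gives a solution with a linear bound; uniqueness is not claimed. The
  map \<open>L\<close> restricts the directions in which the solution may move: for \<open>h\<close>
  it is the identity, for \<open>f\<close> the inclusion of the second parameter block.\<close>

lemma local_solvability:
  fixes F :: "'z::euclidean_space \<Rightarrow> 'e::euclidean_space" and L :: "'a::euclidean_space \<Rightarrow> 'z"
  assumes F: "C1_on U F" "z \<in> U" and L: "linear L" and surj: "surj (D1 F z \<circ> L)"
  obtains c \<delta> where "c > 0" "\<delta> > 0"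
    "\<And>y e. y \<in> ball z \<delta> \<Longrightarrow> norm (e - F y) < \<delta> \<Longrightarrow>
        \<exists>a. y + L a \<in> U \<and> F (y + L a) = e \<and> norm a \<le> c * norm (e - F y)"
proof -
  have diff: "F differentiable (at y)" if "y \<in> U" for y using F that unfolding C1_on_def by blast
  have linT: "linear (D1 F z \<circ> L)"
    using linear_compose[OF L linear_D1[OF diff[OF F(2)]]] .
  obtain B b where B: "linear B" "\<And>\<eta>. (D1 F z \<circ> L) (B \<eta>) = \<eta>" "b > 0"
    "\<And>\<eta>. norm (B \<eta>) \<le> b * norm \<eta>"
    using surj_linear_right_inverse[OF linT surj] by metis
  obtain l where l: "l > 0" "\<And>a. norm (L a) \<le> l * norm a"
    using linear_bounded_pos[OF L] by blast
  have lb: "l * b > 0" using l B by simp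
  have LB: "norm (L (B \<eta>)) \<le> l * b * norm \<eta>" for \<eta>
  proof -
    have "norm (L (B \<eta>)) \<le> l * norm (B \<eta>)" by (rule l(2))
    also have "\<dots> \<le> l * (b * norm \<eta>)" using B(4) l(1) by simp
    finally show ?thesis by (simp add: mult.assoc)
  qed
  \<comment> \<open>Half the reciprocal of the bound for L o B: along y + L (B \<eta>) the deviation
    of F from its linearisation is then at most |\<eta>| / 2.\<close>
  have "1 / (2 * (l * b)) > 0" using lb by simp
  then obtain \<delta> where \<delta>: "\<delta> > 0" "ball z \<delta> \<subseteq> U"
    "\<And>y y'. y \<in> ball z \<delta> \<Longrightarrow> y' \<in> ball z \<delta> \<Longrightarrow>
      norm (F y' - F y - D1 F z (y' - y)) \<le> 1 / (2 * (l * b)) * norm (y' - y)"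
    using C1_on_strict[OF F] by blast
  \<comment> \<open>Chosen so that \<delta>' + 2 l b \<delta>' = \<delta>: the base point uses the
    first share, a correction L (B \<eta>) with |\<eta>| \<le> 2 \<delta>' the second.\<close>
  define \<delta>' where "\<delta>' = \<delta> / (1 + 2 * (l * b))"
  have "(1 + 2 * (l * b)) * \<delta>' = \<delta>" using lb by (simp add: \<delta>'_def)
  then have \<delta>': "\<delta>' > 0" "\<delta>' + 2 * (l * b) * \<delta>' = \<delta>"
    using \<delta>(1) lb by (simp add: \<delta>'_def, simp only: distrib_right mult_1)
  show ?thesis
  proof (rule that[of "2 * b" \<delta>'])
    fix y e assume y: "y \<in> ball z \<delta>'" and e: "norm (e - F y) < \<delta>'"
    \<comment> \<open>A fixed point of \<open>T\<close> solves F = e. On the ball of radius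
      \<open>s\<close> the nonlinear part contributes at most s/2 and the initial error |e - F y| is
      s/2, so \<open>T\<close> maps the ball into itself.\<close>
    define s where "s = 2 * norm (e - F y)"
    define T where "T \<eta> = \<eta> - (F (y + L (B \<eta>)) - e)" for \<eta>
    have y\<delta>: "y \<in> ball z \<delta>" using y \<delta>' lb by (auto simp: algebra_simps intro: less_le_trans)
    have inball: "y + L (B \<eta>) \<in> ball z \<delta>" if "\<eta> \<in> cball 0 s" for \<eta>
    proof -
      have "norm (L (B \<eta>)) \<le> l * b * s"
        using LB[of \<eta>] that lb by (smt (verit) mem_cball_0 mult_left_mono)
      also have "\<dots> \<le> l * b * (2 * \<delta>')" using e lb by (intro mult_left_mono) (auto simp: s_def)
      finally have "norm (L (B \<eta>)) \<le> 2 * (l * b) * \<delta>'" by (simp add: mult_ac)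
      moreover have "dist z (y + L (B \<eta>)) \<le> dist z y + norm (L (B \<eta>))"
        by norm
      ultimately show ?thesis using y \<delta>'(2) by simp
    qed
    have "continuous_on (cball 0 s) T"
    proof -
      have FU: "continuous_on U F"
        using diff by (intro continuous_at_imp_continuous_on ballI differentiable_imp_continuous_within)
      have "linear (\<lambda>\<eta>. L (B \<eta>))" using linear_compose[OF B(1) L] by (simp add: o_def)
      then have "continuous_on (cball 0 s) (\<lambda>\<eta>. L (B \<eta>))"
        by (intro linear_continuous_on) (simp add: linear_conv_bounded_linear)
      then have "continuous_on (cball 0 s) (\<lambda>\<eta>. y + L (B \<eta>))"
        by (intro continuous_on_add continuous_on_const)
      moreover have "(\<lambda>\<eta>. y + L (B \<eta>)) ` cball 0 s \<subseteq> U" using inball \<delta>(2) by blast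
      ultimately have "continuous_on (cball 0 s) (\<lambda>\<eta>. F (y + L (B \<eta>)))"
        by (rule continuous_on_compose2[OF FU])
      then show ?thesis
        unfolding T_def by (intro continuous_on_diff continuous_on_id continuous_on_const)
    qed
    moreover have "T \<in> cball 0 s \<rightarrow> cball 0 s"
    proof
      fix \<eta> :: 'e assume \<eta>: "\<eta> \<in> cball 0 s"
      have "norm (F (y + L (B \<eta>)) - F y - \<eta>) \<le> 1 / (2 * (l * b)) * norm (L (B \<eta>))"
        using \<delta>(3)[OF y\<delta> inball[OF \<eta>]] B(2)[of \<eta>] by simp
      also have "\<dots> \<le> 1 / (2 * (l * b)) * (l * b * norm \<eta>)"
        using LB lb by (intro mult_left_mono) auto
      also have "\<dots> \<le> s / 2" using lb \<eta> l B by simp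
      finally have "norm (F (y + L (B \<eta>)) - F y - \<eta>) \<le> s / 2" .
      moreover have "norm (T \<eta>) \<le> norm (F (y + L (B \<eta>)) - F y - \<eta>) + norm (e - F y)"
        unfolding T_def by norm
      ultimately show "T \<eta> \<in> cball 0 s" by (simp add: s_def)
    qed
    moreover have "cball 0 s \<noteq> ({} :: 'e set)" by (simp add: s_def)
    ultimately obtain \<eta> where \<eta>: "\<eta> \<in> cball 0 s" "T \<eta> = \<eta>"
      using brouwer[OF compact_cball convex_cball] by metis
    have "norm (B \<eta>) \<le> b * s" using B(3,4) \<eta>(1) by (smt (verit) mem_cball_0 mult_left_mono)
    moreover have "F (y + L (B \<eta>)) = e" using \<eta>(2) by (simp add: T_def)
    ultimately show "\<exists>a. y + L a \<in> U \<and> F (y + L a) = e \<and> norm a \<le> 2 * b * norm (e - F y)"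
      using inball[OF \<eta>(1)] \<delta>(2) by (intro exI[of _ "B \<eta>"]) (auto simp: s_def mult_ac)
  qed (use B \<delta>' in auto)
qed

section \<open>Regular normals, polar cones and approximate duality\<close>

lemma regular_normal_coneD:
  assumes "v \<in> regular_normal_cone \<Omega> z" "\<epsilon> > 0"
  obtains \<delta> where "\<delta> > 0" "\<And>y. y \<in> \<Omega> \<Longrightarrow> norm (y - z) < \<delta> \<Longrightarrow> v \<bullet> (y - z) \<le> \<epsilon> * norm (y - z)"
proof -
  have "\<forall>\<epsilon>>0. \<exists>\<delta>>0. \<forall>y\<in>\<Omega>. norm (y - z) < \<delta> \<longrightarrow> v \<bullet> (y - z) \<le> \<epsilon> * norm (y - z)"
    using assms(1) by (simp add: regular_normal_cone_def)
  from this[rule_format, OF assms(2)] show ?thesis using that by metis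
qed

lemma regular_normal_tangent_le_0:
  assumes v: "v \<in> regular_normal_cone \<Omega> z" and w: "w \<in> tangent_cone \<Omega> z"
  shows "v \<bullet> w \<le> 0"
proof -
  obtain t wk where t: "\<And>k. t k > (0::real)" "t \<longlonglongrightarrow> 0" "wk \<longlonglongrightarrow> w" "\<And>k. z + t k *\<^sub>R wk k \<in> \<Omega>"
    using w unfolding tangent_cone_def by blast
  have "(\<lambda>k. norm (t k *\<^sub>R wk k)) \<longlonglongrightarrow> 0"
    using tendsto_norm[OF tendsto_scaleR[OF t(2,3)]] by simp
  have le: "v \<bullet> w \<le> \<epsilon> * norm w" if "\<epsilon> > 0" for \<epsilon>
  proof -
    obtain \<delta> where \<delta>: "\<delta> > 0" "\<And>y. y \<in> \<Omega> \<Longrightarrow> norm (y - z) < \<delta> \<Longrightarrow> v \<bullet> (y - z) \<le> \<epsilon> * norm (y - z)"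
      using regular_normal_coneD[OF v \<open>\<epsilon> > 0\<close>] by metis
    have "\<forall>\<^sub>F k in sequentially. norm (t k *\<^sub>R wk k) < \<delta>"
      using order_tendstoD(2)[OF \<open>(\<lambda>k. norm (t k *\<^sub>R wk k)) \<longlonglongrightarrow> 0\<close> \<delta>(1)] .
    then have ev: "\<forall>\<^sub>F k in sequentially. v \<bullet> wk k \<le> \<epsilon> * norm (wk k)"
    proof eventually_elim
      case (elim k)
      have "t k * (v \<bullet> wk k) \<le> t k * (\<epsilon> * norm (wk k))"
        using \<delta>(2)[OF t(4)[of k]] elim t(1)[of k] by (simp add: mult_ac)
      then show ?case using t(1)[of k] by simp
    qed
    have "(\<lambda>k. \<epsilon> * norm (wk k)) \<longlonglongrightarrow> \<epsilon> * norm w" "(\<lambda>k. v \<bullet> wk k) \<longlonglongrightarrow> v \<bullet> w"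
      using t(3) by (auto intro!: tendsto_intros)
    from tendsto_le[OF sequentially_bot this ev] show ?thesis .
  qed
  show ?thesis
  proof (rule field_le_epsilon)
    fix e :: real assume e: "e > 0"
    have "v \<bullet> w \<le> (e / (norm w + 1)) * norm w" using e by (intro le) (simp add: add_nonneg_pos)
    also have "\<dots> \<le> e" using e by (simp add: divide_le_eq add_pos_nonneg add_nonneg_pos algebra_simps)
    finally show "v \<bullet> w \<le> 0 + e" by simp
  qed
qed

lemma inner_dual_vec:
  assumes "linear l" shows "dual_vec l \<bullet> v = l v"
proof -
  have "dual_vec l \<bullet> v = (\<Sum>b\<in>Basis. (v \<bullet> b) *\<^sub>R l b)"
    unfolding dual_vec_def inner_sum_left by (simp add: inner_commute mult.commute)
  then show ?thesis using linear_eq_sum_Basis[OF assms, of v] by simp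
qed

definition polar_cone :: "'a::real_inner set \<Rightarrow> 'a set" where
  "polar_cone K = {\<mu>. \<forall>k\<in>K. \<mu> \<bullet> k \<le> 0}"

text \<open>Only approximate dual solutions are available, since \<open>K + range A\<close> need not be closed;
  the proof separates \<open>(b, 0)\<close> from a closed convex cone.\<close>
lemma conic_duality_approx:
  fixes A :: "'z::euclidean_space \<Rightarrow> 'e::euclidean_space"
  assumes K: "convex_cone K" and A: "linear A" and \<mu>: "\<mu> \<in> polar_cone K"
    and max: "\<And>\<mu>'. \<mu>' \<in> polar_cone K \<Longrightarrow> (\<And>v. \<mu>' \<bullet> A v = \<mu> \<bullet> A v) \<Longrightarrow> \<mu>' \<bullet> b \<le> \<mu> \<bullet> b"
    and \<epsilon>: "\<epsilon> > 0"
  obtains v k where "k \<in> K" "norm (b + A v - k) \<le> \<epsilon>" "\<mu> \<bullet> k \<ge> - \<epsilon>"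
proof -
  \<comment> \<open>The first component is to approach \<open>b\<close>; the second encodes \<mu> .
    k \<ge> 0 with slack \<open>s\<close>. Approximating (b, 0) by elements of \<open>T\<close> is
    thus the primal statement up to \<epsilon>.\<close>
  define T where "T = {(k - A v, s - \<mu> \<bullet> k) | k v s. k \<in> K \<and> s \<ge> (0::real)}"
  have T: "convex_cone T"
    unfolding convex_cone_iff
  proof (intro conjI ballI allI impI)
    have "(0 - A 0, 0 - \<mu> \<bullet> 0) \<in> T" unfolding T_def using convex_cone_contains_0[OF K] by blast
    then show "0 \<in> T" using linear_0[OF A] by (simp add: zero_prod_def)
  next
    fix x y assume "x \<in> T" "y \<in> T"
    then obtain k v s k' v' s' where *: "k \<in> K" "s \<ge> 0" "k' \<in> K" "s' \<ge> 0"
      "x = (k - A v, s - \<mu> \<bullet> k)" "y = (k' - A v', s' - \<mu> \<bullet> k')" unfolding T_def by blast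
    have "x + y = ((k + k') - A (v + v'), (s + s') - \<mu> \<bullet> (k + k'))"
      using * by (simp add: linear_add[OF A] inner_add_right)
    moreover have "k + k' \<in> K" "s + s' \<ge> 0" using * convex_cone_add[OF K] by auto
    ultimately show "x + y \<in> T" unfolding T_def by blast
  next
    fix x and c :: real assume "x \<in> T" "0 \<le> c"
    then obtain k v s where *: "k \<in> K" "s \<ge> 0" "x = (k - A v, s - \<mu> \<bullet> k)" unfolding T_def by blast
    have "c *\<^sub>R x = (c *\<^sub>R k - A (c *\<^sub>R v), c * s - \<mu> \<bullet> (c *\<^sub>R k))"
      using * by (simp add: linear_cmul[OF A] algebra_simps)
    moreover have "c *\<^sub>R k \<in> K" "c * s \<ge> 0" using * convex_cone_scaleR[OF K] \<open>0 \<le> c\<close> by auto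
    ultimately show "c *\<^sub>R x \<in> T" unfolding T_def by blast
  qed
  have "(b, 0) \<in> closure T"
  proof (rule ccontr)
    assume "(b, 0) \<notin> closure T"
    then obtain p \<beta> where p: "p \<bullet> (b, 0) < \<beta>" "\<And>x. x \<in> closure T \<Longrightarrow> p \<bullet> x > \<beta>"
      using separating_hyperplane_closed_point[OF convex_closure closed_closure, of T "(b, 0)"] T
      unfolding convex_cone_def by blast
    obtain \<eta> \<sigma> where p_eq: "p = (\<eta>, \<sigma>)" by (cases p)
    have pT: "p \<bullet> x > \<beta>" if "x \<in> T" for x using p(2) closure_subset that by blast
    have \<beta>: "\<beta> < 0" using pT[OF convex_cone_contains_0[OF T]] by simp
    \<comment> \<open>On a cone the lower bound improves to 0: a negative value could be rescaled to
      equal \<beta>, against the strict inequality.\<close>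
    have nonneg: "p \<bullet> x \<ge> 0" if "x \<in> T" for x
    proof (rule ccontr)
      assume neg: "\<not> p \<bullet> x \<ge> 0"
      have "p \<bullet> ((\<beta> / (p \<bullet> x)) *\<^sub>R x) > \<beta>"
        using neg \<beta> that by (intro pT convex_cone_scaleR[OF T]) (auto simp: divide_nonpos_neg)
      then show False using neg by simp
    qed
    have T0: "(k - A v, s - \<mu> \<bullet> k) \<in> T" if "k \<in> K" "s \<ge> 0" for k v s
      unfolding T_def using that by blast
    have ge: "\<eta> \<bullet> (k - A v) + \<sigma> * (s - \<mu> \<bullet> k) \<ge> 0" if "k \<in> K" "s \<ge> 0" for k v s
      using nonneg[OF T0[OF that]] by (simp add: p_eq)
    have K0: "0 \<in> K" using convex_cone_contains_0[OF K] .
    have \<sigma>: "\<sigma> \<ge> 0" using ge[OF K0, of 1 0] linear_0[OF A] by simp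
    have \<eta>A: "\<eta> \<bullet> A v = 0" for v
      using ge[OF K0, of 0 v] ge[OF K0, of 0 "- v"] linear_neg[OF A, of v] by simp
    have \<eta>K: "\<eta> \<bullet> k - \<sigma> * (\<mu> \<bullet> k) \<ge> 0" if "k \<in> K" for k
      using ge[OF that, of 0 0] linear_0[OF A] by simp
    \<comment> \<open>The separating vector may have \<sigma> = 0, hence the divisor \<sigma> + 1.
      The competitor is polar because \<eta> dominates \<sigma> \<mu> on \<open>K\<close> and \<mu>
      is nonpositive there; it agrees with \<mu> on the range of \<open>A\<close>, where \<eta>
      vanishes. Maximality of \<mu> then forces \<eta> . b \<ge> 0, against the separation.\<close>
    define \<mu>' where "\<mu>' = \<mu> - (1 / (\<sigma> + 1)) *\<^sub>R \<eta>"
    have "\<mu>' \<in> polar_cone K"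
      unfolding polar_cone_def
    proof (intro CollectI ballI)
      fix k assume k: "k \<in> K"
      have "(\<sigma> + 1) * (\<mu>' \<bullet> k) = \<mu> \<bullet> k - (\<eta> \<bullet> k - \<sigma> * (\<mu> \<bullet> k))"
        using \<sigma> by (simp add: \<mu>'_def inner_diff_left field_simps)
      also have "\<dots> \<le> 0" using \<eta>K[OF k] \<mu> k unfolding polar_cone_def by force
      finally show "\<mu>' \<bullet> k \<le> 0" using \<sigma> by (simp add: mult_le_0_iff)
    qed
    moreover have "\<mu>' \<bullet> A v = \<mu> \<bullet> A v" for v by (simp add: \<mu>'_def inner_diff_left \<eta>A)
    ultimately have "\<mu>' \<bullet> b \<le> \<mu> \<bullet> b" by (rule max)
    then have "(1 / (\<sigma> + 1)) * (\<eta> \<bullet> b) \<ge> 0" by (simp add: \<mu>'_def inner_diff_left)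
    then have "\<eta> \<bullet> b \<ge> 0" using \<sigma> by (simp add: zero_le_divide_iff)
    moreover have "\<eta> \<bullet> b < \<beta>" using p(1) by (simp add: p_eq)
    ultimately show False using \<beta> by simp
  qed
  then obtain x where x: "x \<in> T" "dist x (b, 0) < \<epsilon>" using \<epsilon> closure_approachable by blast
  then obtain k v s where *: "k \<in> K" "s \<ge> 0" "x = (k - A v, s - \<mu> \<bullet> k)" unfolding T_def by blast
  have "dist (k - A v) b < \<epsilon>" "dist (s - \<mu> \<bullet> k) 0 < \<epsilon>"
    using x(2) dist_fst_le[of x "(b, 0)"] dist_snd_le[of x "(b, 0)"] * by auto
  then have "norm (b + A v - k) \<le> \<epsilon>" "\<mu> \<bullet> k \<ge> - \<epsilon>"
    using *(2) by (auto simp: dist_norm norm_minus_commute algebra_simps)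
  then show ?thesis using that * by blast
qed

section \<open>Arcs in reduced constraint systems\<close>

text \<open>The directions vary with k, as in the definition of tangent vectors: the remainder is
  o(t |w k|) with |w k| bounded, and continuity of \<open>D\<close> takes care of D (w k).\<close>

lemma has_derivative_sequentially:
  assumes D: "(\<phi> has_derivative D) (at z)" and t: "\<And>k. t k > (0::real)" "t \<longlonglongrightarrow> 0"
    and w: "w \<longlonglongrightarrow> w0"
  shows "(\<lambda>k. (\<phi> (z + t k *\<^sub>R w k) - \<phi> z) /\<^sub>R t k) \<longlonglongrightarrow> D w0"
proof -
  have bl: "bounded_linear D" using D has_derivative_bounded_linear by blast
  have "(\<lambda>k. (\<phi> (z + t k *\<^sub>R w k) - \<phi> z) /\<^sub>R t k - D (w k)) \<longlonglongrightarrow> 0"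
  proof (rule tendstoI)
    fix e :: real assume e: "e > 0"
    define c where "c = norm w0 + 1"
    have c: "c > 0" by (simp add: c_def add_nonneg_pos)
    have "\<forall>e>0. \<exists>d>0. \<forall>y. norm (y - z) < d \<longrightarrow> norm (\<phi> y - \<phi> z - D (y - z)) \<le> e * norm (y - z)"
      using D unfolding has_derivative_at_alt by blast
    moreover have "e / (2 * c) > 0" using e c by simp
    ultimately obtain d where d: "d > 0"
      "\<And>y. norm (y - z) < d \<Longrightarrow> norm (\<phi> y - \<phi> z - D (y - z)) \<le> e / (2 * c) * norm (y - z)"
      by metis
    have "(\<lambda>k. norm (t k *\<^sub>R w k)) \<longlonglongrightarrow> 0"
      using tendsto_norm[OF tendsto_scaleR[OF t(2) w]] by simp
    from order_tendstoD(2)[OF this d(1)]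
    have "\<forall>\<^sub>F k in sequentially. norm (t k *\<^sub>R w k) < d" .
    moreover have "\<forall>\<^sub>F k in sequentially. norm (w k) < c"
      using order_tendstoD(2)[OF tendsto_norm[OF w]] by (simp add: c_def)
    ultimately show "\<forall>\<^sub>F k in sequentially.
        dist ((\<phi> (z + t k *\<^sub>R w k) - \<phi> z) /\<^sub>R t k - D (w k)) 0 < e"
    proof eventually_elim
      case (elim k)
      have "(\<phi> (z + t k *\<^sub>R w k) - \<phi> z) /\<^sub>R t k - D (w k)
          = (\<phi> (z + t k *\<^sub>R w k) - \<phi> z - D (t k *\<^sub>R w k)) /\<^sub>R t k"
        using t(1)[of k] by (simp add: linear_cmul[OF bounded_linear.linear[OF bl]] algebra_simps)
      then have "norm ((\<phi> (z + t k *\<^sub>R w k) - \<phi> z) /\<^sub>R t k - D (w k))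
          = norm (\<phi> (z + t k *\<^sub>R w k) - \<phi> z - D (t k *\<^sub>R w k)) / t k"
        using t(1)[of k] by (simp add: divide_inverse mult.commute)
      also have "\<dots> \<le> (e / (2 * c) * (t k * norm (w k))) / t k"
        using d(2)[of "z + t k *\<^sub>R w k"] elim(1) t(1)[of k]
        by (intro divide_right_mono) (auto simp: less_imp_le)
      also have "\<dots> = e / (2 * c) * norm (w k)" using t(1)[of k] by simp
      also have "\<dots> \<le> e / (2 * c) * c" using elim(2) e c by (intro mult_left_mono) auto
      also have "\<dots> < e" using e c by simp
      finally show ?case by simp
    qed
  qed
  from tendsto_add[OF this bounded_linear.tendsto[OF bl w]] show ?thesis by simp
qed

lemma bounded_bilinear_D2:
  assumes "twice_diff_at \<phi> z" shows "bounded_bilinear (D2 \<phi> z)"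
  using linear_D2_left[OF assms] linear_D2_right[OF assms]
  by (simp add: bilinear_conv_bounded_bilinear[symmetric] bilinear_def)

text \<open>With tolerance 1 in \<open>D1_expansion\<close> the derivative is bounded on a ball: by
  \<open>B\<close> at the centre, \<delta> M from the second derivative and \<delta> from the
  remainder.\<close>

lemma twice_diff_at_Lipschitz:
  fixes \<phi> :: "'a::euclidean_space \<Rightarrow> 'b::euclidean_space"
  assumes "twice_diff_at \<phi> z"
  obtains \<delta> l where "\<delta> > 0" "l > 0"
    "\<And>y y'. norm (y - z) < \<delta> \<Longrightarrow> norm (y' - z) < \<delta> \<Longrightarrow> norm (\<phi> y' - \<phi> y) \<le> l * norm (y' - y)"
proof -
  obtain \<delta> where \<delta>: "\<delta> > 0" "\<And>y. norm (y - z) < \<delta> \<Longrightarrow> \<phi> differentiable (at y)"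
    "\<And>y b. norm (y - z) < \<delta> \<Longrightarrow>
      norm (D1 \<phi> y b - D1 \<phi> z b - D2 \<phi> z (y - z) b) \<le> 1 * norm (y - z) * norm b"
    using D1_expansion[OF assms zero_less_one] by blast
  obtain M where M: "M > 0" "\<And>a b. norm (D2 \<phi> z a b) \<le> norm a * norm b * M"
    using bounded_bilinear.pos_bounded[OF bounded_bilinear_D2[OF assms]] by blast
  obtain B where B: "B > 0" "\<And>b. norm (D1 \<phi> z b) \<le> B * norm b"
    using linear_bounded_pos[OF linear_D1[OF twice_diff_at_imp_differentiable[OF assms]]] by blast
  define l where "l = B + \<delta> * M + \<delta>"
  have l: "l > 0" using B M \<delta> by (simp add: l_def add_pos_pos)
  show ?thesis
  proof (rule that[OF \<delta>(1) l])
    fix y y' assume y: "norm (y - z) < \<delta>" "norm (y' - z) < \<delta>"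
    show "norm (\<phi> y' - \<phi> y) \<le> l * norm (y' - y)"
    proof (rule differentiable_bound[OF convex_ball[of z \<delta>]])
      fix x assume "x \<in> ball z \<delta>"
      then have x: "norm (x - z) < \<delta>" by (simp add: dist_norm norm_minus_commute)
      show "(\<phi> has_derivative D1 \<phi> x) (at x within ball z \<delta>)"
        by (rule has_derivative_at_withinI, rule D1_has_derivative, rule \<delta>(2)[OF x])
      show "onorm (D1 \<phi> x) \<le> l"
      proof (rule onorm_le)
        fix b
        have "norm (D1 \<phi> x b) \<le> norm (D1 \<phi> x b - D1 \<phi> z b - D2 \<phi> z (x - z) b)
            + norm (D1 \<phi> z b) + norm (D2 \<phi> z (x - z) b)"
          by norm
        also have "\<dots> \<le> norm (x - z) * norm b + B * norm b + norm (x - z) * norm b * M"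
          using \<delta>(3)[OF x, of b] B(2)[of b] M(2)[of "x - z" b] by simp
        also have "\<dots> \<le> \<delta> * norm b + B * norm b + \<delta> * norm b * M"
          using x M(1) by (intro add_mono mult_right_mono) auto
        also have "\<dots> = l * norm b" by (simp add: l_def algebra_simps)
        finally show "norm (D1 \<phi> x b) \<le> l * norm b" .
      qed
    qed (use y in \<open>auto simp: dist_norm norm_minus_commute\<close>)
  qed
qed

lemma norm_Pair_le: "norm (a, b) \<le> norm a + norm b"
  by (simp add: norm_Pair sqrt_sum_squares_le_sum)

text \<open>\<open>G\<close> stands for the composite of \<open>h\<close> and \<open>g\<close>.
  Assumption \<open>regular\<close> is Robinson stability measured by the distance to a chosen point
  \<open>e\<close> of \<open>K\<close>; the strict bound \<open>r\<close> is there because the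
  distance to the feasible set need not be attained.\<close>

locale reduced_system =
  fixes G :: "'p::euclidean_space \<times> 'x::euclidean_space \<Rightarrow> 'e::euclidean_space"
    and K :: "'e set" and \<Gamma> :: "'p \<Rightarrow> 'x set" and pb :: 'p and xb :: 'x
    and \<kappa> \<delta>\<^sub>0 :: real
  assumes G: "twice_diff_at G (pb, xb)" and G0: "G (pb, xb) = 0"
    and K_closed: "closed K" and K: "convex_cone K"
    and \<kappa>: "\<kappa> > 0" and \<delta>\<^sub>0: "\<delta>\<^sub>0 > 0"
    and \<Gamma>_iff: "norm ((p, x) - (pb, xb)) < \<delta>\<^sub>0 \<Longrightarrow> x \<in> \<Gamma> p \<longleftrightarrow> G (p, x) \<in> K"
    and regular: "norm ((p, x) - (pb, xb)) < \<delta>\<^sub>0 \<Longrightarrow> e \<in> K \<Longrightarrow> norm e < \<delta>\<^sub>0 \<Longrightarrow>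
      \<kappa> * norm (e - G (p, x)) < r \<Longrightarrow> \<exists>x'\<in>\<Gamma> p. norm (x' - x) < r"
begin

abbreviation A where "A \<equiv> D1 G (pb, xb)"

lemma linear_A: "linear A"
  by (intro linear_D1 twice_diff_at_imp_differentiable G)

lemma A_derivative: "(G has_derivative A) (at (pb, xb))"
  by (intro D1_has_derivative twice_diff_at_imp_differentiable G)

text \<open>Limits of difference quotients stay in the closed cone \<open>K\<close>. Conversely, if
  A (0, w) is in \<open>K\<close>, so is t A (0, w), at distance o(t) from G (pb, xb + t w), and
  \<open>regular\<close> moves xb + t w by o(t) into the feasible set. Robinson stability thus acts
  as the constraint qualification.\<close>

lemma tangent_cone_eq: "tangent_cone (\<Gamma> pb) xb = {w. A (0, w) \<in> K}"
proof (intro equalityI subsetI)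
  fix w assume "w \<in> tangent_cone (\<Gamma> pb) xb"
  then obtain t wk where t: "\<And>k. t k > (0::real)" "t \<longlonglongrightarrow> 0" "wk \<longlonglongrightarrow> w"
    "\<And>k. xb + t k *\<^sub>R wk k \<in> \<Gamma> pb"
    unfolding tangent_cone_def by blast
  have "(\<lambda>k. (0::'p, wk k)) \<longlonglongrightarrow> (0, w)" using t(3) by (intro tendsto_Pair) auto
  from has_derivative_sequentially[OF A_derivative t(1,2) this]
  have lim: "(\<lambda>k. G (pb, xb + t k *\<^sub>R wk k) /\<^sub>R t k) \<longlonglongrightarrow> A (0, w)" by (simp add: G0)
  have "(\<lambda>k. norm (t k *\<^sub>R wk k)) \<longlonglongrightarrow> 0"
    using tendsto_norm[OF tendsto_scaleR[OF t(2,3)]] by simp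
  from order_tendstoD(2)[OF this \<delta>\<^sub>0]
  have ev: "\<forall>\<^sub>F k in sequentially. G (pb, xb + t k *\<^sub>R wk k) /\<^sub>R t k \<in> K"
  proof eventually_elim
    case (elim k)
    have "norm ((pb, xb + t k *\<^sub>R wk k) - (pb, xb)) < \<delta>\<^sub>0" using elim by (simp add: norm_Pair)
    then show ?case using \<Gamma>_iff[of pb "xb + t k *\<^sub>R wk k"] t(4) t(1)[of k] by (intro convex_cone_scaleR[OF K]) auto
  qed
  from Lim_in_closed_set[OF K_closed ev sequentially_bot lim]
  show "w \<in> {w. A (0, w) \<in> K}" by simp
next
  fix w assume "w \<in> {w. A (0, w) \<in> K}"
  then have w: "A (0, w) \<in> K" by simp
  \<comment> \<open>The tangent sequence has to be feasible for every index, so the step lengths are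
    kept below a bound that makes \<open>regular\<close> applicable from k = 0 on.\<close>
  obtain c where c: "c > 0" "c * norm w < \<delta>\<^sub>0" "c * norm (A (0, w)) < \<delta>\<^sub>0"
  proof
    define n where "n = norm w + norm (A (0, w)) + 1"
    have n: "n > 0" "norm w < n" "norm (A (0, w)) < n"
      unfolding n_def using norm_ge_zero[of w] norm_ge_zero[of "A (0, w)"] by linarith+
    show "\<delta>\<^sub>0 / n > 0" using n \<delta>\<^sub>0 by simp
    show "\<delta>\<^sub>0 / n * norm w < \<delta>\<^sub>0" "\<delta>\<^sub>0 / n * norm (A (0, w)) < \<delta>\<^sub>0"
      using n \<delta>\<^sub>0 by (simp_all add: divide_less_eq)
  qed
  define t where "t k = c * inverse (real (Suc k))" for k
  have t0: "t k > 0" for k using c(1) by (simp add: t_def)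
  have tc: "t k \<le> c" for k using c(1) by (simp add: t_def field_simps)
  have tlim: "t \<longlonglongrightarrow> 0"
    unfolding t_def using tendsto_mult[OF tendsto_const LIMSEQ_inverse_real_of_nat, of c] by simp
  \<comment> \<open>The added square makes the bound in \<open>regular\<close> strict and is still
    o(t).\<close>
  define r where "r k = \<kappa> * norm (t k *\<^sub>R A (0, w) - G (pb, xb + t k *\<^sub>R w)) + (t k)\<^sup>2" for k
  have "\<exists>x'\<in>\<Gamma> pb. norm (x' - (xb + t k *\<^sub>R w)) < r k" for k
  proof (rule regular)
    have "t k * norm w \<le> c * norm w" "t k * norm (A (0, w)) \<le> c * norm (A (0, w))"
      using tc by (auto intro!: mult_right_mono)
    then show "norm ((pb, xb + t k *\<^sub>R w) - (pb, xb)) < \<delta>\<^sub>0" "norm (t k *\<^sub>R A (0, w)) < \<delta>\<^sub>0"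
      using c t0[of k] by (auto simp: norm_Pair)
    show "t k *\<^sub>R A (0, w) \<in> K" using t0[of k] w convex_cone_scaleR[OF K] by simp
    show "\<kappa> * norm (t k *\<^sub>R A (0, w) - G (pb, xb + t k *\<^sub>R w)) < r k"
      using t0[of k] by (simp add: r_def)
  qed
  then obtain x where x: "\<And>k. x k \<in> \<Gamma> pb" "\<And>k. norm (x k - (xb + t k *\<^sub>R w)) < r k" by metis
  have "(\<lambda>k. G (pb, xb + t k *\<^sub>R w) /\<^sub>R t k) \<longlonglongrightarrow> A (0, w)"
    using has_derivative_sequentially[OF A_derivative t0 tlim tendsto_const, of "(0, w)"]
    by (simp add: G0)
  then have "(\<lambda>k. \<kappa> * norm (A (0, w) - G (pb, xb + t k *\<^sub>R w) /\<^sub>R t k) + t k) \<longlonglongrightarrow>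
      \<kappa> * norm (A (0, w) - A (0, w)) + 0"
    by (intro tendsto_intros tlim)
  moreover have "r k / t k = \<kappa> * norm (A (0, w) - G (pb, xb + t k *\<^sub>R w) /\<^sub>R t k) + t k" for k
  proof -
    have "norm (A (0, w) - G (pb, xb + t k *\<^sub>R w) /\<^sub>R t k)
        = norm ((t k *\<^sub>R A (0, w) - G (pb, xb + t k *\<^sub>R w)) /\<^sub>R t k)"
      using t0[of k] by (simp add: scaleR_diff_right)
    also have "\<dots> = norm (t k *\<^sub>R A (0, w) - G (pb, xb + t k *\<^sub>R w)) / t k"
      using t0[of k] by (simp add: divide_inverse mult.commute)
    finally show ?thesis
      using t0[of k] by (simp add: r_def add_divide_distrib power2_eq_square)
  qed
  ultimately have rlim: "(\<lambda>k. r k / t k) \<longlonglongrightarrow> 0" by simp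
  define wk where "wk k = (x k - xb) /\<^sub>R t k" for k
  have "(\<lambda>k. wk k - w) \<longlonglongrightarrow> 0"
  proof (rule Lim_null_comparison[OF always_eventually rlim], rule allI)
    fix k
    have "wk k - w = (x k - (xb + t k *\<^sub>R w)) /\<^sub>R t k"
      using t0[of k] by (simp add: wk_def algebra_simps)
    then have "norm (wk k - w) = norm (x k - (xb + t k *\<^sub>R w)) / t k"
      using t0[of k] by (simp add: divide_inverse mult.commute)
    also have "\<dots> \<le> r k / t k"
      using x(2)[of k] t0[of k] by (intro divide_right_mono) auto
    finally show "norm (wk k - w) \<le> r k / t k" .
  qed
  then have "wk \<longlonglongrightarrow> w" by (rule LIM_zero_cancel)
  moreover have "xb + t k *\<^sub>R wk k \<in> \<Gamma> pb" for k using x(1)[of k] t0[of k] by (simp add: wk_def)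
  ultimately show "w \<in> tangent_cone (\<Gamma> pb) xb"
    unfolding tangent_cone_def using t0 tlim by blast
qed

text \<open>At z + t (0, u) + (t^2/2) v the value of \<open>G\<close> is t A (0, u) + (t^2/2) (b + A
  v) + o(t^2). Replacing b + A v by the nearby \<open>k\<close> gives an element of
  \<open>K\<close>, and \<open>regular\<close> pulls the point into the feasible set at a cost of
  order \<epsilon> t^2. Since \<mu> annihilates A (0, u), only \<mu> . k and these errors enter the
  bound for \<mu> . G.\<close>

lemma second_order_feasible_arc:
  assumes \<mu>: "\<mu> \<in> polar_cone K" and u: "A (0, u) \<in> K" "\<mu> \<bullet> A (0, u) = 0"
    and max: "\<And>\<mu>'. \<mu>' \<in> polar_cone K \<Longrightarrow> (\<And>v. \<mu>' \<bullet> A v = \<mu> \<bullet> A v) \<Longrightarrow>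
      \<mu>' \<bullet> D2 G (pb, xb) (0, u) (0, u) \<le> \<mu> \<bullet> D2 G (pb, xb) (0, u) (0, u)"
    and \<epsilon>: "\<epsilon> > 0"
  obtains t p x where "0 < t" "t < \<epsilon>" "norm (p - pb) \<le> \<epsilon> * t" "norm (x - xb - t *\<^sub>R u) \<le> \<epsilon> * t"
    "x \<in> \<Gamma> p" "\<mu> \<bullet> G (p, x) \<ge> - \<epsilon> * t\<^sup>2"
proof -
  let ?z = "(pb, xb)" and ?u = "(0::'p, u)"
  define b where "b = D2 G ?z ?u ?u"
  obtain \<delta> l where l: "\<delta> > 0" "l > 0" "\<And>y y'. norm (y - ?z) < \<delta> \<Longrightarrow> norm (y' - ?z) < \<delta> \<Longrightarrow>
      norm (G y' - G y) \<le> l * norm (y' - y)"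
    using twice_diff_at_Lipschitz[OF G] by blast
  \<comment> \<open>Total loss in the bound for \<mu> . G, in units of
    \<open>\<epsilon>\<^sub>1\<close> t^2: 1 for \<mu> . k, and |\<mu>| times 1 for the expansion
    error plus 2 l \<kappa> for the move to the feasible point.\<close>
  define c where "c = 1 + norm \<mu> * (1 + 2 * l * \<kappa>)"
  have c: "c > 0" using l(2) \<kappa> by (auto simp: c_def intro!: add_pos_nonneg)
  define \<epsilon>\<^sub>1 where "\<epsilon>\<^sub>1 = \<epsilon> / c"
  have \<epsilon>\<^sub>1: "\<epsilon>\<^sub>1 > 0" "\<epsilon>\<^sub>1 * c = \<epsilon>" using \<epsilon> c by (auto simp: \<epsilon>\<^sub>1_def)
  obtain v k where k: "k \<in> K" "norm (b + A v - k) \<le> \<epsilon>\<^sub>1" "\<mu> \<bullet> k \<ge> - \<epsilon>\<^sub>1"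
    using conic_duality_approx[OF K linear_A \<mu> max \<epsilon>\<^sub>1(1)] unfolding b_def by blast
  \<comment> \<open>Since |q t| < |u| + 1, the Taylor remainder is at most a quarter of
    \<open>\<epsilon>\<^sub>1\<close> t^2. The convergence of \<open>D2\<close> costs another
    quarter and the duality error a half, which adds up to \<open>err\<close>.\<close>
  define \<eta> where "\<eta> = \<epsilon>\<^sub>1 / (4 * (norm u + 1)\<^sup>2)"
  have nu: "norm u + 1 > 0" by (simp add: add_nonneg_pos)
  have \<eta>: "\<eta> > 0" "\<eta> * (norm u + 1)\<^sup>2 = \<epsilon>\<^sub>1 / 4" using \<epsilon>\<^sub>1(1) nu by (auto simp: \<eta>_def)
  obtain \<delta>\<^sub>2 where \<delta>\<^sub>2: "\<delta>\<^sub>2 > 0" "\<And>w. norm w < \<delta>\<^sub>2 \<Longrightarrow>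
      norm (G (?z + w) - G ?z - A w - (1/2) *\<^sub>R D2 G ?z w w) \<le> \<eta> * (norm w)\<^sup>2"
    using Taylor_Young[OF G \<eta>(1)] by blast
  define q where "q t = ?u + (t/2) *\<^sub>R v" for t :: real
  \<comment> \<open>The target for \<open>G\<close> at the arc point; it lies in \<open>K\<close> as
    a sum of nonnegative multiples of two of its elements.\<close>
  define e where "e t = t *\<^sub>R A ?u + (t\<^sup>2/2) *\<^sub>R k" for t
  let ?F = "at_right (0::real)"
  have T0: "((\<lambda>t. t) \<longlongrightarrow> 0) ?F" by (rule tendsto_ident_at)
  have q: "(q \<longlongrightarrow> ?u) ?F"
    unfolding q_def using T0 by (auto intro!: tendsto_eq_intros)
  have tq: "((\<lambda>t. norm (t *\<^sub>R q t)) \<longlongrightarrow> 0) ?F"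
    using tendsto_norm[OF tendsto_scaleR[OF T0 q]] by simp
  have elim0: "(e \<longlongrightarrow> 0) ?F"
    unfolding e_def using T0 by (auto intro!: tendsto_eq_intros)
  have D2lim: "((\<lambda>t. D2 G ?z (q t) (q t)) \<longlongrightarrow> b) ?F"
    unfolding b_def by (rule bounded_bilinear.tendsto[OF bounded_bilinear_D2[OF G] q q])
  have ev: "\<forall>\<^sub>F t in ?F. t > 0" "\<forall>\<^sub>F t in ?F. t < \<epsilon>"
    "\<forall>\<^sub>F t in ?F. norm (t *\<^sub>R q t) < \<delta>\<^sub>2" "\<forall>\<^sub>F t in ?F. norm (t *\<^sub>R q t) < \<delta>\<^sub>0"
    "\<forall>\<^sub>F t in ?F. norm (t *\<^sub>R q t) < \<delta> / 2"
    "\<forall>\<^sub>F t in ?F. norm (e t) < \<delta>\<^sub>0" "\<forall>\<^sub>F t in ?F. norm (q t) < norm u + 1"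
    "\<forall>\<^sub>F t in ?F. dist (D2 G ?z (q t) (q t)) b < \<epsilon>\<^sub>1 / 2"
    "\<forall>\<^sub>F t in ?F. 2 * \<kappa> * \<epsilon>\<^sub>1 * t\<^sup>2 < \<delta> / 2"
    "\<forall>\<^sub>F t in ?F. t * (norm v + 2 * \<kappa> * \<epsilon>\<^sub>1) < \<epsilon>"
  proof -
    show "\<forall>\<^sub>F t in ?F. t > 0" by (rule eventually_at_right_less)
    show "\<forall>\<^sub>F t in ?F. t < \<epsilon>" using order_tendstoD(2)[OF T0 \<epsilon>] .
    show "\<forall>\<^sub>F t in ?F. norm (t *\<^sub>R q t) < \<delta>\<^sub>2" "\<forall>\<^sub>F t in ?F. norm (t *\<^sub>R q t) < \<delta>\<^sub>0"
      "\<forall>\<^sub>F t in ?F. norm (t *\<^sub>R q t) < \<delta> / 2"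
      using order_tendstoD(2)[OF tq \<delta>\<^sub>2(1)] order_tendstoD(2)[OF tq \<delta>\<^sub>0]
        order_tendstoD(2)[OF tq, of "\<delta> / 2"] l(1) by auto
    show "\<forall>\<^sub>F t in ?F. norm (e t) < \<delta>\<^sub>0"
      using order_tendstoD(2)[OF tendsto_norm[OF elim0], of \<delta>\<^sub>0] \<delta>\<^sub>0 by simp
    show "\<forall>\<^sub>F t in ?F. norm (q t) < norm u + 1"
      using order_tendstoD(2)[OF tendsto_norm[OF q], of "norm u + 1"] by (simp add: norm_Pair)
    show "\<forall>\<^sub>F t in ?F. dist (D2 G ?z (q t) (q t)) b < \<epsilon>\<^sub>1 / 2"
      using tendstoD[OF D2lim, of "\<epsilon>\<^sub>1 / 2"] \<epsilon>\<^sub>1(1) by simp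
    have "((\<lambda>t. 2 * \<kappa> * \<epsilon>\<^sub>1 * t\<^sup>2) \<longlongrightarrow> 0) ?F" using T0 by (auto intro!: tendsto_eq_intros)
    from order_tendstoD(2)[OF this, of "\<delta> / 2"]
    show "\<forall>\<^sub>F t in ?F. 2 * \<kappa> * \<epsilon>\<^sub>1 * t\<^sup>2 < \<delta> / 2" using l(1) by simp
    have "((\<lambda>t. t * (norm v + 2 * \<kappa> * \<epsilon>\<^sub>1)) \<longlongrightarrow> 0) ?F" using T0 by (auto intro!: tendsto_eq_intros)
    from order_tendstoD(2)[OF this \<epsilon>]
    show "\<forall>\<^sub>F t in ?F. t * (norm v + 2 * \<kappa> * \<epsilon>\<^sub>1) < \<epsilon>" .
  qed
  have "\<forall>\<^sub>F t in ?F. t > 0 \<and> t < \<epsilon> \<and> norm (t *\<^sub>R q t) < \<delta>\<^sub>2 \<and> norm (t *\<^sub>R q t) < \<delta>\<^sub>0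
      \<and> norm (t *\<^sub>R q t) < \<delta> / 2 \<and> norm (e t) < \<delta>\<^sub>0 \<and> norm (q t) < norm u + 1
      \<and> dist (D2 G ?z (q t) (q t)) b < \<epsilon>\<^sub>1 / 2 \<and> 2 * \<kappa> * \<epsilon>\<^sub>1 * t\<^sup>2 < \<delta> / 2
      \<and> t * (norm v + 2 * \<kappa> * \<epsilon>\<^sub>1) < \<epsilon>"
    using ev by eventually_elim blast
  then obtain t where t: "t > 0" "t < \<epsilon>" "norm (t *\<^sub>R q t) < \<delta>\<^sub>2" "norm (t *\<^sub>R q t) < \<delta>\<^sub>0"
    "norm (t *\<^sub>R q t) < \<delta> / 2" "norm (e t) < \<delta>\<^sub>0" "norm (q t) < norm u + 1"
    "dist (D2 G ?z (q t) (q t)) b < \<epsilon>\<^sub>1 / 2" "2 * \<kappa> * \<epsilon>\<^sub>1 * t\<^sup>2 < \<delta> / 2"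
    "t * (norm v + 2 * \<kappa> * \<epsilon>\<^sub>1) < \<epsilon>"
    using eventually_happens[of _ ?F] trivial_limit_at_right_real by blast
  define p x where "p = pb + (t\<^sup>2/2) *\<^sub>R fst v" and "x = xb + t *\<^sub>R u + (t\<^sup>2/2) *\<^sub>R snd v"
  have px: "(p, x) = ?z + t *\<^sub>R q t"
    by (cases v) (simp add: p_def x_def q_def power2_eq_square scaleR_add_right)
  have err: "norm (G (p, x) - e t) \<le> \<epsilon>\<^sub>1 * t\<^sup>2"
  proof -
    have Aq: "A (t *\<^sub>R q t) = t *\<^sub>R A ?u + (t\<^sup>2/2) *\<^sub>R A v"
      unfolding q_def scaleR_add_right linear_add[OF linear_A] linear_cmul[OF linear_A]
      by (simp add: power2_eq_square)
    interpret D2: bounded_bilinear "D2 G ?z" by (rule bounded_bilinear_D2[OF G])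
    have Dq: "D2 G ?z (t *\<^sub>R q t) (t *\<^sub>R q t) = t\<^sup>2 *\<^sub>R D2 G ?z (q t) (q t)"
      by (simp add: D2.scaleR_left D2.scaleR_right power2_eq_square)
    have "G (p, x) - e t = (G (?z + t *\<^sub>R q t) - G ?z - A (t *\<^sub>R q t)
          - (1/2) *\<^sub>R D2 G ?z (t *\<^sub>R q t) (t *\<^sub>R q t))
        + (t\<^sup>2/2) *\<^sub>R (D2 G ?z (q t) (q t) - b) + (t\<^sup>2/2) *\<^sub>R (b + A v - k)"
      by (simp add: px G0 Aq Dq e_def algebra_simps)
    then have "norm (G (p, x) - e t) \<le> norm (G (?z + t *\<^sub>R q t) - G ?z - A (t *\<^sub>R q t)
          - (1/2) *\<^sub>R D2 G ?z (t *\<^sub>R q t) (t *\<^sub>R q t))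
        + norm ((t\<^sup>2/2) *\<^sub>R (D2 G ?z (q t) (q t) - b)) + norm ((t\<^sup>2/2) *\<^sub>R (b + A v - k))"
      using norm_triangle_le norm_triangle_ineq by (metis (no_types, lifting) add_mono order_refl)
    also have "\<dots> \<le> \<epsilon>\<^sub>1 / 4 * t\<^sup>2 + (t\<^sup>2/2) * (\<epsilon>\<^sub>1 / 2) + (t\<^sup>2/2) * \<epsilon>\<^sub>1"
    proof (intro add_mono)
      have "norm (G (?z + t *\<^sub>R q t) - G ?z - A (t *\<^sub>R q t)
          - (1/2) *\<^sub>R D2 G ?z (t *\<^sub>R q t) (t *\<^sub>R q t)) \<le> \<eta> * (norm (t *\<^sub>R q t))\<^sup>2"
        by (rule \<delta>\<^sub>2(2)[OF t(3)])
      also have "\<dots> = \<eta> * (norm (q t))\<^sup>2 * t\<^sup>2" by (simp add: power_mult_distrib)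
      also have "\<dots> \<le> \<eta> * (norm u + 1)\<^sup>2 * t\<^sup>2"
        using t(7) \<eta>(1) by (intro mult_right_mono mult_left_mono power_mono) auto
      finally show "norm (G (?z + t *\<^sub>R q t) - G ?z - A (t *\<^sub>R q t)
          - (1/2) *\<^sub>R D2 G ?z (t *\<^sub>R q t) (t *\<^sub>R q t)) \<le> \<epsilon>\<^sub>1 / 4 * t\<^sup>2" by (simp only: \<eta>(2))
      have "norm (D2 G ?z (q t) (q t) - b) \<le> \<epsilon>\<^sub>1 / 2" using t(8) by (simp add: dist_norm)
      then show "norm ((t\<^sup>2/2) *\<^sub>R (D2 G ?z (q t) (q t) - b)) \<le> (t\<^sup>2/2) * (\<epsilon>\<^sub>1 / 2)"
        unfolding norm_scaleR by (intro mult_mono) auto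
      show "norm ((t\<^sup>2/2) *\<^sub>R (b + A v - k)) \<le> (t\<^sup>2/2) * \<epsilon>\<^sub>1"
        unfolding norm_scaleR using k(2) by (intro mult_mono) auto
    qed
    also have "\<dots> = \<epsilon>\<^sub>1 * t\<^sup>2" by (simp add: algebra_simps)
    finally show ?thesis .
  qed
  \<comment> \<open>The factor 2 leaves room for the strict inequality in
    \<open>regular\<close>.\<close>
  have "\<exists>x'\<in>\<Gamma> p. norm (x' - x) < 2 * \<kappa> * \<epsilon>\<^sub>1 * t\<^sup>2"
  proof (rule regular)
    show "norm ((p, x) - (pb, xb)) < \<delta>\<^sub>0" using t(4) by (simp add: px)
    show "e t \<in> K" unfolding e_def using t(1) u(1) k(1)
      by (intro convex_cone_add[OF K] convex_cone_scaleR[OF K]) auto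
    show "norm (e t) < \<delta>\<^sub>0" by (rule t(6))
    have "\<kappa> * norm (e t - G (p, x)) \<le> \<kappa> * (\<epsilon>\<^sub>1 * t\<^sup>2)"
      using err \<kappa> by (simp add: norm_minus_commute)
    also have "\<dots> < 2 * \<kappa> * \<epsilon>\<^sub>1 * t\<^sup>2" using \<kappa> \<epsilon>\<^sub>1(1) t(1) by simp
    finally show "\<kappa> * norm (e t - G (p, x)) < 2 * \<kappa> * \<epsilon>\<^sub>1 * t\<^sup>2" .
  qed
  then obtain x' where x': "x' \<in> \<Gamma> p" "norm (x' - x) < 2 * \<kappa> * \<epsilon>\<^sub>1 * t\<^sup>2" by blast
  have "norm (p - pb) = (t\<^sup>2/2) * norm (fst v)" by (simp add: p_def)
  also have "\<dots> \<le> t\<^sup>2 * norm v" by (intro mult_mono norm_fst_le[of "fst v" "snd v", unfolded prod.collapse]) auto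
  also have "\<dots> = t * norm v * t" by (simp add: power2_eq_square)
  also have "\<dots> \<le> (t * (norm v + 2 * \<kappa> * \<epsilon>\<^sub>1)) * t"
    using t(1) \<kappa> \<epsilon>\<^sub>1(1) by (intro mult_right_mono mult_left_mono) auto
  also have "\<dots> \<le> \<epsilon> * t" using t(1,10) by (intro mult_right_mono) auto
  finally have p_le: "norm (p - pb) \<le> \<epsilon> * t" .
  have "x' - xb - t *\<^sub>R u = (x' - x) + (t\<^sup>2/2) *\<^sub>R snd v" by (simp add: x_def)
  then have "norm (x' - xb - t *\<^sub>R u) \<le> norm (x' - x) + norm ((t\<^sup>2/2) *\<^sub>R snd v)"
    by (simp only: norm_triangle_ineq)
  also have "norm ((t\<^sup>2/2) *\<^sub>R snd v) \<le> t\<^sup>2 * norm v"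
    unfolding norm_scaleR by (intro mult_mono norm_snd_le[of "snd v" "fst v", unfolded prod.collapse]) auto
  finally have "norm (x' - xb - t *\<^sub>R u) \<le> (t * (norm v + 2 * \<kappa> * \<epsilon>\<^sub>1)) * t"
    using x'(2) by (simp add: power2_eq_square algebra_simps)
  also have "\<dots> \<le> \<epsilon> * t" using t(1,10) by (intro mult_right_mono) auto
  finally have x_le: "norm (x' - xb - t *\<^sub>R u) \<le> \<epsilon> * t" .
  have xx': "norm ((p, x') - (p, x)) = norm (x' - x)" by (simp add: norm_Pair)
  have px\<delta>: "norm ((p, x) - ?z) < \<delta> / 2" using t(5) by (simp add: px)
  have "norm ((p, x') - ?z) \<le> norm ((p, x') - (p, x)) + norm ((p, x) - ?z)"
    using norm_triangle_ineq[of "(p, x') - (p, x)" "(p, x) - ?z"] by (simp only: diff_add_cancel add_diff_eq)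
  then have "norm ((p, x') - ?z) < \<delta>" using px\<delta> xx' x'(2) t(9) by simp
  then have "norm (G (p, x') - G (p, x)) \<le> l * norm (x' - x)"
    using l(3)[of "(p, x)" "(p, x')"] px\<delta> l(1) xx' by simp
  also have "\<dots> \<le> l * (2 * \<kappa> * \<epsilon>\<^sub>1 * t\<^sup>2)" using x'(2) l(2) by (intro mult_left_mono) auto
  finally have "norm (G (p, x') - G (p, x)) \<le> 2 * l * \<kappa> * \<epsilon>\<^sub>1 * t\<^sup>2" by (simp add: mult_ac)
  moreover have "norm (G (p, x') - e t) \<le> norm (G (p, x') - G (p, x)) + norm (G (p, x) - e t)"
    by norm
  ultimately have Ge: "norm (G (p, x') - e t) \<le> (1 + 2 * l * \<kappa>) * (\<epsilon>\<^sub>1 * t\<^sup>2)"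
    using err by (simp add: algebra_simps)
  have "\<bar>\<mu> \<bullet> (G (p, x') - e t)\<bar> \<le> norm \<mu> * norm (G (p, x') - e t)" by (rule Cauchy_Schwarz_ineq2)
  also have "\<dots> \<le> norm \<mu> * ((1 + 2 * l * \<kappa>) * (\<epsilon>\<^sub>1 * t\<^sup>2))" using Ge by (intro mult_left_mono) auto
  finally have 1: "\<mu> \<bullet> G (p, x') \<ge> \<mu> \<bullet> e t - norm \<mu> * ((1 + 2 * l * \<kappa>) * (\<epsilon>\<^sub>1 * t\<^sup>2))"
    by (simp add: inner_diff_right)
  have "\<mu> \<bullet> e t = (t\<^sup>2/2) * (\<mu> \<bullet> k)" by (simp add: e_def inner_add_right u(2))
  also have "\<dots> \<ge> (t\<^sup>2/2) * (- \<epsilon>\<^sub>1)" using k(3) by (intro mult_left_mono) auto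
  finally have "(t\<^sup>2/2) * (- \<epsilon>\<^sub>1) \<le> \<mu> \<bullet> e t" .
  moreover have "(t\<^sup>2/2) * (- \<epsilon>\<^sub>1) = - (\<epsilon>\<^sub>1 * t\<^sup>2) / 2" by simp
  moreover have "0 \<le> \<epsilon>\<^sub>1 * t\<^sup>2" using \<epsilon>\<^sub>1(1) by simp
  ultimately have "\<mu> \<bullet> e t \<ge> - (\<epsilon>\<^sub>1 * t\<^sup>2)" by linarith
  then have "\<mu> \<bullet> G (p, x') \<ge> - (\<epsilon>\<^sub>1 * c) * t\<^sup>2"
    using 1 by (simp add: c_def algebra_simps)
  then show ?thesis using that t(1,2) p_le x_le x'(1) \<epsilon>\<^sub>1(2) by simp
qed

end

section \<open>Normal vectors along the feasible arc\<close>

lemma norm_inverse_scaleR_le: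
  fixes y :: "'a::real_normed_vector"
  assumes "s > 0" "norm y \<le> e * s" shows "norm (y /\<^sub>R s) \<le> e"
proof -
  have "norm (y /\<^sub>R s) = norm y / s" using assms(1) by (simp add: divide_inverse mult.commute)
  then show ?thesis using assms by (simp add: pos_divide_le_eq)
qed

context reduced_system begin

text \<open>To first order a + t H is the x-gradient of \<mu> . G at (pb, xb + t u). The mean value
  theorem turns the increment over d into a derivative at an intermediate point, whose offset from
  the ray exceeds that of (p, x) by at most |d|. The constant \<open>c\<close> is independent of
  \<eta>, so the proximal weight can be fixed before \<eta> is made small.\<close>

lemma gradient_estimate:
  assumes a: "\<And>d. a \<bullet> d = \<mu> \<bullet> A (0, d)" and H: "\<And>d. H \<bullet> d = \<mu> \<bullet> D2 G (pb, xb) (0, u) (0, d)"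
  obtains c where "c \<ge> 0" "\<And>\<eta>. \<eta> > 0 \<Longrightarrow> \<exists>\<delta>>0. \<forall>p x d t.
      norm ((p, x) - (pb, xb)) < \<delta> \<longrightarrow> norm ((p, x + d) - (pb, xb)) < \<delta> \<longrightarrow> t \<ge> 0 \<longrightarrow>
      \<bar>\<mu> \<bullet> (G (p, x + d) - G (p, x)) - a \<bullet> d - t * (H \<bullet> d)\<bar>
        \<le> (c * (norm ((p, x) - (pb, xb) - t *\<^sub>R (0, u)) + norm d)
          + \<eta> * (t + norm ((p, x) - (pb, xb) - t *\<^sub>R (0, u)) + norm d)) * norm d"
proof -
  let ?z = "(pb, xb)"
  interpret D2: bounded_bilinear "D2 G ?z" by (rule bounded_bilinear_D2[OF G])
  obtain M where M: "M > 0" "\<And>a b. norm (D2 G ?z a b) \<le> norm a * norm b * M"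
    using D2.pos_bounded by blast
  show ?thesis
  proof (rule that)
    show "norm \<mu> * M \<ge> 0" using M(1) by simp
  next
    fix \<eta> :: real assume \<eta>: "\<eta> > 0"
    \<comment> \<open>The intermediate point is within (|u| + 1) (t + r + |d|) of z, and pairing
      with \<mu> costs |\<mu>|; both factors are divided out in advance.\<close>
    define \<eta>\<^sub>1 where "\<eta>\<^sub>1 = \<eta> / ((norm \<mu> + 1) * (norm u + 1))"
    have pos: "(norm \<mu> + 1) * (norm u + 1) > 0" by (simp add: add_nonneg_pos)
    have \<eta>\<^sub>1: "\<eta>\<^sub>1 > 0" "\<eta>\<^sub>1 * ((norm \<mu> + 1) * (norm u + 1)) = \<eta>"
      using \<eta> pos by (auto simp: \<eta>\<^sub>1_def)
    obtain \<delta> where \<delta>: "\<delta> > 0" "\<And>y. norm (y - ?z) < \<delta> \<Longrightarrow> G differentiable (at y)"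
      "\<And>y b. norm (y - ?z) < \<delta> \<Longrightarrow>
        norm (D1 G y b - A b - D2 G ?z (y - ?z) b) \<le> \<eta>\<^sub>1 * norm (y - ?z) * norm b"
      using D1_expansion[OF G \<eta>\<^sub>1(1)] by blast
    show "\<exists>\<delta>>0. \<forall>p x d t.
      norm ((p, x) - ?z) < \<delta> \<longrightarrow> norm ((p, x + d) - ?z) < \<delta> \<longrightarrow> t \<ge> 0 \<longrightarrow>
      \<bar>\<mu> \<bullet> (G (p, x + d) - G (p, x)) - a \<bullet> d - t * (H \<bullet> d)\<bar>
        \<le> (norm \<mu> * M * (norm ((p, x) - ?z - t *\<^sub>R (0, u)) + norm d)
          + \<eta> * (t + norm ((p, x) - ?z - t *\<^sub>R (0, u)) + norm d)) * norm d"
    proof (intro exI[of _ \<delta>] conjI allI impI \<delta>(1))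
      fix p :: 'p and x d :: 'x and t :: real
      assume x: "norm ((p, x) - ?z) < \<delta>" "norm ((p, x + d) - ?z) < \<delta>" and t: "t \<ge> 0"
      define r where "r = norm ((p, x) - ?z - t *\<^sub>R (0, u))"
      have r0: "r \<ge> 0" by (simp add: r_def)
      have mem_iff: "y \<in> ball ?z \<delta> \<longleftrightarrow> norm (y - ?z) < \<delta>" for y
        by (metis dist_commute dist_norm mem_ball)
      have near: "norm ((p, x + s *\<^sub>R d) - ?z) < \<delta>" if "0 \<le> s" "s \<le> 1" for s
      proof -
        have "(p, x + s *\<^sub>R d) = (1 - s) *\<^sub>R (p, x) + s *\<^sub>R (p, x + d)"
          by (simp add: algebra_simps)
        also have "\<dots> \<in> ball ?z \<delta>"
          using x that by (intro convexD[OF convex_ball]) (auto simp only: mem_iff)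
        finally show ?thesis by (simp only: mem_iff)
      qed
      have "\<exists>s\<in>{0<..<1}. \<mu> \<bullet> G (p, x + 1 *\<^sub>R d) - \<mu> \<bullet> G (p, x + 0 *\<^sub>R d)
          = (\<lambda>h. \<mu> \<bullet> D1 G (p, x + s *\<^sub>R d) (h *\<^sub>R (0, d))) (1 - 0)"
      proof (rule mvt_simple[OF zero_less_one])
        fix s :: real assume s: "0 \<le> s" "s \<le> 1"
        have "((\<lambda>s. (p, x + s *\<^sub>R d)) has_derivative (\<lambda>h. h *\<^sub>R (0, d))) (at s)"
          by (auto intro!: derivative_eq_intros)
        from diff_chain_at[OF this D1_has_derivative[OF \<delta>(2)[OF near[OF s]]]]
        have "((\<lambda>s. G (p, x + s *\<^sub>R d)) has_derivative (\<lambda>h. D1 G (p, x + s *\<^sub>R d) (h *\<^sub>R (0, d)))) (at s)"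
          by (simp add: o_def)
        from has_derivative_at_withinI[OF has_derivative_inner_right[OF this]]
        show "((\<lambda>s. \<mu> \<bullet> G (p, x + s *\<^sub>R d)) has_derivative
            (\<lambda>h. \<mu> \<bullet> D1 G (p, x + s *\<^sub>R d) (h *\<^sub>R (0, d)))) (at s within {0..1})" .
      qed
      then obtain s where s: "0 < s" "s < 1"
        "\<mu> \<bullet> (G (p, x + d) - G (p, x)) = \<mu> \<bullet> D1 G (p, x + s *\<^sub>R d) (0, d)"
        by (auto simp: inner_diff_right)
      define y where "y = (p, x + s *\<^sub>R d)"
      \<comment> \<open>The offset of the intermediate point from z + t (0, u); splitting it off by
        bilinearity isolates the term t H . d.\<close>
      define e where "e = ((p, x) - ?z - t *\<^sub>R (0, u)) + s *\<^sub>R (0, d)"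
      have ye: "y - ?z = t *\<^sub>R (0, u) + e" by (simp add: y_def e_def)
      have "norm (s *\<^sub>R (0::'p, d)) \<le> norm d" using s by (simp add: norm_Pair mult_left_le_one_le)
      then have e_le: "norm e \<le> r + norm d"
        unfolding e_def r_def by (rule norm_triangle_le[OF add_left_mono])
      have "norm (y - ?z) \<le> t * norm u + (r + norm d)"
        unfolding ye using t e_le by (intro norm_triangle_le add_mono) (simp_all add: norm_Pair)
      also have "\<dots> \<le> t * norm u + t + (r + norm d) * norm u + (r + norm d)"
        using t by (simp add: r_def)
      also have "\<dots> = (norm u + 1) * (t + r + norm d)" by (simp add: algebra_simps)
      finally have y_le: "norm (y - ?z) \<le> (norm u + 1) * (t + r + norm d)" .
      have "\<mu> \<bullet> (G (p, x + d) - G (p, x)) - a \<bullet> d - t * (H \<bullet> d)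
          = \<mu> \<bullet> (D1 G y (0, d) - A (0, d) - D2 G ?z (y - ?z) (0, d)) + \<mu> \<bullet> D2 G ?z e (0, d)"
        unfolding ye s(3) a H y_def[symmetric] D2.add_left D2.scaleR_left
        by (simp add: inner_diff_right inner_add_right)
      also have "\<bar>\<dots>\<bar> \<le> norm \<mu> * (\<eta>\<^sub>1 * norm (y - ?z) * norm d) + norm \<mu> * (norm e * norm d * M)"
      proof (rule order_trans[OF abs_triangle_ineq], rule add_mono)
        have "norm (D1 G y (0, d) - A (0, d) - D2 G ?z (y - ?z) (0, d))
            \<le> \<eta>\<^sub>1 * norm (y - ?z) * norm (0::'p, d)"
          unfolding y_def using s by (intro \<delta>(3) near) auto
        then show "\<bar>\<mu> \<bullet> (D1 G y (0, d) - A (0, d) - D2 G ?z (y - ?z) (0, d))\<bar>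
            \<le> norm \<mu> * (\<eta>\<^sub>1 * norm (y - ?z) * norm d)"
          by (intro order_trans[OF Cauchy_Schwarz_ineq2] mult_left_mono) (simp_all add: norm_Pair)
        show "\<bar>\<mu> \<bullet> D2 G ?z e (0, d)\<bar> \<le> norm \<mu> * (norm e * norm d * M)"
          using M(2)[of e "(0, d)"]
          by (intro order_trans[OF Cauchy_Schwarz_ineq2] mult_left_mono) (simp_all add: norm_Pair)
      qed
      also have "\<dots> \<le> (norm \<mu> + 1) * (\<eta>\<^sub>1 * ((norm u + 1) * (t + r + norm d)) * norm d)
          + norm \<mu> * ((r + norm d) * norm d * M)"
        using M(1) \<eta>\<^sub>1(1) y_le e_le t r0 by (intro add_mono mult_mono mult_nonneg_nonneg) auto
      also have "\<dots> = (norm \<mu> * M * (r + norm d)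
          + \<eta>\<^sub>1 * ((norm \<mu> + 1) * (norm u + 1)) * (t + r + norm d)) * norm d"
        by (simp add: algebra_simps)
      finally show "\<bar>\<mu> \<bullet> (G (p, x + d) - G (p, x)) - a \<bullet> d - t * (H \<bullet> d)\<bar>
        \<le> (norm \<mu> * M * (norm ((p, x) - ?z - t *\<^sub>R (0, u)) + norm d)
          + \<eta> * (t + norm ((p, x) - ?z - t *\<^sub>R (0, u)) + norm d)) * norm d"
        unfolding \<eta>\<^sub>1(2) r_def .
    qed
  qed
qed

text \<open>The normal vectors come from minimising a proximal perturbation of a linear functional over
  \<open>\<Gamma> p\<close>; the feasible arc is an \<open>o(t\<^sup>2)\<close>-approximate minimiser, so that the exact minimiser
  lies within \<open>o(t)\<close> of it.\<close>
lemma normal_cone_arc: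
  assumes \<mu>: "\<mu> \<in> polar_cone K"
    and a: "\<And>d. a \<bullet> d = \<mu> \<bullet> A (0, d)" and H: "\<And>d. H \<bullet> d = \<mu> \<bullet> D2 G (pb, xb) (0, u) (0, d)"
    and arc: "\<And>\<epsilon>. \<epsilon> > 0 \<Longrightarrow> \<exists>t p x. 0 < t \<and> t < \<epsilon> \<and> norm (p - pb) \<le> \<epsilon> * t
      \<and> norm (x - xb - t *\<^sub>R u) \<le> \<epsilon> * t \<and> x \<in> \<Gamma> p \<and> \<mu> \<bullet> G (p, x) \<ge> - \<epsilon> * t\<^sup>2"
    and \<xi>u: "\<xi> \<bullet> u = 0" and \<xi>: "\<And>w. A (0, w) \<in> K \<Longrightarrow> \<mu> \<bullet> A (0, w) = 0 \<Longrightarrow> \<xi> \<bullet> w \<le> 0"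
    and u: "\<mu> \<bullet> A (0, u) = 0"
    and \<epsilon>: "\<epsilon> > 0"
  obtains t p x y where "0 < t" "t < \<epsilon>" "norm (p - pb) \<le> \<epsilon> * t" "norm (x - xb - t *\<^sub>R u) \<le> \<epsilon> * t"
    "y \<in> regular_normal_cone (\<Gamma> p) x" "norm (y - a - t *\<^sub>R (\<xi> + H)) \<le> \<epsilon> * t"
proof -
  let ?z = "(pb, xb)"
  obtain c where c: "c \<ge> 0" "\<And>\<eta>. \<eta> > 0 \<Longrightarrow> \<exists>\<delta>>0. \<forall>p x d t.
      norm ((p, x) - ?z) < \<delta> \<longrightarrow> norm ((p, x + d) - ?z) < \<delta> \<longrightarrow> t \<ge> 0 \<longrightarrow>
      \<bar>\<mu> \<bullet> (G (p, x + d) - G (p, x)) - a \<bullet> d - t * (H \<bullet> d)\<bar>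
        \<le> (c * (norm ((p, x) - ?z - t *\<^sub>R (0, u)) + norm d)
          + \<eta> * (t + norm ((p, x) - ?z - t *\<^sub>R (0, u)) + norm d)) * norm d"
    using gradient_estimate[OF a H] by blast
  obtain \<delta>\<^sub>1 where \<delta>\<^sub>1: "\<delta>\<^sub>1 > 0" "\<And>p x d t.
      norm ((p, x) - ?z) < \<delta>\<^sub>1 \<Longrightarrow> norm ((p, x + d) - ?z) < \<delta>\<^sub>1 \<Longrightarrow> t \<ge> 0 \<Longrightarrow>
      \<bar>\<mu> \<bullet> (G (p, x + d) - G (p, x)) - a \<bullet> d - t * (H \<bullet> d)\<bar>
        \<le> (c * (norm ((p, x) - ?z - t *\<^sub>R (0, u)) + norm d)
          + 1 * (t + norm ((p, x) - ?z - t *\<^sub>R (0, u)) + norm d)) * norm d"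
    using c(2)[of 1] by auto
  obtain \<delta>\<^sub>2 where \<delta>\<^sub>2: "\<delta>\<^sub>2 > 0" "\<And>y. norm (y - ?z) < \<delta>\<^sub>2 \<Longrightarrow> G differentiable (at y)"
    using D1_expansion[OF G zero_less_one] by metis
  \<comment> \<open>Half of the smallest radius, because the norm of a pair is estimated by the sum
    of the two norms.\<close>
  define R where "R = min \<delta>\<^sub>0 (min \<delta>\<^sub>1 \<delta>\<^sub>2) / 2"
  have R: "R > 0" "2 * R \<le> \<delta>\<^sub>0" "2 * R \<le> \<delta>\<^sub>1" "2 * R \<le> \<delta>\<^sub>2"
    using \<delta>\<^sub>0 \<delta>\<^sub>1(1) \<delta>\<^sub>2(1) by (auto simp: R_def)
  have inR: "norm ((p, x) - ?z) < \<delta>\<^sub>0" "norm ((p, x) - ?z) < \<delta>\<^sub>1" "norm ((p, x) - ?z) < \<delta>\<^sub>2"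
    if "norm (p - pb) < R" "norm (x - xb) \<le> R" for p x
    using norm_Pair_le[of "p - pb" "x - xb"] that R by auto
  \<comment> \<open>Bounds accuracies and times alike, so that all arc points, not only late ones,
    lie in the box of size \<open>R\<close>.\<close>
  define c\<^sub>0 where "c\<^sub>0 = min 1 (R / (2 * (norm u + 2)))"
  have nu2: "norm u + 2 > 0" by (simp add: add_nonneg_pos)
  have c\<^sub>0: "c\<^sub>0 > 0" "c\<^sub>0 \<le> 1" "c\<^sub>0 * (norm u + 2) < R"
  proof -
    show "c\<^sub>0 > 0" "c\<^sub>0 \<le> 1" using R nu2 by (auto simp: c\<^sub>0_def)
    have "c\<^sub>0 * (norm u + 2) \<le> R / (2 * (norm u + 2)) * (norm u + 2)"
      using nu2 by (intro mult_right_mono) (auto simp: c\<^sub>0_def)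
    also have "\<dots> = R / 2"
    proof -
      have "R / (2 * n) * n = R / 2" if "n > 0" for n using that by simp
      from this[OF nu2] show ?thesis .
    qed
    finally show "c\<^sub>0 * (norm u + 2) < R" using R(1) by simp
  qed
  define E where "E k = c\<^sub>0 * inverse (real (Suc k))" for k
  have E: "E k > 0" "E k \<le> c\<^sub>0" for k using c\<^sub>0(1) by (auto simp: E_def field_simps)
  have Elim: "E \<longlonglongrightarrow> 0"
    unfolding E_def using tendsto_mult[OF tendsto_const LIMSEQ_inverse_real_of_nat, of c\<^sub>0] by simp
  have "\<forall>k. \<exists>t p x. 0 < t \<and> t < E k \<and> norm (p - pb) \<le> E k * t
      \<and> norm (x - xb - t *\<^sub>R u) \<le> E k * t \<and> x \<in> \<Gamma> p \<and> \<mu> \<bullet> G (p, x) \<ge> - E k * t\<^sup>2"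
    using arc[OF E(1)] by blast
  then obtain t p X where
    t: "\<And>k. 0 < t k" "\<And>k. t k < E k" and p: "\<And>k. norm (p k - pb) \<le> E k * t k"
    and X: "\<And>k. norm (X k - xb - t k *\<^sub>R u) \<le> E k * t k" "\<And>k. X k \<in> \<Gamma> (p k)"
      "\<And>k. \<mu> \<bullet> G (p k, X k) \<ge> - E k * (t k)\<^sup>2"
    by metis
  have E1: "E k \<le> 1" for k using E(2)[of k] c\<^sub>0(2) by simp
  have Et: "E k * t k \<le> t k" "t k \<le> 1" "t k \<le> c\<^sub>0" for k
    using E1[of k] t[of k] E(2)[of k] c\<^sub>0(2) by (auto simp: mult_left_le_one_le E(1) less_imp_le)
  have tlim: "t \<longlonglongrightarrow> 0"
    by (rule tendsto_sandwich[of "\<lambda>_. 0" t sequentially E]) (use t Elim in \<open>auto simp: less_imp_le\<close>)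
  have pR: "norm (p k - pb) < R" for k
  proof -
    have "norm (p k - pb) \<le> c\<^sub>0 * 1" using p[of k] Et(1,3)[of k] by linarith
    also have "\<dots> \<le> c\<^sub>0 * (norm u + 2)"
      using c\<^sub>0(1) norm_ge_zero[of u] by (intro mult_left_mono) (auto simp del: norm_ge_zero)
    finally show ?thesis using c\<^sub>0(3) by simp
  qed
  have XR: "norm (X k - xb) \<le> R" for k
  proof -
    have "norm (X k - xb) \<le> norm (X k - xb - t k *\<^sub>R u) + norm (t k *\<^sub>R u)"
      using norm_triangle_ineq[of "X k - xb - t k *\<^sub>R u" "t k *\<^sub>R u"] by simp
    also have "\<dots> \<le> c\<^sub>0 + c\<^sub>0 * norm u"
    proof (rule add_mono)
      show "norm (X k - xb - t k *\<^sub>R u) \<le> c\<^sub>0" using X(1)[of k] Et(1,3)[of k] by linarith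
      show "norm (t k *\<^sub>R u) \<le> c\<^sub>0 * norm u"
        using Et(3)[of k] t(1)[of k] by (simp add: mult_right_mono)
    qed
    also have "\<dots> \<le> c\<^sub>0 * (norm u + 2)" using c\<^sub>0(1) by (simp add: algebra_simps)
    finally show ?thesis using c\<^sub>0(3) by simp
  qed
  \<comment> \<open>Half the weight is c + 2: c pays for the curvature of \<mu> . G, one unit for
    the \<eta> term, and one unit of |d|^2 is left over.\<close>
  define \<rho> where "\<rho> = 2 * (c + 2)"
  have \<rho>: "\<rho> > 0" using c(1) by (simp add: \<rho>_def)
  \<comment> \<open>The normal wanted at time t k; the problem below minimises - v k . x plus a
    penalty on the distance to the arc point.\<close>
  define v where "v k = a + t k *\<^sub>R (\<xi> + H)" for k
  \<comment> \<open>The ball provides compactness; at the index chosen in the end the minimiser lies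
    in its interior.\<close>
  define S where "S k = {x \<in> cball xb R. G (p k, x) \<in> K}" for k
  have Siff: "x \<in> S k \<longleftrightarrow> norm (x - xb) \<le> R \<and> x \<in> \<Gamma> (p k)" for x k
    using \<Gamma>_iff[OF inR(1)[OF pR]] by (auto simp: S_def dist_norm norm_minus_commute)
  have "\<exists>x\<in>S k. \<forall>y\<in>S k. \<rho>/2 * (norm (x - X k))\<^sup>2 - v k \<bullet> x \<le> \<rho>/2 * (norm (y - X k))\<^sup>2 - v k \<bullet> y" for k
  proof (rule continuous_attains_inf)
    have "continuous_on (cball xb R) (\<lambda>x. G (p k, x))"
    proof (rule continuous_on_compose2[of "{z. norm (z - ?z) < \<delta>\<^sub>2}" G])
      show "continuous_on {z. norm (z - ?z) < \<delta>\<^sub>2} G"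
        using \<delta>\<^sub>2(2) by (intro continuous_at_imp_continuous_on ballI differentiable_imp_continuous_within) simp
      show "continuous_on (cball xb R) (\<lambda>x. (p k, x))" by (intro continuous_intros)
      show "(\<lambda>x. (p k, x)) ` cball xb R \<subseteq> {z. norm (z - ?z) < \<delta>\<^sub>2}"
        using inR(3)[OF pR] by (auto simp: dist_norm norm_minus_commute)
    qed
    then have "closed (cball xb R \<inter> (\<lambda>x. G (p k, x)) -` K)"
      by (intro continuous_closed_preimage K_closed closed_cball)
    then have "compact (cball xb R \<inter> (cball xb R \<inter> (\<lambda>x. G (p k, x)) -` K))"
      by (intro compact_Int_closed compact_cball)
    moreover have "cball xb R \<inter> (cball xb R \<inter> (\<lambda>x. G (p k, x)) -` K) = S k" by (auto simp: S_def)
    ultimately show "compact (S k)" by simp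
    show "S k \<noteq> {}" using Siff XR X(2) by blast
    show "continuous_on (S k) (\<lambda>x. \<rho>/2 * (norm (x - X k))\<^sup>2 - v k \<bullet> x)" by (intro continuous_intros)
  qed
  then obtain x where x: "\<And>k. x k \<in> S k" "\<And>k y. y \<in> S k \<Longrightarrow>
      \<rho>/2 * (norm (x k - X k))\<^sup>2 - v k \<bullet> x k \<le> \<rho>/2 * (norm (y - X k))\<^sup>2 - v k \<bullet> y"
    by metis
  define d where "d k = x k - X k" for k
  have xd: "x k = X k + d k" for k by (simp add: d_def)
  have xR: "norm (X k + d k - xb) \<le> R" and xK: "G (p k, X k + d k) \<in> K" for k
    using x(1)[of k] Siff[of "x k" k] by (auto simp: S_def d_def)
  \<comment> \<open>The arc point is feasible and carries no penalty, so comparison with the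
    minimiser bounds the squared deviation.\<close>
  have prox: "\<rho>/2 * (norm (d k))\<^sup>2 \<le> v k \<bullet> d k" for k
    using x(2)[of "X k" k] Siff[of "X k" k] XR X(2) by (simp add: d_def inner_diff_right)
  have growth: "\<mu> \<bullet> (G (p k, X k + d k) - G (p k, X k)) \<le> E k * (t k)\<^sup>2" for k
  proof -
    have "\<mu> \<bullet> G (p k, X k + d k) \<le> 0" using \<mu> xK[of k] by (simp add: polar_cone_def)
    then show ?thesis using X(3)[of k] by (simp add: inner_diff_right)
  qed
  have res: "norm ((p k, X k) - ?z - t k *\<^sub>R (0, u)) \<le> 2 * E k * t k" for k
    using norm_Pair_le[of "p k - pb" "X k - xb - t k *\<^sub>R u"] p[of k] X(1)[of k] by simp
  \<comment> \<open>In v k . d k the terms a . d + t H . d are traded for the increment of \<mu> .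
    G, which \<open>growth\<close> bounds. The gradient estimate is a premise because it is used
    with \<eta> = 1 for all k, and with a smaller \<eta> for large k only.\<close>
  have key: "\<rho>/2 * (norm (d k))\<^sup>2 \<le> E k * (t k)\<^sup>2
      + (c * (2 * E k * t k + norm (d k)) + \<eta> * (t k + 2 * E k * t k + norm (d k))) * norm (d k)
      + t k * (\<xi> \<bullet> d k)"
    if "\<eta> > 0" and "\<bar>\<mu> \<bullet> (G (p k, X k + d k) - G (p k, X k)) - a \<bullet> d k - t k * (H \<bullet> d k)\<bar>
        \<le> (c * (norm ((p k, X k) - ?z - t k *\<^sub>R (0, u)) + norm (d k))
          + \<eta> * (t k + norm ((p k, X k) - ?z - t k *\<^sub>R (0, u)) + norm (d k))) * norm (d k)" for k \<eta>
  proof -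
    have "(c * (norm ((p k, X k) - ?z - t k *\<^sub>R (0, u)) + norm (d k))
          + \<eta> * (t k + norm ((p k, X k) - ?z - t k *\<^sub>R (0, u)) + norm (d k))) * norm (d k)
        \<le> (c * (2 * E k * t k + norm (d k))
          + \<eta> * (t k + 2 * E k * t k + norm (d k))) * norm (d k)"
      using res[of k] c(1) that(1) by (intro mult_right_mono add_mono mult_left_mono) auto
    moreover have "v k \<bullet> d k = a \<bullet> d k + t k * (H \<bullet> d k) + t k * (\<xi> \<bullet> d k)"
      by (simp add: v_def inner_add_left algebra_simps)
    ultimately show ?thesis using prox[of k] growth[of k] that(2) by linarith
  qed
  have scaled: "(c + 2) * (norm (d k /\<^sub>R t k))\<^sup>2 \<le> E k
      + (c * (2 * E k + norm (d k /\<^sub>R t k)) + \<eta> * (1 + 2 * E k + norm (d k /\<^sub>R t k))) * norm (d k /\<^sub>R t k)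
      + \<xi> \<bullet> (d k /\<^sub>R t k)"
    if "\<eta> > 0" and "\<bar>\<mu> \<bullet> (G (p k, X k + d k) - G (p k, X k)) - a \<bullet> d k - t k * (H \<bullet> d k)\<bar>
        \<le> (c * (norm ((p k, X k) - ?z - t k *\<^sub>R (0, u)) + norm (d k))
          + \<eta> * (t k + norm ((p k, X k) - ?z - t k *\<^sub>R (0, u)) + norm (d k))) * norm (d k)" for k \<eta>
  proof -
    define n where "n = norm (d k /\<^sub>R t k)"
    define w where "w = \<xi> \<bullet> (d k /\<^sub>R t k)"
    have n: "norm (d k) = t k * n" using t(1)[of k] by (simp add: n_def)
    have w: "\<xi> \<bullet> d k = t k * w" using t(1)[of k] by (simp add: w_def)
    have "(t k)\<^sup>2 * ((c + 2) * n\<^sup>2)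
        \<le> (t k)\<^sup>2 * (E k + (c * (2 * E k + n) + \<eta> * (1 + 2 * E k + n)) * n + w)"
      using key[OF that] by (simp add: n w \<rho>_def power2_eq_square algebra_simps)
    then have "(c + 2) * n\<^sup>2 \<le> E k + (c * (2 * E k + n) + \<eta> * (1 + 2 * E k + n)) * n + w"
      using t(1)[of k] by simp
    then show ?thesis unfolding n_def w_def .
  qed
  \<comment> \<open>With \<eta> = 1 the quadratic terms leave n^2 \<le> 1 + (2 c + 3 + |\<xi>|) n
    for n = |d k| / t k, so n cannot exceed 1 plus the linear coefficient.\<close>
  have bnd: "norm (d k /\<^sub>R t k) \<le> 2 * c + 4 + norm \<xi>" for k
  proof -
    define n where "n = norm (d k /\<^sub>R t k)"
    have n0: "n \<ge> 0" by (simp add: n_def)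
    have "(c + 2) * n\<^sup>2 \<le> E k + (c * (2 * E k + n) + 1 * (1 + 2 * E k + n)) * n + \<xi> \<bullet> (d k /\<^sub>R t k)"
      unfolding n_def
      using t(1)[of k] by (intro scaled \<delta>\<^sub>1(2) inR(2)[OF pR XR] inR(2)[OF pR xR]) auto
    moreover have "\<xi> \<bullet> (d k /\<^sub>R t k) \<le> norm \<xi> * n" unfolding n_def by (rule norm_cauchy_schwarz)
    moreover have "E k * n \<le> n" "c * (E k * n) \<le> c * n"
      using E1[of k] E(1)[of k] n0 c(1) by (auto intro!: mult_left_mono mult_left_le_one_le)
    ultimately have "n * n \<le> 1 + (2 * c + 3 + norm \<xi>) * n"
      using E1[of k] by (simp add: power2_eq_square algebra_simps)
    show ?thesis
    proof (rule ccontr)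
      assume "\<not> ?thesis"
      then have n: "n > 1 + (2 * c + 3 + norm \<xi>)" by (simp add: n_def)
      have "1 \<le> n" using n c(1) norm_ge_zero[of \<xi>] by linarith
      have "(1 + (2 * c + 3 + norm \<xi>)) * n < n * n" using n \<open>1 \<le> n\<close> by (intro mult_strict_right_mono) auto
      then have "n + (2 * c + 3 + norm \<xi>) * n < n * n" by (simp add: algebra_simps)
      then show False using \<open>n * n \<le> _\<close> \<open>1 \<le> n\<close> by linarith
    qed
  qed
  have "seq_compact (cball (0::'x) (2 * c + 4 + norm \<xi>))"
    by (intro compact_imp_seq_compact compact_cball)
  moreover have "\<forall>k. d k /\<^sub>R t k \<in> cball 0 (2 * c + 4 + norm \<xi>)" using bnd by simp
  ultimately obtain w \<sigma> where \<sigma>: "strict_mono (\<sigma> :: nat \<Rightarrow> nat)"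
    and wlim: "((\<lambda>k. d k /\<^sub>R t k) \<circ> \<sigma>) \<longlonglongrightarrow> w"
    by (rule seq_compactE)
  have wlim: "(\<lambda>k. d (\<sigma> k) /\<^sub>R t (\<sigma> k)) \<longlonglongrightarrow> w" using wlim by (simp add: o_def)
  have E\<sigma>: "(\<lambda>k. E (\<sigma> k)) \<longlonglongrightarrow> 0" and t\<sigma>: "(\<lambda>k. t (\<sigma> k)) \<longlonglongrightarrow> 0"
    using LIMSEQ_subseq_LIMSEQ[OF Elim \<sigma>] LIMSEQ_subseq_LIMSEQ[OF tlim \<sigma>] by (auto simp: o_def)
  have plim: "(\<lambda>k. (p (\<sigma> k) - pb) /\<^sub>R t (\<sigma> k)) \<longlonglongrightarrow> 0"
  proof (rule Lim_null_comparison[OF always_eventually E\<sigma>], rule allI)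
    show "norm ((p (\<sigma> k) - pb) /\<^sub>R t (\<sigma> k)) \<le> E (\<sigma> k)" for k
      by (rule norm_inverse_scaleR_le[OF t(1) p])
  qed
  have "(\<lambda>k. (X (\<sigma> k) - xb - t (\<sigma> k) *\<^sub>R u) /\<^sub>R t (\<sigma> k)) \<longlonglongrightarrow> 0"
  proof (rule Lim_null_comparison[OF always_eventually E\<sigma>], rule allI)
    show "norm ((X (\<sigma> k) - xb - t (\<sigma> k) *\<^sub>R u) /\<^sub>R t (\<sigma> k)) \<le> E (\<sigma> k)" for k
      by (rule norm_inverse_scaleR_le[OF t(1) X(1)])
  qed
  from tendsto_add[OF this tendsto_add[OF tendsto_const[of u] wlim]]
  have xlim: "(\<lambda>k. (X (\<sigma> k) + d (\<sigma> k) - xb) /\<^sub>R t (\<sigma> k)) \<longlonglongrightarrow> u + w"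
    using t(1) by (simp add: algebra_simps less_imp_neq[THEN not_sym])
  have Auw: "A (0, u + w) \<in> K"
  proof -
    have "(\<lambda>k. (G (?z + t (\<sigma> k) *\<^sub>R ((p (\<sigma> k) - pb) /\<^sub>R t (\<sigma> k), (X (\<sigma> k) + d (\<sigma> k) - xb) /\<^sub>R t (\<sigma> k)))
        - G ?z) /\<^sub>R t (\<sigma> k)) \<longlonglongrightarrow> A (0, u + w)"
      by (rule has_derivative_sequentially[OF A_derivative t(1) t\<sigma> tendsto_Pair[OF plim xlim]])
    moreover have "?z + t (\<sigma> k) *\<^sub>R ((p (\<sigma> k) - pb) /\<^sub>R t (\<sigma> k), (X (\<sigma> k) + d (\<sigma> k) - xb) /\<^sub>R t (\<sigma> k))
        = (p (\<sigma> k), X (\<sigma> k) + d (\<sigma> k))" for k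
      using t(1)[of "\<sigma> k"] by simp
    ultimately have lim: "(\<lambda>k. G (p (\<sigma> k), X (\<sigma> k) + d (\<sigma> k)) /\<^sub>R t (\<sigma> k)) \<longlonglongrightarrow> A (0, u + w)"
      by (simp add: G0)
    have "\<forall>\<^sub>F k in sequentially. G (p (\<sigma> k), X (\<sigma> k) + d (\<sigma> k)) /\<^sub>R t (\<sigma> k) \<in> K"
      using xK t(1) by (intro always_eventually allI convex_cone_scaleR[OF K]) (auto simp: less_imp_le)
    from Lim_in_closed_set[OF K_closed this sequentially_bot lim] show ?thesis .
  qed
  have split: "A (0, u + w) = A (0, u) + A (0, w)"
    using linear_add[OF linear_A, of "(0, u)" "(0, w)"] by simp
  \<comment> \<open>By \<open>prox\<close> the products v k . d k are nonnegative, and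
    \<open>v\<close> tends to \<open>a\<close>. Polarity of \<mu> at A (0, u + w) gives the opposite
    sign, so u + w is critical and the assumption on \<xi> applies to it.\<close>
  have "a \<bullet> w \<ge> 0"
  proof (rule tendsto_lowerbound)
    have "(\<lambda>k. v (\<sigma> k) \<bullet> (d (\<sigma> k) /\<^sub>R t (\<sigma> k))) \<longlonglongrightarrow> (a + 0 *\<^sub>R (\<xi> + H)) \<bullet> w"
      unfolding v_def
      by (intro tendsto_inner tendsto_add tendsto_const tendsto_scaleR t\<sigma> wlim)
    then show "(\<lambda>k. v (\<sigma> k) \<bullet> (d (\<sigma> k) /\<^sub>R t (\<sigma> k))) \<longlonglongrightarrow> a \<bullet> w" by simp
    have "0 \<le> v k \<bullet> (d k /\<^sub>R t k)" for k
    proof -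
      have "0 \<le> v k \<bullet> d k" using prox[of k] \<rho> by (smt (verit) mult_nonneg_nonneg zero_le_power2 divide_nonneg_nonneg)
      then show ?thesis using t(1)[of k] by simp
    qed
    then show "\<forall>\<^sub>F k in sequentially. 0 \<le> v (\<sigma> k) \<bullet> (d (\<sigma> k) /\<^sub>R t (\<sigma> k))" by simp
  qed simp
  moreover have "\<mu> \<bullet> A (0, u + w) \<le> 0" using \<mu> Auw by (simp add: polar_cone_def)
  ultimately have "\<mu> \<bullet> A (0, u + w) = 0" using a[of w] u by (simp add: split inner_add_right)
  then have \<xi>w: "\<xi> \<bullet> w \<le> 0" using \<xi>[OF Auw] \<xi>u by (simp add: inner_add_right)
  have Xd: "(\<lambda>k. X (\<sigma> k)) \<longlonglongrightarrow> xb" "(\<lambda>k. p (\<sigma> k)) \<longlonglongrightarrow> pb" "(\<lambda>k. X (\<sigma> k) + d (\<sigma> k)) \<longlonglongrightarrow> xb"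
  proof -
    have d0: "(\<lambda>k. t (\<sigma> k) *\<^sub>R (d (\<sigma> k) /\<^sub>R t (\<sigma> k))) \<longlonglongrightarrow> 0 *\<^sub>R w" by (intro tendsto_scaleR t\<sigma> wlim)
    have "(\<lambda>k. xb + t (\<sigma> k) *\<^sub>R ((X (\<sigma> k) + d (\<sigma> k) - xb) /\<^sub>R t (\<sigma> k))) \<longlonglongrightarrow> xb + 0 *\<^sub>R (u + w)"
      by (intro tendsto_add tendsto_const tendsto_scaleR t\<sigma> xlim)
    then show x0: "(\<lambda>k. X (\<sigma> k) + d (\<sigma> k)) \<longlonglongrightarrow> xb" using t(1) by (simp add: less_imp_neq[THEN not_sym])
    have "(\<lambda>k. pb + t (\<sigma> k) *\<^sub>R ((p (\<sigma> k) - pb) /\<^sub>R t (\<sigma> k))) \<longlonglongrightarrow> pb + 0 *\<^sub>R 0"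
      by (intro tendsto_add tendsto_const tendsto_scaleR t\<sigma> plim)
    then show "(\<lambda>k. p (\<sigma> k)) \<longlonglongrightarrow> pb" using t(1) by (simp add: less_imp_neq[THEN not_sym])
    have "(\<lambda>k. d (\<sigma> k)) \<longlonglongrightarrow> 0" using d0 t(1) by (simp add: less_imp_neq[THEN not_sym])
    from tendsto_diff[OF x0 this] show "(\<lambda>k. X (\<sigma> k)) \<longlonglongrightarrow> xb" by simp
  qed
  have "w = 0"
  proof (rule ccontr)
    assume "w \<noteq> 0"
    \<comment> \<open>Makes the \<eta> term exactly |w|^2 in the limit; with c |w|^2 it is one |w|^2
      short of the left-hand side.\<close>
    define \<eta> where "\<eta> = norm w / (1 + norm w)"
    have n1: "1 + norm w > 0" by (simp add: add_pos_nonneg)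
    have \<eta>: "\<eta> > 0" "\<eta> * (1 + norm w) = norm w" using \<open>w \<noteq> 0\<close> n1 by (auto simp: \<eta>_def)
    obtain \<delta> where \<delta>: "\<delta> > 0" "\<And>p x d t.
      norm ((p, x) - ?z) < \<delta> \<Longrightarrow> norm ((p, x + d) - ?z) < \<delta> \<Longrightarrow> t \<ge> 0 \<Longrightarrow>
      \<bar>\<mu> \<bullet> (G (p, x + d) - G (p, x)) - a \<bullet> d - t * (H \<bullet> d)\<bar>
        \<le> (c * (norm ((p, x) - ?z - t *\<^sub>R (0, u)) + norm d)
          + \<eta> * (t + norm ((p, x) - ?z - t *\<^sub>R (0, u)) + norm d)) * norm d"
      using c(2)[OF \<eta>(1)] by metis
    have "\<forall>\<^sub>F k in sequentially. dist (p (\<sigma> k), X (\<sigma> k)) ?z < \<delta>"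
      "\<forall>\<^sub>F k in sequentially. dist (p (\<sigma> k), X (\<sigma> k) + d (\<sigma> k)) ?z < \<delta>"
      by (rule tendstoD[OF tendsto_Pair[OF Xd(2,1)] \<delta>(1)], rule tendstoD[OF tendsto_Pair[OF Xd(2,3)] \<delta>(1)])
    then have ev: "\<forall>\<^sub>F k in sequentially. (c + 2) * (norm (d (\<sigma> k) /\<^sub>R t (\<sigma> k)))\<^sup>2 \<le> E (\<sigma> k)
      + (c * (2 * E (\<sigma> k) + norm (d (\<sigma> k) /\<^sub>R t (\<sigma> k)))
        + \<eta> * (1 + 2 * E (\<sigma> k) + norm (d (\<sigma> k) /\<^sub>R t (\<sigma> k)))) * norm (d (\<sigma> k) /\<^sub>R t (\<sigma> k))
      + \<xi> \<bullet> (d (\<sigma> k) /\<^sub>R t (\<sigma> k))"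
    proof eventually_elim
      case (elim k)
      show ?case
        by (rule scaled[OF \<eta>(1)], rule \<delta>(2)) (use elim t(1)[of "\<sigma> k"] in \<open>auto simp: dist_norm less_imp_le\<close>)
    qed
    have "(\<lambda>k. (c + 2) * (norm (d (\<sigma> k) /\<^sub>R t (\<sigma> k)))\<^sup>2) \<longlonglongrightarrow> (c + 2) * (norm w)\<^sup>2"
      by (intro tendsto_intros wlim)
    moreover have "(\<lambda>k. E (\<sigma> k)
      + (c * (2 * E (\<sigma> k) + norm (d (\<sigma> k) /\<^sub>R t (\<sigma> k)))
        + \<eta> * (1 + 2 * E (\<sigma> k) + norm (d (\<sigma> k) /\<^sub>R t (\<sigma> k)))) * norm (d (\<sigma> k) /\<^sub>R t (\<sigma> k))
      + \<xi> \<bullet> (d (\<sigma> k) /\<^sub>R t (\<sigma> k))) \<longlonglongrightarrow>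
      0 + (c * (2 * 0 + norm w) + \<eta> * (1 + 2 * 0 + norm w)) * norm w + \<xi> \<bullet> w"
      by (intro tendsto_intros wlim E\<sigma>)
    ultimately have "(c + 2) * (norm w)\<^sup>2
        \<le> 0 + (c * (2 * 0 + norm w) + \<eta> * (1 + 2 * 0 + norm w)) * norm w + \<xi> \<bullet> w"
      using tendsto_le[OF sequentially_bot _ _ ev] by blast
    also have "\<dots> \<le> (c + 1) * (norm w)\<^sup>2"
      using \<xi>w \<eta>(2) by (simp add: power2_eq_square algebra_simps)
    finally have "(norm w)\<^sup>2 \<le> 0" by (simp add: algebra_simps)
    then show False using \<open>w \<noteq> 0\<close> by simp
  qed
  have "\<forall>\<^sub>F k in sequentially. t (\<sigma> k) < \<epsilon>" using order_tendstoD(2)[OF t\<sigma> \<epsilon>] .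
  moreover have "\<forall>\<^sub>F k in sequentially. E (\<sigma> k) < \<epsilon> / 2" using order_tendstoD(2)[OF E\<sigma>, of "\<epsilon>/2"] \<epsilon> by simp
  moreover have "\<forall>\<^sub>F k in sequentially. norm (d (\<sigma> k) /\<^sub>R t (\<sigma> k)) < min (\<epsilon>/2) (\<epsilon>/\<rho>)"
    using order_tendstoD(2)[OF tendsto_norm[OF wlim], of "min (\<epsilon>/2) (\<epsilon>/\<rho>)"] \<epsilon> \<rho> \<open>w = 0\<close> by simp
  moreover have "\<forall>\<^sub>F k in sequentially. dist (X (\<sigma> k) + d (\<sigma> k)) xb < R"
    using tendstoD[OF Xd(3) R(1)] .
  ultimately have "\<forall>\<^sub>F k in sequentially. t (\<sigma> k) < \<epsilon> \<and> E (\<sigma> k) < \<epsilon> / 2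
      \<and> norm (d (\<sigma> k) /\<^sub>R t (\<sigma> k)) < min (\<epsilon>/2) (\<epsilon>/\<rho>) \<and> dist (X (\<sigma> k) + d (\<sigma> k)) xb < R"
    by eventually_elim blast
  then obtain k' where "t (\<sigma> k') < \<epsilon> \<and> E (\<sigma> k') < \<epsilon> / 2
      \<and> norm (d (\<sigma> k') /\<^sub>R t (\<sigma> k')) < min (\<epsilon>/2) (\<epsilon>/\<rho>) \<and> dist (X (\<sigma> k') + d (\<sigma> k')) xb < R"
    using eventually_happens'[OF sequentially_bot] by blast
  then obtain k where k: "t k < \<epsilon>" "E k < \<epsilon> / 2" "norm (d k /\<^sub>R t k) < \<epsilon>/2"
      "norm (d k /\<^sub>R t k) < \<epsilon>/\<rho>" "dist (X k + d k) xb < R"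
    by auto
  have dk: "norm (d k) = t k * norm (d k /\<^sub>R t k)" using t(1)[of k] by simp
  have d_le: "norm (d k) \<le> t k * (\<epsilon>/2)" "norm (d k) \<le> t k * (\<epsilon>/\<rho>)"
    unfolding dk by (rule mult_left_mono[OF less_imp_le[OF k(3)] less_imp_le[OF t(1)]],
      rule mult_left_mono[OF less_imp_le[OF k(4)] less_imp_le[OF t(1)]])
  have Ek: "E k * t k \<le> \<epsilon>/2 * t k" using k(2) t(1)[of k] by (intro mult_right_mono) auto
  have tk\<epsilon>: "\<epsilon>/2 * t k \<le> \<epsilon> * t k" using t(1)[of k] \<epsilon> by simp
  show ?thesis
  proof (rule that)
    show "0 < t k" "t k < \<epsilon>" by (rule t(1), rule k(1))
    show "norm (p k - pb) \<le> \<epsilon> * t k" using p[of k] Ek tk\<epsilon> by linarith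
    have "norm (x k - xb - t k *\<^sub>R u) \<le> norm (X k - xb - t k *\<^sub>R u) + norm (d k)"
      using norm_triangle_ineq[of "X k - xb - t k *\<^sub>R u" "d k"] by (simp add: xd algebra_simps)
    also have "\<dots> \<le> \<epsilon>/2 * t k + t k * (\<epsilon>/2)" using X(1)[of k] Ek d_le(1) by linarith
    also have "\<dots> = \<epsilon> * t k" by simp
    finally show "norm (x k - xb - t k *\<^sub>R u) \<le> \<epsilon> * t k" .
    \<comment> \<open>The vector v - \<rho> d is the negative gradient of the proximal objective at
      the minimiser, hence the candidate normal.\<close>
    have "norm (v k - \<rho> *\<^sub>R d k - a - t k *\<^sub>R (\<xi> + H)) = \<rho> * norm (d k)"
      using \<rho> by (simp add: v_def)
    also have "\<dots> \<le> \<rho> * (t k * (\<epsilon>/\<rho>))" using d_le(2) \<rho> by (intro mult_left_mono) auto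
    also have "\<dots> = \<epsilon> * t k" using \<rho> by simp
    finally show "norm (v k - \<rho> *\<^sub>R d k - a - t k *\<^sub>R (\<xi> + H)) \<le> \<epsilon> * t k" .
    show "v k - \<rho> *\<^sub>R d k \<in> regular_normal_cone (\<Gamma> (p k)) (x k)"
      unfolding regular_normal_cone_def
    proof (intro CollectI conjI allI impI)
      show "x k \<in> \<Gamma> (p k)" using x(1)[of k] Siff by blast
      fix e :: real assume e: "e > 0"
      have gap: "R - norm (x k - xb) > 0" using k(5) by (simp add: xd dist_norm)
      show "\<exists>\<delta>>0. \<forall>y\<in>\<Gamma> (p k). norm (y - x k) < \<delta> \<longrightarrow>
          (v k - \<rho> *\<^sub>R d k) \<bullet> (y - x k) \<le> e * norm (y - x k)"
      \<comment> \<open>The first radius keeps y in the set over which \<open>x k\<close> is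
        minimal, the second absorbs the quadratic remainder (\<rho>/2) |y - x k|^2.\<close>
      proof (intro exI[of _ "min (R - norm (x k - xb)) (2 * e / \<rho>)"] conjI ballI impI)
        show "min (R - norm (x k - xb)) (2 * e / \<rho>) > 0" using gap e \<rho> by simp
        fix y assume y: "y \<in> \<Gamma> (p k)" "norm (y - x k) < min (R - norm (x k - xb)) (2 * e / \<rho>)"
        have "norm (y - xb) \<le> norm (y - x k) + norm (x k - xb)" by norm
        then have "y \<in> S k" using y Siff by simp
        from x(2)[OF this]
        have "v k \<bullet> (y - x k) \<le> \<rho>/2 * ((norm (y - X k))\<^sup>2 - (norm (x k - X k))\<^sup>2)"
          by (simp add: inner_diff_right algebra_simps)
        also have "(norm (y - X k))\<^sup>2 - (norm (x k - X k))\<^sup>2 = 2 * (d k \<bullet> (y - x k)) + (norm (y - x k))\<^sup>2"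
          unfolding power2_norm_eq_inner d_def
          by (simp add: inner_diff_left inner_diff_right inner_commute)
        finally have "(v k - \<rho> *\<^sub>R d k) \<bullet> (y - x k) \<le> \<rho>/2 * norm (y - x k) * norm (y - x k)"
          by (simp add: inner_diff_left power2_eq_square algebra_simps)
        also have "\<dots> \<le> e * norm (y - x k)"
          using y(2) \<rho> by (intro mult_right_mono) (auto simp: field_simps)
        finally show "(v k - \<rho> *\<^sub>R d k) \<bullet> (y - x k) \<le> e * norm (y - x k)" .
      qed
    qed
  qed
qed

end

section \<open>Cone reduction\<close>

locale cone_reduction =
  fixes C V :: "'y::euclidean_space set" and h :: "'y \<Rightarrow> 'e::euclidean_space" and K :: "'e set" and yb :: 'y
  assumes h: "C2_on V h" and yb: "yb \<in> V" and h0: "h yb = 0" and surj: "surj (D1 h yb)"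
    and reduction: "C \<inter> V = {y \<in> V. h y \<in> K}"
    and K_closed: "closed K" and K: "convex_cone K"
begin

lemma h_twice: "twice_diff_at h yb"
  by (rule C2_on_imp_twice_diff_at[OF h yb])

lemma linear_Dh: "linear (D1 h yb)"
  by (intro linear_D1 twice_diff_at_imp_differentiable h_twice)

lemma mem_C_iff: "y \<in> V \<Longrightarrow> y \<in> C \<longleftrightarrow> h y \<in> K"
  using reduction by blast

lemma yb_C: "yb \<in> C"
  using mem_C_iff[OF yb] h0 convex_cone_contains_0[OF K] by simp

text \<open>Surjectivity of the derivative of \<open>h\<close> lifts a point e of \<open>K\<close>
  to a point of \<open>C\<close> within c |e - h (g (p, x))| of g (p, x), and Robinson stability
  passes from there to the feasible set. The modulus is \<kappa> c + 1 because \<kappa> may be 0 and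
  a positive one is required.\<close>

lemma reduced_system_compose:
  fixes g :: "'p::euclidean_space \<times> 'x::euclidean_space \<Rightarrow> 'y"
  assumes g: "twice_diff_at g (pb, xb)" and gyb: "g (pb, xb) = yb" and rob: "robinson_stable g C pb xb"
  obtains \<kappa> \<delta> where "reduced_system (h \<circ> g) K (Gamma g C) pb xb \<kappa> \<delta>"
proof -
  let ?z = "(pb, xb)"
  have hy: "twice_diff_at h (g ?z)" using h_twice gyb by simp
  have G: "twice_diff_at (h \<circ> g) ?z" by (rule twice_diff_at_compose(1)[OF g hy])
  have "surj (D1 h yb \<circ> (\<lambda>a. a))" using surj by (simp add: o_def)
  then obtain c \<delta>\<^sub>h where c: "c > 0" "\<delta>\<^sub>h > 0"
    "\<And>y e. y \<in> ball yb \<delta>\<^sub>h \<Longrightarrow> norm (e - h y) < \<delta>\<^sub>h \<Longrightarrow>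
        \<exists>a. y + a \<in> V \<and> h (y + a) = e \<and> norm a \<le> c * norm (e - h y)"
    using local_solvability[OF C2_on_imp_C1_on[OF h] yb linear_id[unfolded id_def]] by metis
  obtain \<kappa> W U where W: "\<kappa> \<ge> 0" "open W" "pb \<in> W" "open U" "xb \<in> U"
    "\<And>p x. p \<in> W \<Longrightarrow> x \<in> U \<Longrightarrow> Gamma g C p \<noteq> {} \<and> infdist x (Gamma g C p) \<le> \<kappa> * infdist (g (p, x)) C"
    using rob unfolding robinson_stable_def by blast
  have cont: "isCont \<phi> ?z" if "twice_diff_at \<phi> ?z" for \<phi> :: "'p \<times> 'x \<Rightarrow> 'c::euclidean_space"
    using differentiable_imp_continuous_within[OF twice_diff_at_imp_differentiable[OF that]] by simp
  have tend: "(\<phi> \<longlongrightarrow> \<phi> ?z) (nhds ?z)" if "twice_diff_at \<phi> ?z" for \<phi> :: "'p \<times> 'x \<Rightarrow> 'c::euclidean_space"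
    using cont[OF that] by (simp add: isCont_def tendsto_nhds_iff)
  have openV: "open V" using h by (simp add: C2_on_def)
  have "\<forall>\<^sub>F z in nhds ?z. z \<in> W \<times> U"
    using W by (intro eventually_nhds_in_open open_Times) auto
  moreover have "\<forall>\<^sub>F z in nhds ?z. g z \<in> V \<inter> ball yb \<delta>\<^sub>h"
    using topological_tendstoD[OF tend[OF g], of "V \<inter> ball yb \<delta>\<^sub>h"] openV yb gyb c(2) by auto
  moreover have "\<forall>\<^sub>F z in nhds ?z. dist ((h \<circ> g) z) ((h \<circ> g) ?z) < \<delta>\<^sub>h / 2"
    using tendstoD[OF tend[OF G], of "\<delta>\<^sub>h / 2"] c(2) by simp
  ultimately have "\<forall>\<^sub>F z in nhds ?z. z \<in> W \<times> U \<and> g z \<in> V \<inter> ball yb \<delta>\<^sub>h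
      \<and> dist ((h \<circ> g) z) ((h \<circ> g) ?z) < \<delta>\<^sub>h / 2"
    by eventually_elim blast
  then obtain \<delta>\<^sub>1 where \<delta>\<^sub>1: "\<delta>\<^sub>1 > 0" "\<And>z. norm (z - ?z) < \<delta>\<^sub>1 \<Longrightarrow> z \<in> W \<times> U \<and> g z \<in> V \<inter> ball yb \<delta>\<^sub>h
      \<and> dist ((h \<circ> g) z) ((h \<circ> g) ?z) < \<delta>\<^sub>h / 2"
    unfolding eventually_nhds_metric dist_norm by blast
  \<comment> \<open>With e and h (g (p, x)) both shorter than \<open>\<delta>\<^sub>h\<close> / 2,
    their difference is in the range of the solvability result.\<close>
  define \<delta> where "\<delta> = min \<delta>\<^sub>1 (\<delta>\<^sub>h / 2)"
  have \<delta>: "\<delta> > 0" "\<delta> \<le> \<delta>\<^sub>1" "\<delta> \<le> \<delta>\<^sub>h / 2" using \<delta>\<^sub>1(1) c(2) by (auto simp: \<delta>_def)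
  have "reduced_system (h \<circ> g) K (Gamma g C) pb xb (\<kappa> * c + 1) \<delta>"
  proof
    show "twice_diff_at (h \<circ> g) ?z" "(h \<circ> g) ?z = 0" "closed K" "convex_cone K" "\<delta> > 0"
      using G gyb h0 K_closed K \<delta>(1) by auto
    show "\<kappa> * c + 1 > 0" using W(1) c(1) by (simp add: add_nonneg_pos)
  next
    fix p x assume "norm ((p, x) - ?z) < \<delta>"
    then have "g (p, x) \<in> V" using \<delta>\<^sub>1(2)[of "(p, x)"] \<delta>(2) by simp
    then show "x \<in> Gamma g C p \<longleftrightarrow> (h \<circ> g) (p, x) \<in> K" by (simp add: Gamma_def mem_C_iff)
  next
    fix p x e r
    assume near: "norm ((p, x) - ?z) < \<delta>" and e: "e \<in> K" "norm e < \<delta>"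
      and r: "(\<kappa> * c + 1) * norm (e - (h \<circ> g) (p, x)) < r"
    have z: "p \<in> W" "x \<in> U" "g (p, x) \<in> V" "g (p, x) \<in> ball yb \<delta>\<^sub>h" "norm (h (g (p, x))) < \<delta>\<^sub>h / 2"
      using \<delta>\<^sub>1(2)[of "(p, x)"] near \<delta>(2) by (auto simp: gyb h0)
    have "norm (e - h (g (p, x))) < \<delta>\<^sub>h"
      using norm_triangle_ineq4[of e "h (g (p, x))"] z(5) e(2) \<delta>(3) by linarith
    then obtain a where a: "g (p, x) + a \<in> V" "h (g (p, x) + a) = e"
      "norm a \<le> c * norm (e - h (g (p, x)))"
      using c(3)[OF z(4)] by blast
    have "g (p, x) + a \<in> C" using a(1,2) e(1) by (simp add: mem_C_iff)
    then have "infdist (g (p, x)) C \<le> norm a"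
      using infdist_le[of "g (p, x) + a" C "g (p, x)"] by (simp add: dist_norm)
    then have "\<kappa> * infdist (g (p, x)) C \<le> \<kappa> * (c * norm (e - h (g (p, x))))"
      using a(3) W(1) by (intro mult_left_mono) auto
    also have "\<dots> \<le> (\<kappa> * c + 1) * norm (e - (h \<circ> g) (p, x))" by (simp add: algebra_simps)
    finally have "infdist x (Gamma g C p) < r" and ne: "Gamma g C p \<noteq> {}"
      using W(6)[OF z(1,2)] r by auto
    \<comment> \<open>An infimum below r has a feasible point below r, attained or not; nonemptiness
      is what rules out the default value 0 of \<open>infdist\<close>.\<close>
    then have "(INF a\<in>Gamma g C p. dist x a) < r" by (simp add: infdist_notempty)
    then have "\<exists>x'\<in>Gamma g C p. dist x x' < r"
      using ne by (subst (asm) cINF_less_iff) (auto intro: bdd_belowI[of _ 0])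
    then show "\<exists>x'\<in>Gamma g C p. norm (x' - x) < r" by (simp add: dist_norm norm_minus_commute)
  qed
  then show ?thesis using that by blast
qed

text \<open>\<open>C\<close> is itself a constraint system, with constraint map \<open>snd\<close> and a dummy parameter.\<close>
lemma tangent_cone_C: "tangent_cone C yb = {w. D1 h yb w \<in> K}"
proof -
  have lin: "linear (snd :: real \<times> 'y \<Rightarrow> 'y)" by (simp add: linear_snd)
  have eq: "(\<lambda>z. 0 + snd z) = (snd :: real \<times> 'y \<Rightarrow> 'y)" by simp
  note snd = twice_diff_at_affine[OF lin, where c = 0, unfolded eq, of "(0, yb)"]
  have \<Gamma>: "Gamma (snd :: real \<times> 'y \<Rightarrow> 'y) C p = C" for p by (simp add: Gamma_def)
  have "robinson_stable (snd :: real \<times> 'y \<Rightarrow> 'y) C 0 yb"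
    unfolding robinson_stable_def \<Gamma> using yb_C
    by (intro exI[of _ 1] exI[of _ UNIV] conjI) auto
  then obtain \<kappa> \<delta> where "reduced_system (h \<circ> snd) K (Gamma (snd :: real \<times> 'y \<Rightarrow> 'y) C) 0 yb \<kappa> \<delta>"
    using reduced_system_compose[OF snd(1)] by auto
  from reduced_system.tangent_cone_eq[OF this]
  show ?thesis using twice_diff_at_compose(2)[OF snd(1), of h] h_twice by (simp add: \<Gamma> snd(2))
qed

text \<open>The adjoint of a surjection is injective: the difference of two candidates is itself a
  value of \<open>D1 h yb\<close>, and testing against its preimage gives squared norm 0.\<close>

lemma mu_of_adjoint: "mu_of h yb (adjoint (D1 h yb) \<mu>) = \<mu>"
  unfolding mu_of_def
proof (rule the_equality)
  fix \<mu>' assume eq: "adjoint (D1 h yb) \<mu>' = adjoint (D1 h yb) \<mu>"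
  obtain y where y: "D1 h yb y = \<mu>' - \<mu>" using surj by (metis surjD)
  have "(\<mu>' - \<mu>) \<bullet> (\<mu>' - \<mu>) = y \<bullet> adjoint (D1 h yb) \<mu>' - y \<bullet> adjoint (D1 h yb) \<mu>"
    unfolding adjoint_works[OF linear_Dh] y by (simp add: inner_diff_right)
  then show "\<mu>' = \<mu>" by (simp add: eq)
qed rule

text \<open>On \<open>C\<close> near yb the function \<mu> . h is nonpositive, and it differs from
  its linearisation by o(|y - yb|).\<close>

lemma adjoint_polar_normal:
  assumes "\<mu> \<in> polar_cone K" shows "adjoint (D1 h yb) \<mu> \<in> regular_normal_cone C yb"
  unfolding regular_normal_cone_def
proof (intro CollectI conjI allI impI yb_C)
  fix \<epsilon> :: real assume "\<epsilon> > 0"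
  define \<eta> where "\<eta> = \<epsilon> / (norm \<mu> + 1)"
  have n1: "norm \<mu> + 1 > 0" by (simp add: add_nonneg_pos)
  have \<eta>: "\<eta> > 0" "\<eta> * (norm \<mu> + 1) = \<epsilon>" using \<open>\<epsilon> > 0\<close> n1 by (auto simp: \<eta>_def)
  obtain d where d: "d > 0" "\<And>y. norm (y - yb) < d \<Longrightarrow> norm (h y - h yb - D1 h yb (y - yb)) \<le> \<eta> * norm (y - yb)"
    using D1_has_derivative[OF twice_diff_at_imp_differentiable[OF h_twice]] \<eta>(1)
    unfolding has_derivative_at_alt by metis
  have openV: "open V" using h by (simp add: C2_on_def)
  then obtain d' where d': "d' > 0" "ball yb d' \<subseteq> V" using yb open_contains_ball by blast
  show "\<exists>\<delta>>0. \<forall>y\<in>C. norm (y - yb) < \<delta> \<longrightarrow> adjoint (D1 h yb) \<mu> \<bullet> (y - yb) \<le> \<epsilon> * norm (y - yb)"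
  proof (intro exI[of _ "min d d'"] conjI ballI impI)
    show "min d d' > 0" using d d' by simp
    fix y assume y: "y \<in> C" "norm (y - yb) < min d d'"
    have "y \<in> V" using y(2) d'(2) by (auto simp: dist_norm norm_minus_commute)
    then have "h y \<in> K" using y(1) by (simp add: mem_C_iff)
    then have hy: "\<mu> \<bullet> h y \<le> 0" using assms by (simp add: polar_cone_def)
    have "adjoint (D1 h yb) \<mu> \<bullet> (y - yb) = \<mu> \<bullet> D1 h yb (y - yb)"
      by (simp add: inner_commute adjoint_works[OF linear_Dh])
    also have "\<dots> = \<mu> \<bullet> h y - \<mu> \<bullet> (h y - h yb - D1 h yb (y - yb))"
      by (simp add: h0 inner_diff_right)
    also have "\<dots> \<le> 0 + norm \<mu> * norm (h y - h yb - D1 h yb (y - yb))"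
      using hy Cauchy_Schwarz_ineq2[of \<mu> "h y - h yb - D1 h yb (y - yb)"] by linarith
    also have "\<dots> \<le> (norm \<mu> + 1) * (\<eta> * norm (y - yb))"
      unfolding add_0 using d(2)[of y] y(2) by (intro mult_mono) auto
    also have "\<dots> = \<epsilon> * norm (y - yb)" using \<eta>(2) by (simp add: mult.assoc[symmetric] mult.commute)
    finally show "adjoint (D1 h yb) \<mu> \<bullet> (y - yb) \<le> \<epsilon> * norm (y - yb)" .
  qed
qed

text \<open>A normal is nonpositive on the tangent cone, which contains the kernel of
  \<open>D1 h yb\<close>, a subspace. So it vanishes there and factors through
  \<open>D1 h yb\<close>; a linear right inverse yields the factor, which is polar because the
  tangent cone is the preimage of \<open>K\<close>.\<close>

lemma normal_mu_of:
  assumes "l \<in> regular_normal_cone C yb"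
  shows "mu_of h yb l \<in> polar_cone K" "l \<bullet> y = mu_of h yb l \<bullet> D1 h yb y"
proof -
  have le: "l \<bullet> \<eta> \<le> 0" if "D1 h yb \<eta> \<in> K" for \<eta>
    using regular_normal_tangent_le_0[OF assms, of \<eta>] that by (simp add: tangent_cone_C)
  obtain B b where B: "linear B" "\<And>y. D1 h yb (B y) = y"
    using surj_linear_right_inverse[OF linear_Dh surj] by metis
  define \<mu> where "\<mu> = adjoint B l"
  have \<mu>: "\<mu> \<bullet> e = l \<bullet> B e" for e
    using adjoint_works[OF B(1), of e l] by (simp add: \<mu>_def inner_commute)
  have pol: "\<mu> \<in> polar_cone K" unfolding polar_cone_def using le B(2) by (simp add: \<mu>)
  have rep: "l \<bullet> y = \<mu> \<bullet> D1 h yb y" for y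
  proof -
    have ker: "D1 h yb (y - B (D1 h yb y)) = 0" by (simp add: linear_diff[OF linear_Dh] B(2))
    then have "l \<bullet> (y - B (D1 h yb y)) \<le> 0" "l \<bullet> (- (y - B (D1 h yb y))) \<le> 0"
      by (intro le; simp only: linear_neg[OF linear_Dh] ker convex_cone_contains_0[OF K] neg_0_equal_iff_equal
          minus_zero)+
    then show ?thesis by (simp add: \<mu> inner_diff_right)
  qed
  have "y \<bullet> adjoint (D1 h yb) \<mu> = y \<bullet> l" for y
    using rep[of y] by (simp add: adjoint_works[OF linear_Dh] inner_commute)
  then have "adjoint (D1 h yb) \<mu> = l" by (metis vector_eq_ldot)
  then have "mu_of h yb l = \<mu>" using mu_of_adjoint by blast
  then show "mu_of h yb l \<in> polar_cone K" "l \<bullet> y = mu_of h yb l \<bullet> D1 h yb y"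
    using pol rep by auto
qed

end

section \<open>Isolated calmness\<close>

text \<open>All constants depending on \<open>f\<close>, \<open>u\<close> and the calmness modulus
  are fixed before the point of the arc is requested. In units of t, the norm of \<open>u\<close> is
  then bounded by half of itself.\<close>

lemma isolated_calmness_contradiction:
  fixes f :: "('p1::euclidean_space \<times> 'p2::euclidean_space) \<times> 'x::euclidean_space \<Rightarrow> 'x"
    and g :: "('p1 \<times> 'p2) \<times> 'x \<Rightarrow> 'y"
  assumes f: "C1_around f (pb, xb)"
    and calm: "isolatedly_calm (Ssol f g C) pb xb"
    and g_indep: "\<forall>p1 p2 x. g ((p1, p2), x) = g ((p1, snd pb), x)"
    and surj: "surj (D1 (\<lambda>p2. f ((fst pb, p2), xb)) (snd pb))"
    and u: "u \<noteq> 0"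
    and arc: "\<And>\<epsilon>. \<epsilon> > 0 \<Longrightarrow> \<exists>t p x y. 0 < t \<and> t < \<epsilon> \<and> norm (p - pb) \<le> \<epsilon> * t
      \<and> norm (x - xb - t *\<^sub>R u) \<le> \<epsilon> * t \<and> y \<in> regular_normal_cone (Gamma g C p) x
      \<and> norm (y + f (pb, xb) + t *\<^sub>R D1 f (pb, xb) (0, u)) \<le> \<epsilon> * t"
  shows False
proof -
  let ?z = "(pb, xb)"
  obtain U where U: "C1_on U f" "?z \<in> U" using f unfolding C1_around_def by blast
  have diff: "f differentiable (at ?z)" using U unfolding C1_on_def by blast
  define L :: "'p2 \<Rightarrow> ('p1 \<times> 'p2) \<times> 'x" where "L q = ((0, q), 0)" for q
  have linL: "linear L" by (rule linearI) (auto simp: L_def)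
  have normL: "norm (L q) = norm q" for q by (simp add: L_def norm_Pair)
  have "((\<lambda>p2. f ((fst pb, p2), xb)) has_derivative D1 f ?z \<circ> L) (at (snd pb))"
  proof -
    have "((\<lambda>p2. ((fst pb, p2), xb)) has_derivative L) (at (snd pb))"
      unfolding L_def by (auto intro!: derivative_eq_intros)
    moreover have "(f has_derivative D1 f ?z) (at ((fst pb, snd pb), xb))"
      using D1_has_derivative[OF diff] by simp
    ultimately show ?thesis using diff_chain_at[of "\<lambda>p2. ((fst pb, p2), xb)" L "snd pb" f "D1 f ?z"]
      by (simp add: o_def)
  qed
  from D1_eqI[OF this] surj have surjL: "surj (D1 f ?z \<circ> L)" by simp
  obtain c \<delta> where c: "c > 0" "\<delta> > 0"
    "\<And>y e. y \<in> ball ?z \<delta> \<Longrightarrow> norm (e - f y) < \<delta> \<Longrightarrow>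
        \<exists>q. y + L q \<in> U \<and> f (y + L q) = e \<and> norm q \<le> c * norm (e - f y)"
    using local_solvability[OF U linL surjL] by blast
  obtain B where B: "B > 0" "\<And>b. norm (D1 f ?z b) \<le> B * norm b"
    using linear_bounded_pos[OF linear_D1[OF diff]] by blast
  obtain l Q X where l: "l > 0" "open Q" "pb \<in> Q" "open X" "xb \<in> X"
    "\<And>p. p \<in> Q \<Longrightarrow> Ssol f g C p \<inter> X \<subseteq> cball xb (l * norm (p - pb))"
    using calm unfolding isolatedly_calm_def by blast
  obtain r\<^sub>Q where r\<^sub>Q: "r\<^sub>Q > 0" "ball pb r\<^sub>Q \<subseteq> Q" using l(2,3) open_contains_ball by blast
  obtain r\<^sub>X where r\<^sub>X: "r\<^sub>X > 0" "ball xb r\<^sub>X \<subseteq> X" using l(4,5) open_contains_ball by blast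
  \<comment> \<open>Bound for the residual - y - f (p, x) in units of
    \<open>\<epsilon>\<^sub>2\<close> t: 1 from the normal, |u| + 2 from the remainder of
    \<open>f\<close>, and 2 B from its derivative along the offset of (p, x) from the ray.\<close>
  define M where "M = norm u + 3 + 2 * B"
  have M: "M > 0" "norm u + 1 \<le> M" using B(1) by (auto simp: M_def intro: add_nonneg_pos)
  have cM: "c * M > 0" using c(1) M(1) by simp
  \<comment> \<open>Makes \<open>\<epsilon>\<^sub>1\<close> (1 + l (1 + c M)) equal to |u| / 2; the
    1 stands for the deviation of x from the ray, l (1 + c M) for calmness at the shifted
    parameter.\<close>
  define \<epsilon>\<^sub>1 where "\<epsilon>\<^sub>1 = norm u / (2 * (1 + l * (1 + c * M)))"
  have den: "1 + l * (1 + c * M) > 0" using l(1) cM by (simp add: add_pos_pos)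
  have \<epsilon>\<^sub>1: "\<epsilon>\<^sub>1 > 0" using u den by (simp add: \<epsilon>\<^sub>1_def)
  define \<epsilon>\<^sub>2 where "\<epsilon>\<^sub>2 = min 1 \<epsilon>\<^sub>1"
  have \<epsilon>\<^sub>2: "\<epsilon>\<^sub>2 > 0" "\<epsilon>\<^sub>2 \<le> 1" "\<epsilon>\<^sub>2 \<le> \<epsilon>\<^sub>1" using \<epsilon>\<^sub>1 by (auto simp: \<epsilon>\<^sub>2_def)
  obtain \<delta>\<^sub>2 where \<delta>\<^sub>2: "\<delta>\<^sub>2 > 0" "\<And>y. norm (y - ?z) < \<delta>\<^sub>2 \<Longrightarrow>
      norm (f y - f ?z - D1 f ?z (y - ?z)) \<le> \<epsilon>\<^sub>2 * norm (y - ?z)"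
    using D1_has_derivative[OF diff] \<epsilon>\<^sub>2(1) unfolding has_derivative_at_alt by metis
  \<comment> \<open>Every distance that must stay inside a neighborhood is at most (M + 1 + c M) t,
    which for t < s is below the smallest radius.\<close>
  define s where "s = min (min \<delta> \<delta>\<^sub>2) (min r\<^sub>Q r\<^sub>X) / (2 * (M + 1 + c * M))"
  have sden: "2 * (M + 1 + c * M) > 0" using M(1) cM by simp
  have s: "s > 0" using c(2) \<delta>\<^sub>2(1) r\<^sub>Q(1) r\<^sub>X(1) sden by (simp add: s_def)
  have half_less: "k / 2 < k" if "k > 0" for k :: real using that by simp
  have s_le: "m * s' < \<delta>" "m * s' < \<delta>\<^sub>2" "m * s' < r\<^sub>Q" "m * s' < r\<^sub>X"
    if "0 \<le> m" "m \<le> M + 1 + c * M" "0 < s'" "s' < s" for m s'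
  proof -
    have "m * s' \<le> (M + 1 + c * M) * s" using that by (intro mult_mono) auto
    also have "\<dots> = min (min \<delta> \<delta>\<^sub>2) (min r\<^sub>Q r\<^sub>X) / 2"
    proof -
      have "n * (k / (2 * n)) = k / 2" if "2 * n > 0" for n k :: real using that by simp
      from this[OF sden] show ?thesis unfolding s_def .
    qed
    also have "\<dots> < min (min \<delta> \<delta>\<^sub>2) (min r\<^sub>Q r\<^sub>X)"
      by (rule half_less) (use c(2) \<delta>\<^sub>2(1) r\<^sub>Q(1) r\<^sub>X(1) in simp)
    finally show "m * s' < \<delta>" "m * s' < \<delta>\<^sub>2" "m * s' < r\<^sub>Q" "m * s' < r\<^sub>X" by auto
  qed
  define \<epsilon> where "\<epsilon> = min \<epsilon>\<^sub>2 s"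
  have \<epsilon>: "\<epsilon> > 0" "\<epsilon> \<le> \<epsilon>\<^sub>2" "\<epsilon> \<le> s" "\<epsilon> \<le> 1" using \<epsilon>\<^sub>2 s by (auto simp: \<epsilon>_def)
  obtain t p x y where t: "0 < t" "t < \<epsilon>" and p: "norm (p - pb) \<le> \<epsilon> * t"
    and x: "norm (x - xb - t *\<^sub>R u) \<le> \<epsilon> * t" and y: "y \<in> regular_normal_cone (Gamma g C p) x"
    and y_le: "norm (y + f ?z + t *\<^sub>R D1 f ?z (0, u)) \<le> \<epsilon> * t"
    using arc[OF \<epsilon>(1)] by blast
  have ts: "0 < t" "t < s" using t \<epsilon>(3) by auto
  have \<epsilon>t: "\<epsilon> * t \<le> \<epsilon>\<^sub>2 * t" "\<epsilon> * t \<le> t" using t(1) \<epsilon> by (auto intro: mult_right_mono)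
  have e_le: "norm (p - pb, x - xb - t *\<^sub>R u) \<le> 2 * (\<epsilon> * t)"
    using norm_Pair_le[of "p - pb" "x - xb - t *\<^sub>R u"] p x by linarith
  have split: "(p, x) - ?z = (p - pb, x - xb - t *\<^sub>R u) + t *\<^sub>R (0, u)" by simp
  have "norm ((p, x) - ?z) \<le> norm (p - pb, x - xb - t *\<^sub>R u) + norm (t *\<^sub>R (0::'p1 \<times> 'p2, u))"
    unfolding split by (rule norm_triangle_ineq)
  also have "norm (t *\<^sub>R (0::'p1 \<times> 'p2, u)) = t * norm u" using t(1) by (simp add: norm_Pair)
  also have "norm (p - pb, x - xb - t *\<^sub>R u) + t * norm u \<le> 2 * t + t * norm u"
    using e_le \<epsilon>t by linarith
  also have "\<dots> = (norm u + 2) * t" by (simp add: algebra_simps)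
  finally have z_le: "norm ((p, x) - ?z) \<le> (norm u + 2) * t" .
  have nu: "0 \<le> norm u + 2" "norm u + 2 \<le> M + 1 + c * M"
    using cM B(1) norm_ge_zero[of u] unfolding M_def by linarith+
  have z_lt: "norm ((p, x) - ?z) < \<delta>" "norm ((p, x) - ?z) < \<delta>\<^sub>2"
    using z_le s_le[OF nu ts] by linarith+
  have lin: "linear (D1 f ?z)" by (rule linear_D1[OF diff])
  have "norm (- y - f (p, x)) \<le> M * \<epsilon>\<^sub>2 * t"
  proof -
    have tri: "norm (- a - b - c) \<le> norm a + norm b + norm c" for a b c :: 'x by norm
    \<comment> \<open>The derivative at (p, x) - z splits into t times its value at (0, u), which
      cancels against the normal, and its value at the small offset.\<close>
    have "- y - f (p, x) = - (y + f ?z + t *\<^sub>R D1 f ?z (0, u)) - (f (p, x) - f ?z - D1 f ?z ((p, x) - ?z))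
        - D1 f ?z (p - pb, x - xb - t *\<^sub>R u)"
      unfolding split linear_add[OF lin] linear_cmul[OF lin] by simp
    also have "norm \<dots> \<le> norm (y + f ?z + t *\<^sub>R D1 f ?z (0, u))
        + norm (f (p, x) - f ?z - D1 f ?z ((p, x) - ?z)) + norm (D1 f ?z (p - pb, x - xb - t *\<^sub>R u))"
      by (rule tri)
    also have "\<dots> \<le> \<epsilon>\<^sub>2 * t + \<epsilon>\<^sub>2 * ((norm u + 2) * t) + B * (2 * (\<epsilon>\<^sub>2 * t))"
    proof (intro add_mono)
      show "norm (y + f ?z + t *\<^sub>R D1 f ?z (0, u)) \<le> \<epsilon>\<^sub>2 * t" using y_le \<epsilon>t(1) by linarith
      show "norm (f (p, x) - f ?z - D1 f ?z ((p, x) - ?z)) \<le> \<epsilon>\<^sub>2 * ((norm u + 2) * t)"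
        by (rule order_trans[OF \<delta>\<^sub>2(2)[OF z_lt(2)] mult_left_mono[OF z_le]]) (use \<epsilon>\<^sub>2 in simp)
      have "norm (p - pb, x - xb - t *\<^sub>R u) \<le> 2 * (\<epsilon>\<^sub>2 * t)" using e_le \<epsilon>t(1) by linarith
      then show "norm (D1 f ?z (p - pb, x - xb - t *\<^sub>R u)) \<le> B * (2 * (\<epsilon>\<^sub>2 * t))"
        by (rule order_trans[OF B(2) mult_left_mono]) (use B(1) in simp)
    qed
    also have "\<dots> = M * \<epsilon>\<^sub>2 * t" by (simp add: M_def algebra_simps)
    finally show ?thesis .
  qed
  then have res: "norm (- y - f (p, x)) \<le> M * \<epsilon>\<^sub>2 * t" .
  have M_le: "0 \<le> M" "M \<le> M + 1 + c * M" "0 \<le> 1 + c * M" "1 + c * M \<le> M + 1 + c * M"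
    using M(1) cM by auto
  have "M * \<epsilon>\<^sub>2 * t \<le> M * t" using M(1) \<epsilon>\<^sub>2 t(1) by (intro mult_right_mono mult_left_le) auto
  then have "norm (- y - f (p, x)) < \<delta>" using res s_le(1)[OF M_le(1,2) ts] by linarith
  moreover have "(p, x) \<in> ball ?z \<delta>" using z_lt(1) by (metis dist_commute dist_norm mem_ball)
  ultimately obtain q where q: "f ((p, x) + L q) = - y" "norm q \<le> c * norm (- y - f (p, x))"
    using c(3) by blast
  define p' where "p' = p + (0, q)"
  have p'x: "(p, x) + L q = (p', x)" by (simp add: L_def p'_def)
  have "Gamma g C p' = Gamma g C p"
  proof -
    have "g (p', x) = g (p, x)" for x
      using g_indep[rule_format, of "fst p" "snd p" x] g_indep[rule_format, of "fst p" "snd p + q" x]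
      by (cases p) (simp add: p'_def)
    then show ?thesis by (simp add: Gamma_def)
  qed
  then have sol: "x \<in> Ssol f g C p'" using y q(1) by (simp add: Ssol_def p'x)
  have "c * norm (- y - f (p, x)) \<le> c * (M * \<epsilon>\<^sub>2 * t)" using res c(1) by (intro mult_left_mono) auto
  then have q_le: "norm q \<le> c * M * \<epsilon>\<^sub>2 * t" using q(2) by (simp add: mult.assoc)
  have "norm (p' - pb) \<le> norm (p - pb) + norm q"
    using norm_triangle_ineq[of "p - pb" "(0, q)"] by (simp add: p'_def norm_Pair algebra_simps)
  then have p'_le: "norm (p' - pb) \<le> (1 + c * M) * \<epsilon>\<^sub>2 * t"
    using p q_le \<epsilon>t(1) by (simp add: algebra_simps)
  have "(1 + c * M) * \<epsilon>\<^sub>2 * t \<le> (1 + c * M) * t" using M_le(3) \<epsilon>\<^sub>2 t(1) by (intro mult_right_mono mult_left_le) auto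
  then have "norm (p' - pb) < r\<^sub>Q" using p'_le s_le(3)[OF M_le(3,4) ts] by linarith
  then have "p' \<in> ball pb r\<^sub>Q" by (metis dist_commute dist_norm mem_ball)
  then have "p' \<in> Q" using r\<^sub>Q(2) by blast
  have "norm (x - xb) \<le> norm ((p, x) - ?z)" using norm_snd_le[of "x - xb" "p - pb"] by simp
  then have "norm (x - xb) < r\<^sub>X" using z_le s_le(4)[OF nu ts] by linarith
  then have "x \<in> ball xb r\<^sub>X" by (metis dist_commute dist_norm mem_ball)
  then have "x \<in> X" using r\<^sub>X(2) by blast
  then have "norm (x - xb) \<le> l * norm (p' - pb)"
    using l(6)[OF \<open>p' \<in> Q\<close>] sol by (auto simp: dist_norm norm_minus_commute)
  also have "\<dots> \<le> l * ((1 + c * M) * \<epsilon>\<^sub>2 * t)" using p'_le l(1) by (intro mult_left_mono) auto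
  finally have 1: "norm (x - xb) \<le> l * ((1 + c * M) * \<epsilon>\<^sub>2 * t)" .
  have tu: "norm (t *\<^sub>R u) = t * norm u" using t(1) by simp
  have "norm (t *\<^sub>R u) \<le> norm (x - xb) + norm (x - xb - t *\<^sub>R u)"
    using norm_triangle_ineq4[of "x - xb" "x - xb - t *\<^sub>R u"] by simp
  then have "t * norm u \<le> l * ((1 + c * M) * \<epsilon>\<^sub>2 * t) + \<epsilon>\<^sub>2 * t" using 1 x \<epsilon>t(1) tu by linarith
  also have "\<dots> = t * (\<epsilon>\<^sub>2 * (1 + l * (1 + c * M)))" by (simp add: algebra_simps)
  finally have "norm u \<le> \<epsilon>\<^sub>2 * (1 + l * (1 + c * M))" using t(1) by simp
  also have "\<dots> \<le> \<epsilon>\<^sub>1 * (1 + l * (1 + c * M))" using \<epsilon>\<^sub>2(3) den by (intro mult_right_mono) auto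
  also have "\<dots> = norm u / 2"
  proof -
    have "k / (2 * n) * n = k / 2" if "n > 0" for n k :: real using that by simp
    from this[OF den] show ?thesis unfolding \<epsilon>\<^sub>1_def .
  qed
  finally show False using u by simp
qed

section \<open>Verification of (C1) and (C2)\<close>

theorem theorem6p3:
  fixes g :: "('p1::euclidean_space \<times> 'p2::euclidean_space) \<times> 'x::euclidean_space \<Rightarrow> 'y::euclidean_space"
    and f :: "('p1 \<times> 'p2) \<times> 'x \<Rightarrow> 'x"
    and C :: "'y set" and K :: "'e::euclidean_space set" and h :: "'y \<Rightarrow> 'e" and V :: "'y set"
    and pb :: "'p1 \<times> 'p2" and xb :: 'x
  assumes g_C2: "C2_around g (pb, xb)"
    and C_closed: "closed C"
    and V_open: "open V" and gV: "g (pb, xb) \<in> V" and h_C2: "C2_on V h"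
    and h_zero: "h (g (pb, xb)) = 0" and h_surj: "surj (D1 h (g (pb, xb)))"
    and reduc: "C \<inter> V = {y \<in> V. h y \<in> K}"
    and K_closed: "closed K" and K_cone: "convex_cone K"
    and f_C1: "C1_around f (pb, xb)"
    and sol: "xb \<in> Ssol f g C pb"
    and robinson: "robinson_stable g C pb xb"
    and calm: "isolatedly_calm (Ssol f g C) pb xb"
    and g_indep: "\<forall>p1 p2 x. g ((p1, p2), x) = g ((p1, snd pb), x)"
    and fp2_surj: "surj (D1 (\<lambda>p2. f ((fst pb, p2), xb)) (snd pb))"
  shows "cond_C1 f g C h pb xb \<and> (extra_cond f g C h pb xb \<longrightarrow> cond_C2 f g C h pb xb)"
proof -
  let ?z = "(pb, xb)" and ?y = "g (pb, xb)"
  let ?adj = "adjoint (D1 g ?z)" and ?mu = "mu_of h ?y"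
  let ?crit = "critical_cone (Gamma g C pb) xb (- f ?z)"
  interpret cone_reduction C V h K ?y
    by unfold_locales (fact h_C2 gV h_zero h_surj reduc K_closed K_cone)+
  have g: "twice_diff_at g ?z" using g_C2 C2_on_imp_twice_diff_at unfolding C2_around_def by blast
  obtain \<kappa> \<delta> where "reduced_system (h \<circ> g) K (Gamma g C) pb xb \<kappa> \<delta>"
    using reduced_system_compose[OF g refl robinson] by blast
  then interpret RS: reduced_system "h \<circ> g" K "Gamma g C" pb xb \<kappa> \<delta> .
  have Dg: "linear (D1 g ?z)" by (intro linear_D1 twice_diff_at_imp_differentiable g)
  have adj: "?adj l \<bullet> v = l \<bullet> D1 g ?z v" for l v
    using adjoint_works[OF Dg, of v l] by (simp add: inner_commute)
  note A_eq = twice_diff_at_compose(2)[OF g h_twice]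
  note B_eq = twice_diff_at_compose(3)[OF g h_twice]
  have f_diff: "f differentiable (at ?z)" using f_C1 unfolding C1_around_def C1_on_def by blast
  have fx: "D1 (\<lambda>x. f (pb, x)) xb u = D1 f ?z (0, u)" for u
  proof -
    have "((\<lambda>x. (pb, x)) has_derivative (\<lambda>u. (0, u))) (at xb)"
      by (auto intro!: derivative_eq_intros)
    from D1_eqI[OF diff_chain_at[OF this D1_has_derivative[OF f_diff], unfolded o_def]]
    show ?thesis by simp
  qed
  \<comment> \<open>The curvature term of \<open>h\<close> completes a chain rule: \<open>l\<close>
    acts as \<mu> after the derivative of \<open>h\<close>, so the objective selecting directional
    multipliers is \<mu> paired with the second derivative of h o g.\<close>
  have val: "l \<bullet> D2 g ?z w w + D2 (\<lambda>y. ?mu l \<bullet> h y) ?y (D1 g ?z w) (D1 g ?z w) = ?mu l \<bullet> D2 (h \<circ> g) ?z w w"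
    if "l \<in> regular_normal_cone C ?y" for l w
    by (simp add: D_inner[OF h_twice] B_eq inner_add_right normal_mu_of(2)[OF that])
  have Dir_iff: "l \<in> Lambda_dir g C h ?z zs w \<longleftrightarrow> l \<in> Lambda g C ?z zs
      \<and> (\<forall>l'\<in>Lambda g C ?z zs. ?mu l' \<bullet> D2 (h \<circ> g) ?z w w \<le> ?mu l \<bullet> D2 (h \<circ> g) ?z w w)" for l zs w
  proof -
    have "l \<in> Lambda g C ?z zs \<Longrightarrow> l \<in> regular_normal_cone C ?y" for l by (simp add: Lambda_def)
    note val = val[OF this]
    show ?thesis
      unfolding Lambda_dir_def Let_def mem_Collect_eq by (simp only: val cong: conj_cong ball_cong)
  qed
  \<comment> \<open>By the same chain rule the operator is the x-derivative of \<open>f\<close> plus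
    the x-Hessian of \<mu> paired with h o g.\<close>
  have Fop: "Fop f g h pb xb l u \<bullet> d = D1 f ?z (0, u) \<bullet> d + ?mu l \<bullet> D2 (h \<circ> g) ?z (0, u) (0, d)"
    if l: "l \<in> regular_normal_cone C ?y" for l u d
  proof -
    have gx: "twice_diff_at (\<lambda>x. g (pb, x)) xb" by (rule D_partial(1)[OF g])
    have "hess_op (\<lambda>x. l \<bullet> g (pb, x)) xb u \<bullet> d = l \<bullet> D2 g ?z (0, u) (0, d)"
    proof -
      have eq: "D2 (\<lambda>x. l \<bullet> g (pb, x)) xb u = (\<lambda>b. l \<bullet> D2 (\<lambda>x. g (pb, x)) xb u b)"
        by (rule ext) (rule D_inner[OF gx])
      have "linear (\<lambda>b. l \<bullet> D2 (\<lambda>x. g (pb, x)) xb u b)"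
        using linear_D2_right[OF gx, of u] by (intro linearI) (simp_all add: linear_add linear_cmul inner_add_right)
      then show ?thesis unfolding hess_op_def eq by (simp add: inner_dual_vec D_partial(3)[OF g])
    qed
    moreover have "Hx g h pb xb l u \<bullet> d = ?mu l \<bullet> D2 h ?y (D1 g ?z (0, u)) (D1 g ?z (0, d))"
    proof -
      have eq: "D2 (\<lambda>y. ?mu l \<bullet> h y) ?y a = (\<lambda>b. ?mu l \<bullet> D2 h ?y a b)" for a
        by (rule ext) (rule D_inner[OF h_twice])
      have "linear (\<lambda>b. ?mu l \<bullet> D2 h ?y a b)" for a
        using linear_D2_right[OF h_twice, of a] by (intro linearI) (simp_all add: linear_add linear_cmul inner_add_right)
      then have "hess_op (\<lambda>y. ?mu l \<bullet> h y) ?y a \<bullet> b = ?mu l \<bullet> D2 h ?y a b" for a b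
        unfolding hess_op_def eq by (simp add: inner_dual_vec)
      moreover have "linear (D1 (\<lambda>x. g (pb, x)) xb)"
        by (intro linear_D1 twice_diff_at_imp_differentiable gx)
      ultimately show ?thesis
        unfolding Hx_def using adjoint_works[of "D1 (\<lambda>x. g (pb, x)) xb" d]
        by (simp add: inner_commute[of _ d]) (simp add: inner_commute D_partial(2)[OF g])
    qed
    ultimately show ?thesis
      by (simp add: Fop_def inner_add_left fx B_eq inner_add_right normal_mu_of(2)[OF l])
  qed
  \<comment> \<open>Membership fixes only the x-part of the adjoint vector; its parameter part may
    vary with \<open>l\<close>.\<close>
  have bar: "l \<in> Lambda_bar f g C pb xb \<longleftrightarrow> l \<in> regular_normal_cone C ?y \<and> (\<forall>d. - f ?z \<bullet> d = ?adj l \<bullet> (0, d))" for l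
  proof -
    have "linear (D1 (\<lambda>x. g (pb, x)) xb)"
      by (intro linear_D1 twice_diff_at_imp_differentiable D_partial(1)[OF g])
    then have "d \<bullet> adjoint (D1 (\<lambda>x. g (pb, x)) xb) l = D1 g ?z (0, d) \<bullet> l" for d
      using adjoint_works[of "D1 (\<lambda>x. g (pb, x)) xb" d l] by (simp add: D_partial(2)[OF g])
    then have *: "adjoint (D1 (\<lambda>x. g (pb, x)) xb) l \<bullet> d = ?adj l \<bullet> (0, d)" for d
      unfolding adj by (metis inner_commute)
    have "f ?z + adjoint (D1 (\<lambda>x. g (pb, x)) xb) l = 0 \<longleftrightarrow> - f ?z = adjoint (D1 (\<lambda>x. g (pb, x)) xb) l"
      by (simp add: eq_neg_iff_add_eq_0 neg_eq_iff_add_eq_0)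
    also have "\<dots> \<longleftrightarrow> (\<forall>d. - f ?z \<bullet> d = ?adj l \<bullet> (0, d))"
      unfolding *[symmetric] by (rule vector_eq_rdot[symmetric])
    finally show ?thesis by (simp add: Lambda_bar_def)
  qed
  have C1: "cond_C1 f g C h pb xb"
    unfolding cond_C1_def
  proof (intro ballI impI)
    fix u l lh
    assume u: "u \<in> ?crit" "u \<noteq> 0" and l: "l \<in> Lambda_bar f g C pb xb"
      and lh: "lh \<in> Lambda_dir g C h ?z (?adj l) (0, u)"
    have lhN: "lh \<in> regular_normal_cone C ?y" and lha: "?adj lh = ?adj l"
      using lh unfolding Dir_iff Lambda_def by auto
    have a: "- f ?z \<bullet> d = ?mu lh \<bullet> RS.A (0, d)" for d
    proof -
      have "- f ?z \<bullet> d = ?adj lh \<bullet> (0, d)" using l unfolding bar lha by blast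
      then show ?thesis unfolding adj A_eq normal_mu_of(2)[OF lhN] .
    qed
    \<comment> \<open>Any multiplier describes the critical cone, since - f . w is its value on A
      (0, w); \<open>lh\<close> qualifies because it shares the adjoint vector of
      \<open>l\<close>.\<close>
    have crit: "w \<in> ?crit \<longleftrightarrow> RS.A (0, w) \<in> K \<and> ?mu lh \<bullet> RS.A (0, w) = 0" for w
      unfolding critical_cone_def RS.tangent_cone_eq a by simp
    show "Fop f g h pb xb lh u \<bullet> u > 0 \<or> (\<exists>ut \<in> ?crit. Fop f g h pb xb lh u \<bullet> ut < 0)"
    proof (rule ccontr)
      assume neg: "\<not> ?thesis"
      define \<xi> where "\<xi> = - Fop f g h pb xb lh u"
      define H where "H = Fop f g h pb xb lh u - D1 f ?z (0, u)"
      \<comment> \<open>Failure of the first alternative gives F u . u \<le> 0; failure of the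
        second one at u itself gives the reverse.\<close>
      have \<xi>u: "\<xi> \<bullet> u = 0" and \<xi>: "\<And>w. w \<in> ?crit \<Longrightarrow> \<xi> \<bullet> w \<le> 0"
        using neg u(1) by (auto simp: \<xi>_def not_less intro: antisym)
      have H: "H \<bullet> d = ?mu lh \<bullet> D2 (h \<circ> g) ?z (0, u) (0, d)" for d
        by (simp add: H_def inner_diff_left Fop[OF lhN])
      \<comment> \<open>A polar vector with the same values on the range of \<open>A\<close> comes
        from a multiplier with the same full adjoint vector, so directional maximality becomes the
        optimality required for duality.\<close>
      have max: "\<mu>' \<bullet> D2 (h \<circ> g) ?z (0, u) (0, u) \<le> ?mu lh \<bullet> D2 (h \<circ> g) ?z (0, u) (0, u)"
        if \<mu>': "\<mu>' \<in> polar_cone K" "\<And>v. \<mu>' \<bullet> RS.A v = ?mu lh \<bullet> RS.A v" for \<mu>'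
      proof -
        define l' where "l' = adjoint (D1 h ?y) \<mu>'"
        have l'N: "l' \<in> regular_normal_cone C ?y" unfolding l'_def by (rule adjoint_polar_normal[OF \<mu>'(1)])
        have mu': "?mu l' = \<mu>'" unfolding l'_def by (rule mu_of_adjoint)
        have "?adj l' \<bullet> v = ?adj l \<bullet> v" for v
          using \<mu>'(2)[of v] normal_mu_of(2)[OF l'N] normal_mu_of(2)[OF lhN]
          by (simp add: lha[symmetric] adj mu' A_eq)
        then have "?adj l' = ?adj l" by (metis vector_eq_rdot)
        then have "l' \<in> Lambda g C ?z (?adj l)" using l'N by (simp add: Lambda_def)
        then show ?thesis using lh mu' unfolding Dir_iff by auto
      qed
      note pol = normal_mu_of(1)[OF lhN]
      have uK: "RS.A (0, u) \<in> K" "?mu lh \<bullet> RS.A (0, u) = 0" using u(1) crit by auto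
      have arc: "\<exists>t p x. 0 < t \<and> t < \<epsilon> \<and> norm (p - pb) \<le> \<epsilon> * t
          \<and> norm (x - xb - t *\<^sub>R u) \<le> \<epsilon> * t \<and> x \<in> Gamma g C p \<and> ?mu lh \<bullet> (h \<circ> g) (p, x) \<ge> - \<epsilon> * t\<^sup>2"
        if "\<epsilon> > 0" for \<epsilon>
        using RS.second_order_feasible_arc[OF pol uK max that] by metis
      have "\<exists>t p x y. 0 < t \<and> t < \<epsilon> \<and> norm (p - pb) \<le> \<epsilon> * t
          \<and> norm (x - xb - t *\<^sub>R u) \<le> \<epsilon> * t \<and> y \<in> regular_normal_cone (Gamma g C p) x
          \<and> norm (y + f ?z + t *\<^sub>R D1 f ?z (0, u)) \<le> \<epsilon> * t" if "\<epsilon> > 0" for \<epsilon>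
      proof -
        obtain t p x y where "0 < t" "t < \<epsilon>" "norm (p - pb) \<le> \<epsilon> * t"
          "norm (x - xb - t *\<^sub>R u) \<le> \<epsilon> * t" "y \<in> regular_normal_cone (Gamma g C p) x"
          "norm (y - (- f ?z) - t *\<^sub>R (\<xi> + H)) \<le> \<epsilon> * t"
          using RS.normal_cone_arc[OF pol a H arc \<xi>u \<xi>[unfolded crit, OF conjI] uK(2) \<open>\<epsilon> > 0\<close>]
          by metis
        \<comment> \<open>The operator cancels, so the normal is close to - f - t D1 f (0, u), the
          form used against calmness.\<close>
        moreover have "\<xi> + H = - D1 f ?z (0, u)" by (simp add: \<xi>_def H_def)
        ultimately show ?thesis by (intro exI[of _ t] exI[of _ p] exI[of _ x] exI[of _ y]) simp
      qed
      then show False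
        by (rule isolated_calmness_contradiction[OF f_C1 calm g_indep fp2_surj u(2)])
    qed
  qed
  moreover have "cond_C2 f g C h pb xb" if extra: "extra_cond f g C h pb xb"
    unfolding cond_C2_def
  proof (intro ballI impI)
    fix u l assume u: "u \<in> ?crit" "u \<noteq> 0" and l: "l \<in> Lambda_bar f g C pb xb"
    obtain v w where w: "w \<in> lin_cone (tangent_cone C ?y)"
      and eq: "D2 (h \<circ> g) ?z (0, u) (0, u) = D1 h ?y (D1 g ?z v) + D1 h ?y w"
      using bspec[OF extra[unfolded extra_cond_def] u(1)]
      by (auto simp: D_partial[OF g] B_eq add.commute)
    \<comment> \<open>The lineality part \<open>w\<close> pairs to 0 with every normal, since w and
      - w are both tangent. What remains is l' . D1 g v, determined by \<open>zs\<close>; hence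
      every multiplier in the set is a maximiser.\<close>
    have const: "?mu l' \<bullet> D2 (h \<circ> g) ?z (0, u) (0, u) = zs \<bullet> v" if "l' \<in> Lambda g C ?z zs" for l' zs
    proof -
      have N: "l' \<in> regular_normal_cone C ?y" "?adj l' = zs" using that by (auto simp: Lambda_def)
      have "w \<in> tangent_cone C ?y" "- w \<in> tangent_cone C ?y" using w by (auto simp: lin_cone_def)
      then have "l' \<bullet> w = 0"
        using regular_normal_tangent_le_0[OF N(1), of w] regular_normal_tangent_le_0[OF N(1), of "- w"] by simp
      then show ?thesis
        unfolding eq inner_add_right normal_mu_of(2)[OF N(1), symmetric] N(2)[symmetric] adj by simp
    qed
    have "l \<in> Lambda g C ?z (?adj l)" using l by (simp add: Lambda_def bar)
    then have "l \<in> Lambda_dir g C h ?z (?adj l) (0, u)" using const by (auto simp: Dir_iff)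
    then show "Fop f g h pb xb l u \<bullet> u > 0 \<or> (\<exists>ut \<in> ?crit. Fop f g h pb xb l u \<bullet> ut < 0)"
      using C1 u l unfolding cond_C1_def by blast
  qed
  ultimately show ?thesis by blast
qed

end
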